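(* Let $y\in\mathcal{I}_{\mathbb{Z}}$ and $(p,q)\in\mathrm{Cyc}_{\mathbb{Z}}(y)$. The involution Little map $\hat{\mathcal{B}}_y$ restricts to a bijection $$\bigcup_{z\in\hat\Phi^+(y,q)}\hat{\mathcal{R}}(z)\to\bigcup_{z\in\hat\Phi^-(y,p)}\hat{\mathcal{R}}(z).$$
   Context: $S_{\mathbb{Z}}$ is the group of permutations of $\mathbb{Z}$ fixing all but finitely many integers; $s_i=(i,i+1)$; $\ell(w)$ is the number of pairs $i<j$ with $w(i)>w(j)$. The Bruhat order $<$ on $S_{\mathbb{Z}}$ is the weakest strict partial order with $w<wt$ whenever $t$ is a transposition with $\ell(w)<\ell(wt)$. $\mathcal{I}_{\mathbb{Z}}=\{y\in S_{\mathbb{Z}}:y=y^{-1}\}$; for $y,z\in\mathcal{I}_{\mathbb{Z}}$ write $y\lessdot_{\mathcal{I}}z$ if $\{y\}=\{\sigma\in\mathcal{I}_{\mathbb{Z}}:y\le\sigma<z\}$. $\mathrm{Cyc}_{\mathbb{Z}}(y)=\{(i,j)\in\mathbb{Z}\times\mathbb{Z}:i\le j=y(i)\}$. The Demazure product is the unique associative map $\circ:S_{\mathbb{Z}}\times S_{\mathbb{Z}}\to S_{\mathbb{Z}}$ with $u\circ v=uv$ if $\ell(uv)=\ell(u)+\ell(v)$ and $s_i\circ s_i=s_i$. For $z\in\mathcal{I}_{\mathbb{Z}}$, $\hat{\mathcal{R}}(z)$ (the involution words of $z$) is the set of all reduced words $(s_{i_1},\dots,s_{i_k})$ of all minimal-length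 $w\in S_{\mathbb{Z}}$ with $z=w^{-1}\circ w$; equivalently, the minimal-length sequences with $z=s_{i_k}\circ\cdots\circ s_{i_1}\circ\cdots\circ s_{i_k}$ (with $s_{i_1}$ appearing once, in the middle). The maps $\tau_{ij}$: for $y\in\mathcal{I}_{\mathbb{Z}}$ and $i<j$ let $A=\{i,j,y(i),y(j)\}$. Then $\tau_{ij}(y)$ is the involution $z$ that agrees with $y$ on $\mathbb{Z}\setminus A$ and whose restriction to the $y$-invariant set $A$ is as follows (restrictions are written by their 2-cycles; unlisted elements of $A$ are fixed). (1) $A=\{a<b\}$, $y|_A=1$, $(i,j)=(a,b)$: $z|_A=(a,b)$. (2) $A=\{a<b<c\}$, $y|_A=(a,b)$, $(i,j)\in\{(b,c),(a,c)\}$: $z|_A=(a,c)$. (3) $A=\{a<b<c\}$, $y|_A=(b,c)$, $(i,j)\in\{(a,b),(a,c)\}$: $z|_A=(a,c)$. (4) $A=\{a<b<c<d\}$, $y|_A=(a,b)(c,d)$, $(i,j)=(b,c)$: $z|_A=(a,c)(b,d)$. (5) $A=\{a<b<c<d\}$, $y|_A=(a,b)(c,d)$, $(i,j)\in\{(a,c),(b,d),(a,d)\}$: $z|_A=(a,d)$. (6) $A=\{a<b<c<d\}$, $y|_A=(a,c)(b,d)$, $(i,j)\in\{(a,b),(c,d),(a,d)\}$: $z|_A=(a,d)(b,c)$. In all other cases $\tau_{ij}(y)=y$. For $r\in\mathbb{Z}$: $\hat\Phi^+(y,r)=\{z\in\mathcal{I}_{\mathbb{Z}}:y\lessdot_{\mathcal{I}}z$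 and $z=\tau_{rj}(y)$ for an integer $j>r\}$ and $\hat\Phi^-(y,r)=\{z\in\mathcal{I}_{\mathbb{Z}}:y\lessdot_{\mathcal{I}}z$ and $z=\tau_{ir}(y)$ for an integer $i<r\}$. The involution Little map: for a sequence $\mathbf{a}=(s_{a_1},\dots,s_{a_k})$ of simple transpositions and $i\in\{1,\dots,k\}$, let $\mathrm{del}_i(\mathbf{a})$ be $\mathbf{a}$ with its $i$th entry deleted. $(\mathbf{a},i)$ is a $y$-marked involution word if $\mathrm{del}_i(\mathbf{a})\in\hat{\mathcal{R}}(y)$; it is reduced if $\mathbf{a}\in\hat{\mathcal{R}}(z)$ for some $z\in\mathcal{I}_{\mathbb{Z}}$. It is known that if a $y$-marked involution word $(\mathbf{a},i)$ is not reduced then there is a unique index $j\ne i$ such that $(\mathbf{a},j)$ is a $y$-marked involution word. For a $y$-marked involution word $(\mathbf{a},i)$, define $(\mathbf{a},i){\downarrow}=(\mathbf{b},j)$, where $\mathbf{b}=(s_{a_1},\dots,s_{a_{i-1}},s_{a_i-1},s_{a_{i+1}},\dots,s_{a_k})$, and $j=i$ if $\mathbf{b}$ is an involution word of some element of $\mathcal{I}_{\mathbb{Z}}$, while otherwise $j$ is the unique index distinct from $i$ such that $(\mathbf{b},j)$ is a $y$-marked involution word. Define $\hat{\mathcal{B}}(\mathbf{a},i)$ as the result of applying $\downarrow$ to $(\mathbf{a},i)$ exactly $N$ times, where $N>0$ is the least positive integer for which the result is reduced (such $N$ exists). If $y\lessdot_{\mathcal{I}}z$ and $\mathbf{a}\in\hat{\mathcal{R}}(z)$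 then there is a unique index $i$ such that $(\mathbf{a},i)$ is a reduced $y$-marked involution word; define $\hat{\mathcal{B}}_y(\mathbf{a})=\mathbf{b}$ where $\hat{\mathcal{B}}(\mathbf{a},i)=(\mathbf{b},j)$. This makes $\hat{\mathcal{B}}_y$ a map from $\bigcup_z\hat{\mathcal{R}}(z)$ to itself, the union over $z\in\mathcal{I}_{\mathbb{Z}}$ with $y\lessdot_{\mathcal{I}}z$. *)

theory Defs
  imports "HOL-Combinatorics.Perm"
begin

unbundle permutation_syntax

text \<open>
  The group of permutations of the integers fixing all but finitely many points is the
  library type \<^typ>\<open>int perm\<close>; its multiplication is composition of functions.
\<close>


subsection \<open>Length, Bruhat order, involutions\<close>

definition simple :: "int \<Rightarrow> int perm" where
  "simple i = \<langle>i \<leftrightarrow> i + 1\<rangle>"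

definition inversions :: "int perm \<Rightarrow> (int \<times> int) set" where
  "inversions w = {(i, j). i < j \<and> w \<langle>$\<rangle> i > w \<langle>$\<rangle> j}"

definition perm_length :: "int perm \<Rightarrow> nat" where
  "perm_length w = card (inversions w)"

text \<open>
  The weakest strict partial order containing the relations \<open>w < w t\<close> is their transitive
  closure: see \<open>bruhat_less_irrefl\<close> and \<open>bruhat_less_least\<close> below.
\<close>

inductive bruhat_less :: "int perm \<Rightarrow> int perm \<Rightarrow> bool" (infix \<open>\<prec>\<close> 50) where
  base: "a \<noteq> b \<Longrightarrow> perm_length w < perm_length (w * \<langle>a \<leftrightarrow> b\<rangle>) \<Longrightarrow> w \<prec> w * \<langle>a \<leftrightarrow> b\<rangle>"
| trans: "u \<prec> v \<Longrightarrow> v \<prec> w \<Longrightarrow> u \<prec> w"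

definition bruhat_le :: "int perm \<Rightarrow> int perm \<Rightarrow> bool" (infix \<open>\<preceq>\<close> 50) where
  "u \<preceq> v \<longleftrightarrow> u = v \<or> u \<prec> v"

lemma bruhat_less_length: "u \<prec> v \<Longrightarrow> perm_length u < perm_length v"
  by (induction rule: bruhat_less.induct) auto

lemma bruhat_less_irrefl: "\<not> u \<prec> u"
  using bruhat_less_length by blast

lemma bruhat_less_least:
  assumes "transp R"
    and "\<And>w a b. a \<noteq> b \<Longrightarrow> perm_length w < perm_length (w * \<langle>a \<leftrightarrow> b\<rangle>) \<Longrightarrow> R w (w * \<langle>a \<leftrightarrow> b\<rangle>)"
    and "u \<prec> v"
  shows "R u v"
  using assms(3) by (induction rule: bruhat_less.induct) (auto intro: assms(2) transpD[OF assms(1)])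

definition invols :: "int perm set" where
  "invols = {y. y = inverse y}"

definition invol_covers :: "int perm \<Rightarrow> int perm \<Rightarrow> bool" where
  "invol_covers y z \<longleftrightarrow>
     y \<in> invols \<and> z \<in> invols \<and> {y} = {\<sigma> \<in> invols. y \<preceq> \<sigma> \<and> \<sigma> \<prec> z}"

definition Cyc :: "int perm \<Rightarrow> (int \<times> int) set" where
  "Cyc y = {(i, j). i \<le> j \<and> j = y \<langle>$\<rangle> i}"


subsection \<open>The Demazure product\<close>

definition is_demazure :: "(int perm \<Rightarrow> int perm \<Rightarrow> int perm) \<Rightarrow> bool" where
  "is_demazure f \<longleftrightarrow>
     (\<forall>u v w. f (f u v) w = f u (f v w)) \<and>
     (\<forall>u v. perm_length (u * v) = perm_length u + perm_length v \<longrightarrow> f u v = u * v) \<and>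
     (\<forall>i. f (simple i) (simple i) = simple i)"

text \<open>Existence and uniqueness are proved at the end of this theory (\<open>ex1_demazure\<close>).\<close>

definition demazure :: "int perm \<Rightarrow> int perm \<Rightarrow> int perm" (infixl \<open>\<circ>\<^sub>D\<close> 70) where
  "demazure = (THE f. is_demazure f)"


subsection \<open>Involution words\<close>

text \<open>The word \<open>(s\<^bsub>a1\<^esub>, \<dots>, s\<^bsub>ak\<^esub>)\<close> is encoded by its list of indices \<open>[a1, \<dots>, ak]\<close>.\<close>

definition word_prod :: "int list \<Rightarrow> int perm" where
  "word_prod a = prod_list (map simple a)"

definition reduced_words :: "int perm \<Rightarrow> int list set" where
  "reduced_words w = {a. is_arg_min length (\<lambda>a. word_prod a = w) a}"

definition invol_words :: "int perm \<Rightarrow> int list set" where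
  "invol_words z =
     (\<Union>w \<in> {w. is_arg_min perm_length (\<lambda>w. z = inverse w \<circ>\<^sub>D w) w}. reduced_words w)"


subsection \<open>The maps \<open>\<tau>\<close>\<close>

text \<open>
  \<open>splice A \<rho> y\<close> agrees with \<open>\<rho>\<close> on \<open>A\<close> and with \<open>y\<close> elsewhere; it is a permutation as soon
  as both \<open>\<rho>\<close> and \<open>y\<close> preserve \<open>A\<close> (\<open>apply_splice\<close>).
\<close>

definition splice :: "int set \<Rightarrow> int perm \<Rightarrow> int perm \<Rightarrow> int perm" where
  "splice A \<rho> y = Perm.Perm (\<lambda>x. if x \<in> A then \<rho> \<langle>$\<rangle> x else y \<langle>$\<rangle> x)"

definition agree_on :: "int set \<Rightarrow> int perm \<Rightarrow> int perm \<Rightarrow> bool" where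
  "agree_on A y \<rho> \<longleftrightarrow> (\<forall>x \<in> A. y \<langle>$\<rangle> x = \<rho> \<langle>$\<rangle> x)"

definition tau :: "int \<Rightarrow> int \<Rightarrow> int perm \<Rightarrow> int perm" where
  "tau i j y = (let A = {i, j, y \<langle>$\<rangle> i, y \<langle>$\<rangle> j} in
     case sorted_list_of_set A of
       [a, b] \<Rightarrow>
         if agree_on A y 1 \<and> (i, j) = (a, b) then splice A \<langle>a \<leftrightarrow> b\<rangle> y
         else y
     | [a, b, c] \<Rightarrow>
         if agree_on A y \<langle>a \<leftrightarrow> b\<rangle> \<and> (i, j) \<in> {(b, c), (a, c)} then splice A \<langle>a \<leftrightarrow> c\<rangle> y
         else if agree_on A y \<langle>b \<leftrightarrow> c\<rangle> \<and> (i, j) \<in> {(a, b), (a, c)} then splice A \<langle>a \<leftrightarrow> c\<rangle> y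
         else y
     | [a, b, c, d] \<Rightarrow>
         if agree_on A y (\<langle>a \<leftrightarrow> b\<rangle> * \<langle>c \<leftrightarrow> d\<rangle>) \<and> (i, j) = (b, c)
           then splice A (\<langle>a \<leftrightarrow> c\<rangle> * \<langle>b \<leftrightarrow> d\<rangle>) y
         else if agree_on A y (\<langle>a \<leftrightarrow> b\<rangle> * \<langle>c \<leftrightarrow> d\<rangle>) \<and> (i, j) \<in> {(a, c), (b, d), (a, d)}
           then splice A \<langle>a \<leftrightarrow> d\<rangle> y
         else if agree_on A y (\<langle>a \<leftrightarrow> c\<rangle> * \<langle>b \<leftrightarrow> d\<rangle>) \<and> (i, j) \<in> {(a, b), (c, d), (a, d)}
           then splice A (\<langle>a \<leftrightarrow> d\<rangle> * \<langle>b \<leftrightarrow> c\<rangle>) y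
         else y
     | _ \<Rightarrow> y)"

definition Phi_plus :: "int perm \<Rightarrow> int \<Rightarrow> int perm set" where
  "Phi_plus y r = {z \<in> invols. invol_covers y z \<and> (\<exists>j > r. z = tau r j y)}"

definition Phi_minus :: "int perm \<Rightarrow> int \<Rightarrow> int perm set" where
  "Phi_minus y r = {z \<in> invols. invol_covers y z \<and> (\<exists>i < r. z = tau i r y)}"


subsection \<open>The involution Little map\<close>

text \<open>Positions in a word are counted from \<open>0\<close>, as usual for lists.\<close>

definition del :: "nat \<Rightarrow> 'a list \<Rightarrow> 'a list" where
  "del i a = take i a @ drop (Suc i) a"

definition is_invol_word :: "int list \<Rightarrow> bool" where
  "is_invol_word a \<longleftrightarrow> (\<exists>z \<in> invols. a \<in> invol_words z)"

definition marked :: "int perm \<Rightarrow> int list \<times> nat \<Rightarrow> bool" where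
  "marked y = (\<lambda>(a, i). i < length a \<and> del i a \<in> invol_words y)"

definition little_step :: "int perm \<Rightarrow> int list \<times> nat \<Rightarrow> int list \<times> nat" where
  "little_step y = (\<lambda>(a, i).
     let b = a[i := a ! i - 1] in
     (b, if is_invol_word b then i else THE j. j \<noteq> i \<and> marked y (b, j)))"

definition little_marked :: "int perm \<Rightarrow> int list \<times> nat \<Rightarrow> int list \<times> nat" where
  "little_marked y m =
     (little_step y ^^ (LEAST N. N > 0 \<and> is_invol_word (fst ((little_step y ^^ N) m)))) m"

text \<open>
  Meaningful only on involution words of the \<open>z\<close> covering \<open>y\<close>, as both the index and the
  number of steps are then well defined.
\<close>

definition little_map :: "int perm \<Rightarrow> int list \<Rightarrow> int list" where
  "little_map y a = fst (little_marked y (a, THE i. marked y (a, i) \<and> is_invol_word a))"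


subsection \<open>Well-definedness\<close>

lemma apply_splice:
  assumes "apply \<rho> ` A = A" "apply y ` A = A"
  shows "splice A \<rho> y \<langle>$\<rangle> x = (if x \<in> A then \<rho> \<langle>$\<rangle> x else y \<langle>$\<rangle> x)"
proof -
  let ?f = "\<lambda>x. if x \<in> A then \<rho> \<langle>$\<rangle> x else y \<langle>$\<rangle> x"
  have "bij_betw (apply \<rho>) A A" "bij_betw (apply y) A A"
    using assms by (auto simp: bij_betw_def inj_on_def apply_inj)
  moreover have "apply y ` (- A) = - A"
    using assms(2) by (metis bij_apply bij_image_Compl_eq)
  then have "bij_betw (apply y) (- A) (- A)"
    by (auto simp: bij_betw_def inj_on_def apply_inj)
  ultimately have "bij_betw ?f (A \<union> - A) (A \<union> - A)"
    by (intro bij_betw_combine)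
      (auto simp: bij_betw_def inj_on_def)
  then have "bij ?f" by simp
  moreover have "finite {x. ?f x \<noteq> x}"
    by (rule finite_subset[of _ "affected \<rho> \<union> affected y"]) (auto simp: in_affected)
  ultimately show ?thesis
    unfolding splice_def by (subst Perm_inverse) auto
qed

lemma finite_inversions: "finite (inversions w)"
proof (cases "affected w = {}")
  case True
  then have "inversions w = {}" by (auto simp: inversions_def)
  then show ?thesis by simp
next
  case False
  define m M where "m = Min (affected w)" and "M = Max (affected w)"
  have *: "m \<le> x" "x \<le> M" if "x \<in> affected w" for x
    using that by (auto simp: m_def M_def)
  have fix_out: "w \<langle>$\<rangle> x = x" if "x < m \<or> x > M" for x
    using *[of x] that by (force simp: in_affected)
  have stay: "m \<le> w \<langle>$\<rangle> x \<and> w \<langle>$\<rangle> x \<le> M" if "m \<le> x" "x \<le> M" for x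
    using *[of "w \<langle>$\<rangle> x"] that apply_affected[of w x]
    by (cases "x \<in> affected w") (simp_all del: apply_affected add: in_affected[of x])
  have "(i, j) \<in> {m..M} \<times> {m..M}" if "i < j" "w \<langle>$\<rangle> i > w \<langle>$\<rangle> j" for i j
    using that fix_out[of i] fix_out[of j] stay[of i] stay[of j]
    by (cases "i < m"; cases "i > M"; cases "j < m"; cases "j > M") auto
  then have "inversions w \<subseteq> {m..M} \<times> {m..M}"
    by (auto simp: inversions_def)
  then show ?thesis
    by (rule finite_subset) simp
qed

lemma apply_simple:
  "simple i \<langle>$\<rangle> x = (if x = i then i + 1 else if x = i + 1 then i else x)"
  unfolding simple_def by (cases "x = i"; cases "x = i + 1") auto

lemma simple_simple: "simple i * simple i = 1"
  by (simp add: simple_def)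

lemma mult_simple_simple: "u * simple i * simple i = u"
  by (simp add: simple_simple mult.assoc)

lemma inverse_simple: "inverse (simple i) = simple i"
  by (simp add: simple_def)

lemma length_mult_simple_asc:
  assumes "u \<langle>$\<rangle> i < u \<langle>$\<rangle> (i + 1)"
  shows "perm_length (u * simple i) = perm_length u + 1"
proof -
  let ?h = "\<lambda>(a, b). (simple i \<langle>$\<rangle> a, simple i \<langle>$\<rangle> b)"
  have "inversions (u * simple i) = insert (i, i + 1) (?h ` inversions u)"
  proof (intro equalityI subsetI)
    fix p assume "p \<in> inversions (u * simple i)"
    then obtain a b where p: "p = (a, b)" "a < b"
      "u \<langle>$\<rangle> (simple i \<langle>$\<rangle> a) > u \<langle>$\<rangle> (simple i \<langle>$\<rangle> b)"
      by (auto simp: inversions_def apply_times)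
    show "p \<in> insert (i, i + 1) (?h ` inversions u)"
    proof (cases "p = (i, i + 1)")
      case False
      then have "simple i \<langle>$\<rangle> a < simple i \<langle>$\<rangle> b"
        using p by (auto simp: apply_simple)
      then have "(simple i \<langle>$\<rangle> a, simple i \<langle>$\<rangle> b) \<in> inversions u"
        using p by (auto simp: inversions_def)
      moreover have "p = ?h (simple i \<langle>$\<rangle> a, simple i \<langle>$\<rangle> b)"
        using p by (auto simp: apply_simple)
      ultimately show ?thesis by blast
    qed simp
  next
    fix p assume p: "p \<in> insert (i, i + 1) (?h ` inversions u)"
    show "p \<in> inversions (u * simple i)"
    proof (cases "p = (i, i + 1)")
      case True
      then show ?thesis using assms by (auto simp: inversions_def apply_times apply_simple)
    next
      case False
      then obtain a b where ab: "p = (simple i \<langle>$\<rangle> a, simple i \<langle>$\<rangle> b)" "a < b"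
        "u \<langle>$\<rangle> a > u \<langle>$\<rangle> b"
        using p by (auto simp: inversions_def)
      then have "(a, b) \<noteq> (i, i + 1)" using assms by auto
      then have "simple i \<langle>$\<rangle> a < simple i \<langle>$\<rangle> b"
        using ab by (auto simp: apply_simple)
      moreover have "simple i \<langle>$\<rangle> (simple i \<langle>$\<rangle> x) = x" for x
        by (auto simp: apply_simple)
      ultimately show ?thesis
        using ab by (auto simp: inversions_def apply_times)
    qed
  qed
  moreover have "(i, i + 1) \<notin> ?h ` inversions u"
    by (auto simp: inversions_def apply_simple split: if_splits)
  moreover have "inj_on ?h (inversions u)"
    by (auto simp: inj_on_def apply_inj)
  ultimately show ?thesis
    by (simp add: perm_length_def finite_inversions card_image)
qed

lemma length_mult_simple_desc:
  assumes "u \<langle>$\<rangle> i > u \<langle>$\<rangle> (i + 1)"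
  shows "perm_length u = perm_length (u * simple i) + 1"
proof -
  have "(u * simple i) \<langle>$\<rangle> i < (u * simple i) \<langle>$\<rangle> (i + 1)"
    using assms by (simp add: apply_times apply_simple)
  from length_mult_simple_asc[OF this] show ?thesis
    by (simp add: mult_simple_simple)
qed

lemma asc_or_desc: "u \<langle>$\<rangle> i < u \<langle>$\<rangle> (i + 1) \<or> u \<langle>$\<rangle> i > u \<langle>$\<rangle> (i + (1::int))" for u :: "int perm"
  using apply_inj[of u i "i + 1"] by linarith

lemma ex_descent:
  fixes u :: "int perm"
  assumes "u \<noteq> 1"
  shows "\<exists>i. u \<langle>$\<rangle> i > u \<langle>$\<rangle> (i + 1)"
proof (rule ccontr)
  assume "\<not> ?thesis"
  then have asc: "u \<langle>$\<rangle> i < u \<langle>$\<rangle> (i + 1)" for i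
    using asc_or_desc[of u i] by auto
  have mono: "u \<langle>$\<rangle> i - i \<le> u \<langle>$\<rangle> (i + int n) - (i + int n)" for i n
  proof (induction n)
    case (Suc n)
    then show ?case using asc[of "i + int n"] by (simp add: algebra_simps)
  qed simp
  have mono': "u \<langle>$\<rangle> i - i \<le> u \<langle>$\<rangle> j - j" if "i \<le> j" for i j
    using mono[of i "nat (j - i)"] that by simp
  obtain b where b: "\<And>x. x \<in> affected u \<Longrightarrow> \<bar>x\<bar> \<le> b"
    using finite_imageI[OF finite_affected[of u], of abs] by (meson Max_ge imageI)
  have "u \<langle>$\<rangle> x = x" for x
  proof -
    define c where "c = \<bar>b\<bar> + \<bar>x\<bar> + 1"
    have "c \<notin> affected u" "- c \<notin> affected u"
      using b[of c] b[of "- c"] by (auto simp: c_def)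
    moreover have "x \<le> c" "- c \<le> x"
      by (auto simp: c_def)
    ultimately show ?thesis
      using mono'[of x c] mono'[of "- c" x] by (simp add: in_affected)
  qed
  then show False
    using assms by (auto intro: perm_eqI)
qed

lemma perm_length_one [simp]: "perm_length 1 = 0"
proof -
  have "inversions 1 = {}" by (auto simp: inversions_def)
  then show ?thesis by (simp add: perm_length_def)
qed

lemma perm_induct [case_names one step]:
  assumes "P 1"
    and "\<And>v i. v \<langle>$\<rangle> i < v \<langle>$\<rangle> (i + 1) \<Longrightarrow> P v \<Longrightarrow> P (v * simple i)"
  shows "P u"
proof (induction "perm_length u" arbitrary: u rule: less_induct)
  case less
  show ?case
  proof (cases "u = 1")
    case False
    then obtain i where i: "u \<langle>$\<rangle> i > u \<langle>$\<rangle> (i + 1)" using ex_descent by blast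
    then have "P (u * simple i)"
      using length_mult_simple_desc[OF i] by (intro less) simp
    moreover have "(u * simple i) \<langle>$\<rangle> i < (u * simple i) \<langle>$\<rangle> (i + 1)"
      using i by (simp add: apply_times apply_simple)
    ultimately have "P (u * simple i * simple i)" by (rule assms(2)[rotated])
    then show ?thesis by (simp add: mult_simple_simple)
  qed (simp add: assms)
qed

lemma length_mult_simple_le: "perm_length (u * simple i) \<le> perm_length u + 1"
  using asc_or_desc[of u i] length_mult_simple_asc[of u i] length_mult_simple_desc[of u i] by auto

lemma length_mult_le: "perm_length (u * v) \<le> perm_length u + perm_length v"
proof (induction v rule: perm_induct)
  case (step v i)
  then show ?case
    using length_mult_simple_le[of "u * v" i] length_mult_simple_asc[of v i]
    by (simp add: mult.assoc)
qed simp

definition hecke_right :: "int \<Rightarrow> int perm \<Rightarrow> int perm" where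
  "hecke_right i u = (if u \<langle>$\<rangle> i < u \<langle>$\<rangle> (i + 1) then u * simple i else u)"

definition hecke_left :: "int \<Rightarrow> int perm \<Rightarrow> int perm" where
  "hecke_left i u = inverse (hecke_right i (inverse u))"

lemma perm_inverse_inverse: "inverse (inverse u) = (u :: int perm)"
  using perm.inverse_inverse by blast

lemma apply_inverse_eq: "inverse u \<langle>$\<rangle> x = y \<longleftrightarrow> u \<langle>$\<rangle> y = (x :: int)"
  unfolding apply_inverse by (metis bij_apply bij_inv_eq_iff)

lemma hecke_left_eq:
  "hecke_left i u = (if inverse u \<langle>$\<rangle> i < inverse u \<langle>$\<rangle> (i + 1) then simple i * u else u)"
  by (simp add: hecke_left_def hecke_right_def inverse_simple perm_inverse_inverse)

lemma hecke_commute: "hecke_right j (hecke_left i u) = hecke_left i (hecke_right j u)"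
proof -
  define p q where "p = inverse u \<langle>$\<rangle> i" and "q = inverse u \<langle>$\<rangle> (i + 1)"
  have pq: "u \<langle>$\<rangle> p = i" "u \<langle>$\<rangle> q = i + 1" "p \<noteq> q"
    using apply_inverse_eq[of u i p] apply_inverse_eq[of u "i + 1" q] by (auto simp: p_def q_def apply_inj)
  have p_iff: "u \<langle>$\<rangle> x = i \<longleftrightarrow> x = p" and q_iff: "u \<langle>$\<rangle> x = i + 1 \<longleftrightarrow> x = q" for x
    using apply_inj[of u x p] apply_inj[of u x q] pq by auto
  have inv': "inverse (u * simple j) \<langle>$\<rangle> x = simple j \<langle>$\<rangle> (inverse u \<langle>$\<rangle> x)" for x
    by (simp add: inverse_simple apply_times)
  show ?thesis
  proof (cases "{p, q} = {j, j + 1}")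
    case True
    then consider "p = j" "q = j + 1" | "p = j + 1" "q = j"
      by (auto simp: doubleton_eq_iff)
    then show ?thesis
    proof cases
      case 1
      have "simple i * u = u * simple j"
        using pq(1,2) p_iff q_iff 1 by (intro perm_eqI) (simp add: apply_times apply_simple, metis)
      then show ?thesis
        using 1 pq inv'[of i] inv'[of "i + 1"]
        by (auto simp: hecke_left_eq hecke_right_def apply_times apply_simple
            simp flip: p_def q_def)
    next
      case 2
      then show ?thesis
        using pq by (auto simp: hecke_left_eq hecke_right_def simp flip: p_def q_def)
    qed
  next
    case False
    have "(simple i * u) \<langle>$\<rangle> j < (simple i * u) \<langle>$\<rangle> (j + 1) \<longleftrightarrow> u \<langle>$\<rangle> j < u \<langle>$\<rangle> (j + 1)"
      using False p_iff[of j] p_iff[of "j + 1"] q_iff[of j] q_iff[of "j + 1"]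
        apply_inj[of u j "j + 1"]
      by (auto simp: apply_times apply_simple)
    moreover have "inverse (u * simple j) \<langle>$\<rangle> i < inverse (u * simple j) \<langle>$\<rangle> (i + 1)
        \<longleftrightarrow> p < q"
      unfolding inv' p_def[symmetric] q_def[symmetric]
      using False pq by (auto simp: apply_simple)
    ultimately show ?thesis
      by (auto simp: hecke_left_eq hecke_right_def mult.assoc simp flip: p_def q_def)
  qed
qed

inductive_set hecke_ops :: "(int \<Rightarrow> int perm \<Rightarrow> int perm) \<Rightarrow> (int perm \<Rightarrow> int perm) set"
  for T where
  id: "id \<in> hecke_ops T"
| step: "f \<in> hecke_ops T \<Longrightarrow> T i \<circ> f \<in> hecke_ops T"

lemma hecke_ops_comp: "f \<in> hecke_ops T \<Longrightarrow> g \<in> hecke_ops T \<Longrightarrow> f \<circ> g \<in> hecke_ops T"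
  by (induction rule: hecke_ops.induct) (auto simp: comp_assoc intro: hecke_ops.step)

lemma hecke_ops_commute:
  assumes "f \<in> hecke_ops hecke_right" "g \<in> hecke_ops hecke_left"
  shows "f (g u) = g (f u)"
proof -
  have 1: "hecke_right i (g u) = g (hecke_right i u)" for i u
    using assms(2) by (induction rule: hecke_ops.induct) (auto simp: hecke_commute)
  show ?thesis
    using assms(1) by (induction rule: hecke_ops.induct) (auto simp: 1)
qed

lemma ex_hecke_right: "\<exists>f \<in> hecke_ops hecke_right. f 1 = u"
proof (induction u rule: perm_induct)
  case one
  then show ?case by (auto intro!: bexI[of _ id] hecke_ops.id)
next
  case (step v i)
  then obtain f where "f \<in> hecke_ops hecke_right" "f 1 = v" by blast
  then show ?case
    using step(1) by (intro bexI[of _ "hecke_right i \<circ> f"])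
      (auto intro: hecke_ops.step, simp add: hecke_right_def)
qed

lemma ex_hecke_left: "\<exists>g \<in> hecke_ops hecke_left. g 1 = u"
proof -
  have "\<exists>g \<in> hecke_ops hecke_left. g 1 = inverse u" for u
  proof (induction u rule: perm_induct)
    case one
    then show ?case by (auto intro!: bexI[of _ id] hecke_ops.id)
  next
    case (step v i)
    then obtain f where "f \<in> hecke_ops hecke_left" "f 1 = inverse v" by blast
    then show ?case
      using step(1) by (intro bexI[of _ "hecke_left i \<circ> f"])
        (auto intro: hecke_ops.step,
          simp add: hecke_left_def hecke_right_def perm_inverse_inverse inverse_simple)
  qed
  from this[of "inverse u"] show ?thesis by (simp add: perm_inverse_inverse)
qed

lemma hecke_ops_eqI:
  assumes "f \<in> hecke_ops hecke_right" "f' \<in> hecke_ops hecke_right" "f 1 = f' 1"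
  shows "f = f'"
proof
  fix u
  obtain g where "g \<in> hecke_ops hecke_left" "g 1 = u" using ex_hecke_left by blast
  then show "f u = f' u"
    using assms hecke_ops_commute by metis
qed

lemma ex_is_demazure: "\<exists>f. is_demazure f"
proof -
  define R where "R v = (THE f. f \<in> hecke_ops hecke_right \<and> f 1 = v)" for v
  have "\<exists>!f. f \<in> hecke_ops hecke_right \<and> f 1 = v" for v
    using ex_hecke_right[of v] hecke_ops_eqI by metis
  from theI'[OF this] have R: "R v \<in> hecke_ops hecke_right" "R v 1 = v" for v
    by (auto simp: R_def)
  have R_eq: "R v = f" if "f \<in> hecke_ops hecke_right" "f 1 = v" for f v
    using that R hecke_ops_eqI by metis
  have R_step: "R (v * simple i) = hecke_right i \<circ> R v" if "v \<langle>$\<rangle> i < v \<langle>$\<rangle> (i + 1)" for v i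
    using that R[of v] by (intro R_eq) (auto intro: hecke_ops.step simp: hecke_right_def)
  have R_one: "R 1 = id"
    by (intro R_eq hecke_ops.id) auto
  have "R w (R v u) = R (R w v) u" for u v w
    using R_eq[OF hecke_ops_comp[OF R(1)[of w] R(1)[of v]]] R(2) by auto
  moreover have "R v u = u * v" if "perm_length (u * v) = perm_length u + perm_length v" for u v
    using that
  proof (induction v rule: perm_induct)
    case (step v i)
    have "perm_length (u * v) = perm_length u + perm_length v"
      and asc: "perm_length (u * v * simple i) > perm_length (u * v)"
      using step(3) length_mult_le[of u v] length_mult_simple_le[of "u * v" i]
        length_mult_simple_asc[OF step(1)] by (auto simp: mult.assoc)
    then have "R v u = u * v" by (intro step)
    moreover have "(u * v) \<langle>$\<rangle> i < (u * v) \<langle>$\<rangle> (i + 1)"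
      using asc asc_or_desc[of "u * v" i] length_mult_simple_desc[of "u * v" i] by auto
    ultimately show ?case
      by (simp add: R_step[OF step(1)] hecke_right_def mult.assoc)
  qed (simp add: R_one)
  moreover have "R (simple i) (simple i) = simple i" for i
    using R_step[of 1 i] by (simp add: R_one hecke_right_def apply_simple)
  ultimately have "is_demazure (\<lambda>u v. R v u)"
    by (simp add: is_demazure_def)
  then show ?thesis by blast
qed

lemma is_demazure_simple:
  assumes "is_demazure f"
  shows "f u (simple i) = hecke_right i u"
proof -
  have len: "perm_length (simple i) = 1"
    using length_mult_simple_asc[of 1 i] by simp
  have asc: "f v (simple i) = v * simple i" if "v \<langle>$\<rangle> i < v \<langle>$\<rangle> (i + 1)" for v
    using assms length_mult_simple_asc[OF that] len by (simp add: is_demazure_def)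
  show ?thesis
  proof (cases "u \<langle>$\<rangle> i < u \<langle>$\<rangle> (i + 1)")
    case False
    define v where "v = u * simple i"
    have "v \<langle>$\<rangle> i < v \<langle>$\<rangle> (i + 1)"
      using False asc_or_desc[of u i] by (simp add: v_def apply_times apply_simple)
    then have "f v (simple i) = u" by (simp add: asc v_def mult_simple_simple)
    then have "f u (simple i) = u"
      using assms unfolding is_demazure_def by metis
    then show ?thesis using False by (simp add: hecke_right_def)
  qed (simp add: asc hecke_right_def)
qed

theorem ex1_demazure: "\<exists>!f. is_demazure f"
proof (rule ex_ex1I[OF ex_is_demazure])
  fix f g assume f: "is_demazure f" and g: "is_demazure g"
  have "f u v = g u v" for u v
  proof (induction v rule: perm_induct)
    case one
    then show ?case using f g by (simp add: is_demazure_def)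
  next
    case (step v i)
    have *: "h u (v * simple i) = hecke_right i (h u v)" if h: "is_demazure h" for h
    proof -
      have "h v (simple i) = v * simple i"
        using step(1) by (simp add: is_demazure_simple[OF h] hecke_right_def)
      then have "h u (v * simple i) = h (h u v) (simple i)"
        using h by (simp add: is_demazure_def)
      then show ?thesis by (simp add: is_demazure_simple[OF h])
    qed
    show ?case by (simp add: *[OF f] *[OF g] step(2))
  qed
  then show "f = g" by blast
qed

lemma is_demazure_demazure: "is_demazure (\<circ>\<^sub>D)"
  unfolding demazure_def by (rule theI'[OF ex1_demazure])

end

theory Submission
  imports Defs
begin

text \<open>
  An involution word of \<open>z\<close> builds \<open>z\<close> up from the identity by steps \<open>x \<mapsto> s \<circ>\<^sub>D x \<circ>\<^sub>D s\<close>,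
  each of which must ascend. If \<open>y\<close> is covered by \<open>z\<close>, a word of \<open>z\<close> contains a letter
  whose removal leaves a word of \<open>y\<close>; this letter is the mark. The Little map lowers the
  marked letter by one, and while the word fails to be reduced it passes to the only other
  letter that can be removed and lowers that one.

  The proof follows a cycle of \<open>y\<close>. In the wiring diagram of the word, the marked letter
  \<open>c\<close> sits between the wires at heights \<open>c\<close> and \<open>c + 1\<close>, and following these to the right
  end gives two integers, the lower and the upper strand of the mark. Only their cycles
  under \<open>y\<close> matter. Lowering the letter turns the lower strand into the upper one, since
  the part of the word to the right of the mark stays the same (\<open>near_strand_shift_mark\<close>).
  Passing to the other mark exchanges the two cycles, as the same two cycles meet there in
  the opposite order (\<open>strand_two_marks\<close>). So the cycle that was the lower one at the
  start is the upper one at the end.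

  What remains is that the strands of a reduced marked word tell which
  \<open>\<tau>\<^sub>i\<^sub>j\<close> takes \<open>y\<close> to \<open>z\<close>. The relation \<open>linked\<close> describes how \<open>z\<close>
  arises from \<open>y\<close> by joining two cycles \<open>(p, q)\<close> and \<open>(p', q')\<close> with \<open>p < p'\<close> and
  \<open>q < q'\<close>. It holds right after the marked letter and survives every later ascending step
  (\<open>linked_at_act\<close>), so a reduced marked word links the cycles of its lower and its upper
  strand. On the other hand \<open>linked\<close> is the relation defined by the maps
  \<open>\<tau>\<^sub>i\<^sub>j\<close> with \<open>i\<close> in the first and \<open>j\<close> in the second cycle
  (\<open>linked_at_tau\<close>, \<open>ex_tau_of_linked\<close>). Hence the words over \<open>\<Phi>\<^sup>+(y, q)\<close> are
  those whose lower strand lies in the cycle of \<open>q\<close>, and the words over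
  \<open>\<Phi>\<^sup>-(y, p)\<close> those whose upper strand does.

  Bijectivity comes from running the algorithm backwards with letters raised instead of
  lowered (\<open>bump_bump\<close>). Both directions stop because a marked word whose marked letter
  occurs nowhere else is reduced (\<open>asc_word_of_unique_letter\<close>), so that letters stay
  within bounds. The two foundations are the lifting property of the Bruhat order, which
  yields the rank function on involutions and the description of coverings
  (\<open>invol_covers_iff\<close>), and the exchange condition for involution words (\<open>ex_other_mark\<close>,
  \<open>other_mark_unique\<close>).
\<close>

section \<open>The Bruhat order and the operators of multiplication by a simple transposition\<close>

lemma apply_swap:
  "\<langle>a \<leftrightarrow> b\<rangle> \<langle>$\<rangle> x = (if x = a then b else if x = b then a else x)"
  by auto

lemma apply_inverse_apply [simp]: "inverse u \<langle>$\<rangle> (u \<langle>$\<rangle> x) = (x :: int)"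
  by (simp add: apply_inverse_eq)

lemma apply_apply_inverse [simp]: "u \<langle>$\<rangle> (inverse u \<langle>$\<rangle> x) = (x :: int)"
  using apply_inverse_eq[of u x "inverse u \<langle>$\<rangle> x"] by simp

lemma swap_mult_swap: "u * \<langle>a \<leftrightarrow> b\<rangle> * \<langle>a \<leftrightarrow> b\<rangle> = u"
  by (intro perm_eqI) (auto simp: apply_times apply_swap)

text \<open>
  Conjugating by \<open>s\<^sub>a\<close> moves the transposition \<open>(a, b)\<close> to \<open>(a + 1, b)\<close>, and the
  length changes by one in each multiplication by \<open>s\<^sub>a\<close>; so the inequality is
  inherited from the shorter distance.
\<close>

lemma length_less_mult_swap:
  assumes "a < b" and "u \<langle>$\<rangle> a < u \<langle>$\<rangle> b"
  shows "perm_length u < perm_length (u * \<langle>a \<leftrightarrow> b\<rangle>)"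
  using assms
proof (induction "nat (b - a)" arbitrary: a u rule: less_induct)
  case less
  show ?case
  proof (cases "b = a + 1")
    case True
    then show ?thesis
      using length_mult_simple_asc[of u a] less(3) by (simp add: simple_def)
  next
    case False
    let ?v = "u * simple a"
    let ?w = "u * \<langle>a \<leftrightarrow> b\<rangle>"
    have eq: "?v * \<langle>a + 1 \<leftrightarrow> b\<rangle> = ?w * simple a"
      using False less(2) by (intro perm_eqI) (auto simp: apply_times apply_swap apply_simple)
    have "perm_length ?v < perm_length (?v * \<langle>a + 1 \<leftrightarrow> b\<rangle>)"
      using less(2,3) False by (intro less(1)) (auto simp: apply_times apply_simple)
    then have IH: "perm_length ?v < perm_length (?w * simple a)" by (simp add: eq)
    show ?thesis
    proof (cases "u \<langle>$\<rangle> a < u \<langle>$\<rangle> (a + 1)")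
      case True
      then show ?thesis
        using IH length_mult_simple_asc[of u a] length_mult_simple_le[of ?w a] by simp
    next
      case False
      then have "u \<langle>$\<rangle> a > u \<langle>$\<rangle> (a + 1)" using asc_or_desc[of u a] by auto
      moreover from this have "?w \<langle>$\<rangle> a > ?w \<langle>$\<rangle> (a + 1)"
        using less(2,3) \<open>b \<noteq> a + 1\<close> by (auto simp: apply_times apply_swap)
      ultimately show ?thesis
        using IH length_mult_simple_desc[of u a] length_mult_simple_desc[of ?w a] by simp
    qed
  qed
qed

lemma bruhat_less_mult_swap:
  assumes "a < b" and "u \<langle>$\<rangle> a < u \<langle>$\<rangle> b"
  shows "u \<prec> u * \<langle>a \<leftrightarrow> b\<rangle>"
  using assms length_less_mult_swap by (intro bruhat_less.base) auto

lemma length_less_mult_swap_iff: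
  assumes "a < b"
  shows "perm_length u < perm_length (u * \<langle>a \<leftrightarrow> b\<rangle>) \<longleftrightarrow> u \<langle>$\<rangle> a < u \<langle>$\<rangle> b"
proof -
  have "perm_length (u * \<langle>a \<leftrightarrow> b\<rangle>) < perm_length u" if "u \<langle>$\<rangle> b < u \<langle>$\<rangle> a"
    using length_less_mult_swap[of a b "u * \<langle>a \<leftrightarrow> b\<rangle>"] that assms
    by (simp add: swap_mult_swap) (auto simp: apply_times apply_swap)
  then show ?thesis
    using assms length_less_mult_swap[of a b u] apply_inj[of u a b] by (cases "u \<langle>$\<rangle> a < u \<langle>$\<rangle> b") fastforce+
qed

text \<open>
  For positions \<open>a < b\<close> the length condition in the definition of the Bruhat order says
  that the value at \<open>a\<close> is less than the value at \<open>b\<close>, which is the form in which the base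
  case is used.
\<close>

lemma bruhat_less_induct [consumes 1, case_names base trans]:
  assumes "u \<prec> v"
    and base: "\<And>w a b. a < b \<Longrightarrow> w \<langle>$\<rangle> a < w \<langle>$\<rangle> b \<Longrightarrow> P w (w * \<langle>a \<leftrightarrow> b\<rangle>)"
    and trans: "\<And>u v w. u \<prec> v \<Longrightarrow> v \<prec> w \<Longrightarrow> P u v \<Longrightarrow> P v w \<Longrightarrow> P u w"
  shows "P u v"
  using assms(1)
proof (induction rule: bruhat_less.induct)
  case (base a b w)
  show ?case
  proof (cases "a < b")
    case True
    then show ?thesis using base length_less_mult_swap_iff assms(2) by blast
  next
    case False
    then have "b < a" using base by simp
    then show ?thesis using base length_less_mult_swap_iff assms(2) by (metis swap_sym)
  qed
next
  case (trans u v w)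
  then show ?case using assms(3) by blast
qed

lemma bruhat_le_refl [simp]: "u \<preceq> u"
  by (simp add: bruhat_le_def)

lemma bruhat_le_trans [trans]: "u \<preceq> v \<Longrightarrow> v \<preceq> w \<Longrightarrow> u \<preceq> w"
  by (auto simp: bruhat_le_def intro: bruhat_less.trans)

lemma bruhat_le_less_trans: "u \<preceq> v \<Longrightarrow> v \<prec> w \<Longrightarrow> u \<prec> w"
  by (auto simp: bruhat_le_def intro: bruhat_less.trans)

lemma bruhat_less_imp_le: "u \<prec> v \<Longrightarrow> u \<preceq> v"
  by (simp add: bruhat_le_def)

lemma bruhat_less_inverse: "u \<prec> v \<Longrightarrow> inverse u \<prec> inverse v"
proof (induction rule: bruhat_less_induct)
  case (base w a b)
  have "inverse (w * \<langle>a \<leftrightarrow> b\<rangle>) = inverse w * \<langle>w \<langle>$\<rangle> a \<leftrightarrow> w \<langle>$\<rangle> b\<rangle>"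
  proof (rule perm_eqI)
    fix x
    show "inverse (w * \<langle>a \<leftrightarrow> b\<rangle>) \<langle>$\<rangle> x = (inverse w * \<langle>w \<langle>$\<rangle> a \<leftrightarrow> w \<langle>$\<rangle> b\<rangle>) \<langle>$\<rangle> x"
      unfolding apply_inverse_eq by (auto simp: apply_times apply_swap apply_inverse_eq)
  qed
  then show ?case
    using base by (simp add: bruhat_less_mult_swap)
qed (rule bruhat_less.trans)

lemma bruhat_le_inverse: "u \<preceq> v \<Longrightarrow> inverse u \<preceq> inverse v"
  using bruhat_less_inverse by (auto simp: bruhat_le_def)

text \<open>
  \<open>dec_right\<close> and \<open>dec_left\<close> are the downward counterparts of the Demazure operators
  \<open>hecke_right\<close> and \<open>hecke_left\<close>. That all four are monotone is the lifting property of
  the Bruhat order.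
\<close>

definition dec_right :: "int \<Rightarrow> int perm \<Rightarrow> int perm" where
  "dec_right i u = (if u \<langle>$\<rangle> (i + 1) < u \<langle>$\<rangle> i then u * simple i else u)"

definition dec_left :: "int \<Rightarrow> int perm \<Rightarrow> int perm" where
  "dec_left i u = inverse (dec_right i (inverse u))"

lemma dec_left_eq:
  "dec_left i u = (if inverse u \<langle>$\<rangle> (i + 1) < inverse u \<langle>$\<rangle> i then simple i * u else u)"
  by (simp add: dec_left_def dec_right_def inverse_simple perm_inverse_inverse)

lemma bruhat_less_simple: "u \<langle>$\<rangle> i < u \<langle>$\<rangle> (i + 1) \<Longrightarrow> u \<prec> u * simple i"
  by (simp add: simple_def bruhat_less_mult_swap)

lemma bruhat_le_hecke_right: "u \<preceq> hecke_right i u"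
  by (simp add: hecke_right_def bruhat_less_simple bruhat_less_imp_le)

lemma bruhat_dec_right_le: "dec_right i u \<preceq> u"
proof (cases "u \<langle>$\<rangle> (i + 1) < u \<langle>$\<rangle> i")
  case True
  then have "u * simple i \<prec> u * simple i * simple i"
    by (intro bruhat_less_simple) (simp add: apply_times apply_simple)
  then show ?thesis
    using True by (simp add: dec_right_def mult_simple_simple bruhat_less_imp_le)
qed (simp add: dec_right_def)

text \<open>
  Right multiplication by \<open>s\<^sub>i\<close> turns the transposition \<open>(a, b)\<close> into its conjugate,
  and keeps the order of the two points that it moves unless these are \<open>i\<close> and \<open>i + 1\<close>.
\<close>

lemma bruhat_less_both_mult_simple:
  assumes "a < b" and "w \<langle>$\<rangle> a < w \<langle>$\<rangle> b" and "(a, b) \<noteq> (i, i + 1)"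
  shows "w * simple i \<prec> w * \<langle>a \<leftrightarrow> b\<rangle> * simple i"
proof -
  let ?a = "simple i \<langle>$\<rangle> a" and ?b = "simple i \<langle>$\<rangle> b"
  have "w * \<langle>a \<leftrightarrow> b\<rangle> * simple i = w * simple i * \<langle>?a \<leftrightarrow> ?b\<rangle>"
    by (intro perm_eqI) (auto simp: apply_times apply_swap apply_simple)
  moreover have "?a < ?b"
    using assms(1,3) by (auto simp: apply_simple)
  moreover have "(w * simple i) \<langle>$\<rangle> ?a < (w * simple i) \<langle>$\<rangle> ?b"
    using assms by (auto simp: apply_times apply_simple)
  ultimately show ?thesis by (simp add: bruhat_less_mult_swap)
qed

text \<open>
  For \<open>v = w t\<close> with \<open>t \<noteq> s\<^sub>i\<close> the previous lemma relates \<open>w s\<^sub>i\<close> to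
  \<open>v s\<^sub>i\<close>; together with \<open>w < v\<close> and the relations between \<open>w\<close> and \<open>w s\<^sub>i\<close>,
  \<open>v\<close> and \<open>v s\<^sub>i\<close> this compares the larger and the smaller elements of both pairs.
  For \<open>t = s\<^sub>i\<close> the two pairs coincide.
\<close>

lemma bruhat_mono_right:
  assumes "u \<prec> v"
  shows "hecke_right i u \<preceq> hecke_right i v \<and> dec_right i u \<preceq> dec_right i v"
  using assms
proof (induction rule: bruhat_less_induct)
  case (base w a b)
  let ?v = "w * \<langle>a \<leftrightarrow> b\<rangle>"
  have less: "w \<prec> ?v" using base by (rule bruhat_less_mult_swap)
  show ?case
  proof (cases "(a, b) = (i, i + 1)")
    case True
    then show ?thesis
      using base by (auto simp: hecke_right_def dec_right_def simple_def apply_times apply_swap swap_mult_swap)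
  next
    case False
    have less': "w * simple i \<prec> ?v * simple i"
      using base False by (rule bruhat_less_both_mult_simple)
    have "hecke_right i w \<preceq> hecke_right i ?v"
      using less less' bruhat_le_hecke_right[of ?v i] asc_or_desc[of ?v i]
        bruhat_less_simple[of "?v * simple i" i]
      by (auto simp: hecke_right_def mult_simple_simple apply_times apply_simple
          intro: bruhat_less_imp_le bruhat_less.trans bruhat_le_trans)
    moreover have "dec_right i w \<preceq> dec_right i ?v"
      using less less' bruhat_dec_right_le[of i w] asc_or_desc[of w i]
        bruhat_less_simple[of w i]
      by (auto simp: dec_right_def mult_simple_simple apply_times apply_simple
          intro: bruhat_less_imp_le bruhat_less.trans bruhat_le_trans)
    ultimately show ?thesis ..
  qed
qed (auto intro: bruhat_le_trans)

lemma hecke_right_mono: "u \<preceq> v \<Longrightarrow> hecke_right i u \<preceq> hecke_right i v"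
  using bruhat_mono_right by (auto simp: bruhat_le_def[of u v])

lemma dec_right_mono: "u \<preceq> v \<Longrightarrow> dec_right i u \<preceq> dec_right i v"
  using bruhat_mono_right by (auto simp: bruhat_le_def[of u v])

lemma hecke_left_mono: "u \<preceq> v \<Longrightarrow> hecke_left i u \<preceq> hecke_left i v"
  by (simp add: hecke_left_def bruhat_le_inverse hecke_right_mono)

lemma dec_left_mono: "u \<preceq> v \<Longrightarrow> dec_left i u \<preceq> dec_left i v"
  by (simp add: dec_left_def bruhat_le_inverse dec_right_mono)

section \<open>Twisted conjugation of involutions by a simple transposition\<close>

lemma invol_inverse: "x \<in> invols \<Longrightarrow> inverse x = x"
  unfolding invols_def by (drule CollectD) (erule sym)

lemma invols_iff: "x \<in> invols \<longleftrightarrow> (\<forall>e. x \<langle>$\<rangle> (x \<langle>$\<rangle> e) = e)"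
proof
  assume "x \<in> invols"
  then have x: "inverse x = x" by (rule invol_inverse)
  show "\<forall>e. x \<langle>$\<rangle> (x \<langle>$\<rangle> e) = e"
  proof
    fix e
    show "x \<langle>$\<rangle> (x \<langle>$\<rangle> e) = e" using apply_apply_inverse[of x e] unfolding x .
  qed
next
  assume a: "\<forall>e. x \<langle>$\<rangle> (x \<langle>$\<rangle> e) = e"
  have "x = inverse x"
  proof (rule perm_eqI)
    fix e
    show "x \<langle>$\<rangle> e = inverse x \<langle>$\<rangle> e"
      using apply_inverse_eq[of x e "x \<langle>$\<rangle> e"] a by simp
  qed
  then show "x \<in> invols" unfolding invols_def by (rule CollectI)
qed

lemma invol_apply [simp]: "x \<in> invols \<Longrightarrow> x \<langle>$\<rangle> (x \<langle>$\<rangle> e) = e"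
  using invols_iff by auto

lemma one_invol [simp]: "1 \<in> invols"
  by (simp add: invols_iff)

text \<open>
  This is \<open>s\<^sub>c \<circ>\<^sub>D x \<circ>\<^sub>D s\<^sub>c\<close> (\<open>inverse_demazure_hecke_right\<close>), defined by the
  one-sided operators so that monotonicity is inherited from them.
\<close>

definition act :: "int \<Rightarrow> int perm \<Rightarrow> int perm" where
  "act c x = hecke_left c (hecke_right c x)"

lemma act_invol [simp]: "x \<in> invols \<Longrightarrow> act c x \<in> invols"
proof -
  assume x: "x \<in> invols"
  have "inverse (act c x) = hecke_right c (hecke_left c (inverse x))"
    by (simp add: act_def hecke_left_def perm_inverse_inverse)
  also have "\<dots> = act c x"
    using x by (simp add: act_def hecke_commute invol_inverse)
  finally have "act c x = inverse (act c x)" by (rule sym)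
  then show ?thesis unfolding invols_def by (rule CollectI)
qed

lemma act_desc:
  assumes "x \<in> invols" "x \<langle>$\<rangle> (c + 1) < x \<langle>$\<rangle> c"
  shows "act c x = x"
  using assms by (simp add: act_def hecke_right_def hecke_left_eq invol_inverse)

text \<open>
  After multiplication by \<open>s\<^sub>c\<close> on the right, the left side still ascends unless
  \<open>s\<^sub>c\<close> commutes with \<open>x\<close>. At an ascent this happens only if \<open>c\<close> and \<open>c + 1\<close> are
  both fixed.
\<close>

lemma act_asc:
  assumes "x \<in> invols" "x \<langle>$\<rangle> c < x \<langle>$\<rangle> (c + 1)"
  shows "act c x = (if x \<langle>$\<rangle> c = c \<and> x \<langle>$\<rangle> (c + 1) = c + 1 then x * simple c
    else simple c * x * simple c)"
proof -
  have "inverse (x * simple c) = simple c * x"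
    using assms by (simp add: invol_inverse inverse_simple perm_inverse_inverse)
  then show ?thesis
    using assms apply_inj[of x c "c + 1"]
    by (auto simp: act_def hecke_right_def hecke_left_eq apply_times apply_simple mult.assoc
        split: if_splits)
qed

lemma act_apply:
  assumes "x \<in> invols" "x \<langle>$\<rangle> c < x \<langle>$\<rangle> (c + 1)"
  shows "act c x \<langle>$\<rangle> e = (if x \<langle>$\<rangle> c = c \<and> x \<langle>$\<rangle> (c + 1) = c + 1 then x \<langle>$\<rangle> (simple c \<langle>$\<rangle> e)
    else simple c \<langle>$\<rangle> (x \<langle>$\<rangle> (simple c \<langle>$\<rangle> e)))"
  using assms by (simp add: act_asc apply_times)

lemma apply_simple_simple [simp]: "simple c \<langle>$\<rangle> (simple c \<langle>$\<rangle> e) = e"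
  by (auto simp: apply_simple)

lemma simple_less_iff:
  assumes "{a, b} \<noteq> {c, c + 1}"
  shows "simple c \<langle>$\<rangle> a < simple c \<langle>$\<rangle> b \<longleftrightarrow> a < b"
  using assms by (auto simp: apply_simple)

lemma act_desc_after:
  assumes "x \<in> invols" "x \<langle>$\<rangle> c < x \<langle>$\<rangle> (c + 1)"
  shows "act c x \<langle>$\<rangle> (c + 1) < act c x \<langle>$\<rangle> c"
  using assms by (auto simp: act_apply[OF assms] apply_simple)

text \<open>
  A monotone operator that undoes an ascending \<open>act\<close> (\<open>down_act\<close>). As for \<open>act\<close>, a single
  formula covers the commuting case: there the left operator finds an ascent and does
  nothing.
\<close>

definition down :: "int \<Rightarrow> int perm \<Rightarrow> int perm" where
  "down c x = dec_left c (dec_right c x)"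

lemma down_act:
  assumes "x \<in> invols" "x \<langle>$\<rangle> c < x \<langle>$\<rangle> (c + 1)"
  shows "down c (act c x) = x"
proof -
  have dr: "dec_right c (act c x) = act c x * simple c"
    using act_desc_after[OF assms] by (simp add: dec_right_def)
  show ?thesis
  proof (cases "x \<langle>$\<rangle> c = c \<and> x \<langle>$\<rangle> (c + 1) = c + 1")
    case True
    then show ?thesis
      using assms dr by (simp add: down_def act_asc mult_simple_simple dec_left_eq invol_inverse)
  next
    case False
    then have "act c x * simple c = simple c * x"
      using assms by (simp only: act_asc if_False mult_simple_simple)
    moreover have "inverse (simple c * x) = x * simple c"
      using assms by (simp add: invol_inverse inverse_simple)
    ultimately show ?thesis
      using assms dr by (simp add: down_def dec_left_eq apply_times apply_simple simple_simple
          flip: mult.assoc)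
  qed
qed

lemma act_down:
  assumes z: "z \<in> invols" and desc: "z \<langle>$\<rangle> (c + 1) < z \<langle>$\<rangle> c"
  shows "down c z \<in> invols" "down c z \<langle>$\<rangle> c < down c z \<langle>$\<rangle> (c + 1)" "act c (down c z) = z"
proof -
  have inv: "inverse (z * simple c) = simple c * z"
    using z by (simp add: invol_inverse inverse_simple)
  have dr: "dec_right c z = z * simple c"
    using desc by (simp add: dec_right_def)
  have "down c z \<in> invols \<and> down c z \<langle>$\<rangle> c < down c z \<langle>$\<rangle> (c + 1) \<and> act c (down c z) = z"
  proof (cases "z \<langle>$\<rangle> c = c + 1")
    case True
    then have z': "z \<langle>$\<rangle> (c + 1) = c" using z invol_apply by metis
    then have d: "down c z = z * simple c"
      using dr inv True by (simp add: down_def dec_left_eq apply_times apply_simple)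
    moreover have "z \<langle>$\<rangle> e \<noteq> c \<and> z \<langle>$\<rangle> e \<noteq> c + 1" if "e \<noteq> c" "e \<noteq> c + 1" for e
      using that True z' z invol_apply by metis
    ultimately have i: "down c z \<in> invols"
      using z z' True by (auto simp: invols_iff apply_times apply_simple)
    have "down c z \<langle>$\<rangle> c = c" "down c z \<langle>$\<rangle> (c + 1) = c + 1"
      using z' True by (auto simp: d apply_times apply_simple)
    then show ?thesis
      using i by (simp add: act_asc) (simp add: d mult_simple_simple)
  next
    case False
    then have "{z \<langle>$\<rangle> (c + 1), z \<langle>$\<rangle> c} \<noteq> {c, c + 1}"
      using desc by (auto simp: doubleton_eq_iff)
    note less = simple_less_iff[OF this]
    have d: "down c z = simple c * z * simple c"
      using dr inv desc less by (simp add: down_def dec_left_eq apply_times mult.assoc)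
    have i: "down c z \<in> invols"
      using z by (auto simp: invols_iff d apply_times)
    have a: "down c z \<langle>$\<rangle> c = simple c \<langle>$\<rangle> (z \<langle>$\<rangle> (c + 1))"
      "down c z \<langle>$\<rangle> (c + 1) = simple c \<langle>$\<rangle> (z \<langle>$\<rangle> c)"
      by (auto simp: d apply_times apply_simple)
    then have asc: "down c z \<langle>$\<rangle> c < down c z \<langle>$\<rangle> (c + 1)"
      using less desc by simp
    have nf: "\<not> (down c z \<langle>$\<rangle> c = c \<and> down c z \<langle>$\<rangle> (c + 1) = c + 1)"
      using desc by (auto simp: a apply_simple split: if_splits)
    have "act c (down c z) = simple c * (simple c * z * simple c) * simple c"
      unfolding act_asc[OF i asc] using nf by (simp only: if_False) (simp only: d)
    also have "\<dots> = z"
      by (intro perm_eqI) (simp add: apply_times)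
    finally show ?thesis using i asc by simp
  qed
  then show "down c z \<in> invols" "down c z \<langle>$\<rangle> c < down c z \<langle>$\<rangle> (c + 1)" "act c (down c z) = z"
    by auto
qed

lemma down_asc:
  assumes "x \<in> invols" "x \<langle>$\<rangle> c < x \<langle>$\<rangle> (c + 1)"
  shows "down c x = x"
  using assms by (simp add: down_def dec_right_def dec_left_eq invol_inverse)

lemma act_mono: "u \<preceq> v \<Longrightarrow> act c u \<preceq> act c v"
  by (simp add: act_def hecke_left_mono hecke_right_mono)

lemma down_mono: "u \<preceq> v \<Longrightarrow> down c u \<preceq> down c v"
  by (simp add: down_def dec_left_mono dec_right_mono)

lemma bruhat_le_act: "x \<preceq> act c x"
proof -
  have "inverse (hecke_right c x) \<preceq> hecke_right c (inverse (hecke_right c x))"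
    by (rule bruhat_le_hecke_right)
  from bruhat_le_inverse[OF this] have "hecke_right c x \<preceq> act c x"
    by (simp add: act_def hecke_left_def perm_inverse_inverse)
  with bruhat_le_hecke_right show ?thesis by (rule bruhat_le_trans)
qed

lemma act_inj:
  assumes "x \<in> invols" "x' \<in> invols" "x \<langle>$\<rangle> c < x \<langle>$\<rangle> (c + 1)" "x' \<langle>$\<rangle> c < x' \<langle>$\<rangle> (c + 1)"
    and "act c x = act c x'"
  shows "x = x'"
  using down_act[OF assms(1,3)] down_act[OF assms(2,4)] unfolding assms(5) by (rule HOL.trans[OF sym])

lemma perm_length_inverse: "perm_length (inverse u) = perm_length u"
proof -
  have "bij_betw (\<lambda>(i, j). (u \<langle>$\<rangle> j, u \<langle>$\<rangle> i)) (inversions u) (inversions (inverse u))"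
    by (rule bij_betw_byWitness[where f' = "\<lambda>(i, j). (inverse u \<langle>$\<rangle> j, inverse u \<langle>$\<rangle> i)"])
      (simp_all add: inversions_def image_subset_iff case_prod_beta)
  then show ?thesis by (simp add: perm_length_def bij_betw_same_card)
qed

text \<open>
  Adding the number of 2-cycles to the length makes every ascending step of \<open>act\<close> count the
  same: conjugation by \<open>s\<^sub>c\<close> adds 2 to the length, and multiplication by \<open>s\<^sub>c\<close> adds 1 to each
  summand. The sum is twice the length of any involution word.
\<close>

definition invol_rank :: "int perm \<Rightarrow> nat" where
  "invol_rank x = perm_length x + card {e. e < x \<langle>$\<rangle> e}"

lemma finite_excedances: "finite {e. e < x \<langle>$\<rangle> e}" for x :: "int perm"
  by (rule finite_subset[OF _ finite_affected[of x]]) (auto simp: in_affected)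

lemma invol_rank_one [simp]: "invol_rank 1 = 0"
  by (simp add: invol_rank_def)

lemma invol_rank_act:
  assumes x: "x \<in> invols" and asc: "x \<langle>$\<rangle> c < x \<langle>$\<rangle> (c + 1)"
  shows "invol_rank (act c x) = invol_rank x + 2"
proof (cases "x \<langle>$\<rangle> c = c \<and> x \<langle>$\<rangle> (c + 1) = c + 1")
  case True
  have "x \<langle>$\<rangle> e \<noteq> c \<and> x \<langle>$\<rangle> e \<noteq> c + 1" if "e \<noteq> c" "e \<noteq> c + 1" for e
    using that True x invol_apply by metis
  then have "{e. e < act c x \<langle>$\<rangle> e} = insert c {e. e < x \<langle>$\<rangle> e}"
    using True by (auto simp: act_apply[OF x asc] apply_simple)
  moreover have "act c x = x * simple c"
    using True x asc by (simp add: act_asc)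
  moreover have "c \<notin> {e. e < x \<langle>$\<rangle> e}"
    using True by simp
  ultimately show ?thesis
    using length_mult_simple_asc[OF asc] by (simp add: invol_rank_def finite_excedances)
next
  case False
  then have act: "act c x = simple c * x * simple c"
    unfolding act_asc[OF x asc] by (simp only: if_False)
  have inv: "inverse (x * simple c) = simple c * x"
    using x by (simp add: invol_inverse inverse_simple)
  have "perm_length (simple c * x) = perm_length x + 1"
    using perm_length_inverse[of "x * simple c"] length_mult_simple_asc[OF asc] by (simp only: inv)
  moreover have "simple c \<langle>$\<rangle> (x \<langle>$\<rangle> c) < simple c \<langle>$\<rangle> (x \<langle>$\<rangle> (c + 1))"
    using False asc by (auto simp: apply_simple split: if_splits)
  then have "perm_length (act c x) = perm_length (simple c * x) + 1"
    unfolding act by (intro length_mult_simple_asc) (simp add: apply_times)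
  moreover have "{e. e < act c x \<langle>$\<rangle> e} = apply (simple c) ` {e. e < x \<langle>$\<rangle> e}"
  proof -
    have *: "simple c \<langle>$\<rangle> e < simple c \<langle>$\<rangle> (x \<langle>$\<rangle> e) \<longleftrightarrow> e < x \<langle>$\<rangle> e" for e
    proof (rule simple_less_iff)
      have "x \<langle>$\<rangle> c \<noteq> c + 1"
        using asc invol_apply[OF x, of c] by (auto simp del: invol_apply)
      moreover from this have "x \<langle>$\<rangle> (c + 1) \<noteq> c"
        using x invol_apply by metis
      ultimately show "{e, x \<langle>$\<rangle> e} \<noteq> {c, c + 1}"
        by (auto simp: doubleton_eq_iff)
    qed
    show ?thesis
    proof (intro equalityI subsetI)
      fix e assume "e \<in> {e. e < act c x \<langle>$\<rangle> e}"
      then have "simple c \<langle>$\<rangle> e \<in> {e. e < x \<langle>$\<rangle> e}"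
        using *[of "simple c \<langle>$\<rangle> e"] by (simp add: act apply_times)
      then show "e \<in> apply (simple c) ` {e. e < x \<langle>$\<rangle> e}"
        by (intro image_eqI[of _ _ "simple c \<langle>$\<rangle> e"]) auto
    qed (auto simp: act apply_times *)
  qed
  then have "card {e. e < act c x \<langle>$\<rangle> e} = card {e. e < x \<langle>$\<rangle> e}"
    by (simp add: card_image inj_on_def apply_inj)
  ultimately show ?thesis by (simp add: invol_rank_def)
qed

section \<open>Words acting on involutions\<close>

text \<open>
  \<open>run x a\<close> applies the letters of \<open>a\<close> from left to right, and \<open>asc_word x a\<close> says that
  every step ascends. The involution words of \<open>z\<close> will be the words that ascend from 1 to
  \<open>z\<close>.
\<close>

primrec run :: "int perm \<Rightarrow> int list \<Rightarrow> int perm" where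
  "run x [] = x"
| "run x (c # a) = run (act c x) a"

primrec asc_word :: "int perm \<Rightarrow> int list \<Rightarrow> bool" where
  "asc_word x [] \<longleftrightarrow> True"
| "asc_word x (c # a) \<longleftrightarrow> x \<langle>$\<rangle> c < x \<langle>$\<rangle> (c + 1) \<and> asc_word (act c x) a"

lemma run_append [simp]: "run x (a @ b) = run (run x a) b"
  by (induction a arbitrary: x) auto

lemma asc_word_append [simp]: "asc_word x (a @ b) \<longleftrightarrow> asc_word x a \<and> asc_word (run x a) b"
  by (induction a arbitrary: x) auto

lemma run_invol [simp]: "x \<in> invols \<Longrightarrow> run x a \<in> invols"
  by (induction a arbitrary: x) auto

lemma run_mono: "x \<preceq> x' \<Longrightarrow> run x a \<preceq> run x' a"
  by (induction a arbitrary: x x') (auto simp: act_mono)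

lemma invol_rank_run_le:
  assumes "x \<in> invols"
  shows "invol_rank (run x a) \<le> invol_rank x + 2 * length a"
  using assms
proof (induction a arbitrary: x)
  case (Cons c a)
  then have "invol_rank (run (act c x) a) \<le> invol_rank (act c x) + 2 * length a" by simp
  moreover have "invol_rank (act c x) \<le> invol_rank x + 2"
    using asc_or_desc[of x c] invol_rank_act[of x c] act_desc[of x c] Cons(2) by auto
  ultimately show ?case by simp
qed simp

lemma invol_rank_run:
  assumes "x \<in> invols" "asc_word x a"
  shows "invol_rank (run x a) = invol_rank x + 2 * length a"
  using assms by (induction a arbitrary: x) (auto simp: invol_rank_act)

text \<open>Ascending steps can be undone one by one.\<close>

lemma run_inj:
  assumes "x \<in> invols" "x' \<in> invols" "asc_word x a" "asc_word x' a" "run x a = run x' a"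
  shows "x = x'"
  using assms
proof (induction a arbitrary: x x')
  case (Cons c a)
  have "act c x = act c x'"
    by (rule Cons.IH) (use Cons.prems in \<open>auto simp only: act_invol asc_word.simps run.simps\<close>)
  then show ?case
    by (intro act_inj[of x x' c]) (use Cons.prems in \<open>auto simp only: asc_word.simps\<close>)
qed simp

lemma invol_induct [consumes 1, case_names one act]:
  assumes "z \<in> invols" and "P 1"
    and "\<And>x c. x \<in> invols \<Longrightarrow> x \<langle>$\<rangle> c < x \<langle>$\<rangle> (c + 1) \<Longrightarrow> P x \<Longrightarrow> P (act c x)"
  shows "P z"
  using assms(1)
proof (induction "invol_rank z" arbitrary: z rule: less_induct)
  case less
  show ?case
  proof (cases "z = 1")
    case False
    then obtain c where c: "z \<langle>$\<rangle> c > z \<langle>$\<rangle> (c + 1)" using ex_descent by blast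
    note d = act_down[OF less(2) c]
    have "invol_rank (down c z) < invol_rank z"
      using invol_rank_act[OF d(1,2)] unfolding d(3) by linarith
    then have "P (down c z)" by (rule less(1)) (rule d(1))
    then have "P (act c (down c z))" by (rule assms(3)[OF d(1,2)])
    then show ?thesis unfolding d(3) .
  qed (simp add: assms(2))
qed

section \<open>Involution words\<close>

text \<open>The Demazure product of the letters.\<close>

definition demazure_word :: "int list \<Rightarrow> int perm" where
  "demazure_word a = foldl (\<lambda>u c. hecke_right c u) 1 a"

lemma demazure_assoc: "(u \<circ>\<^sub>D v) \<circ>\<^sub>D w = u \<circ>\<^sub>D (v \<circ>\<^sub>D w)"
  using is_demazure_demazure by (simp add: is_demazure_def)

lemma demazure_simple: "u \<circ>\<^sub>D simple i = hecke_right i u"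
  using is_demazure_simple[OF is_demazure_demazure] .

lemma demazure_one [simp]: "1 \<circ>\<^sub>D 1 = 1"
  using is_demazure_demazure by (simp add: is_demazure_def)

text \<open>
  The operators of left and of right multiplication commute, so it suffices to evaluate
  the left one at the identity.
\<close>

lemma simple_demazure: "simple i \<circ>\<^sub>D u = hecke_left i u"
proof (induction u rule: perm_induct)
  case one
  have "simple i \<circ>\<^sub>D 1 = simple i"
    using is_demazure_demazure by (simp add: is_demazure_def)
  then show ?case by (simp add: hecke_left_eq)
next
  case (step v j)
  then have "v * simple j = v \<circ>\<^sub>D simple j"
    by (simp add: demazure_simple hecke_right_def)
  then have "simple i \<circ>\<^sub>D (v * simple j) = (simple i \<circ>\<^sub>D v) \<circ>\<^sub>D simple j"
    by (simp only: demazure_assoc)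
  also have "\<dots> = hecke_right j (hecke_left i v)"
    by (simp only: step(2) demazure_simple)
  also have "\<dots> = hecke_left i (hecke_right j v)" by (rule hecke_commute)
  finally show ?case using step(1) by (simp add: hecke_right_def)
qed

lemma inverse_hecke_right: "inverse (hecke_right c u) = hecke_left c (inverse u)"
  by (simp add: hecke_left_def perm_inverse_inverse)

lemma inverse_demazure_hecke_right:
  "inverse (hecke_right c u) \<circ>\<^sub>D hecke_right c u = act c (inverse u \<circ>\<^sub>D u)"
proof -
  have "inverse (hecke_right c u) \<circ>\<^sub>D hecke_right c u
      = (simple c \<circ>\<^sub>D inverse u) \<circ>\<^sub>D (u \<circ>\<^sub>D simple c)"
    by (simp only: inverse_hecke_right simple_demazure demazure_simple)
  also have "\<dots> = simple c \<circ>\<^sub>D ((inverse u \<circ>\<^sub>D u) \<circ>\<^sub>D simple c)"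
    by (simp only: demazure_assoc)
  finally show ?thesis by (simp only: simple_demazure demazure_simple act_def)
qed

lemma demazure_word_snoc: "demazure_word (a @ [c]) = hecke_right c (demazure_word a)"
  by (simp add: demazure_word_def)

text \<open>
  Appending a letter \<open>c\<close> to a word for \<open>w\<close> turns \<open>w\<^sup>-\<^sup>1 \<circ>\<^sub>D w\<close> into
  \<open>s\<^sub>c \<circ>\<^sub>D (w\<^sup>-\<^sup>1 \<circ>\<^sub>D w) \<circ>\<^sub>D s\<^sub>c\<close>.
\<close>

lemma inverse_demazure_word: "inverse (demazure_word a) \<circ>\<^sub>D demazure_word a = run 1 a"
proof (induction a rule: rev_induct)
  case Nil
  then show ?case by (simp add: demazure_word_def)
next
  case (snoc c a)
  then show ?case by (simp add: demazure_word_snoc inverse_demazure_hecke_right)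
qed

lemma word_prod_snoc: "word_prod (a @ [c]) = word_prod a * simple c"
  by (simp add: word_prod_def)

lemma perm_length_word_prod_le: "perm_length (word_prod a) \<le> length a"
proof (induction a rule: rev_induct)
  case (snoc c a)
  then show ?case using length_mult_simple_le[of "word_prod a" c] by (simp add: word_prod_snoc)
qed (simp add: word_prod_def)

lemma perm_length_demazure_word_le: "perm_length (demazure_word a) \<le> length a"
proof (induction a rule: rev_induct)
  case (snoc c a)
  then show ?case using length_mult_simple_le[of "demazure_word a" c]
    by (simp add: demazure_word_snoc hecke_right_def)
qed (simp add: demazure_word_def)

lemma demazure_word_reduced:
  assumes "perm_length (demazure_word a) = length a"
  shows "demazure_word a = word_prod a"
  using assms
proof (induction a rule: rev_induct)
  case (snoc c a)
  have "demazure_word a \<langle>$\<rangle> c < demazure_word a \<langle>$\<rangle> (c + 1)"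
    using snoc(2) perm_length_demazure_word_le[of a]
    by (simp add: demazure_word_snoc hecke_right_def split: if_splits)
  moreover from this have "demazure_word a = word_prod a"
    using snoc length_mult_simple_asc[of "demazure_word a" c]
    by (simp add: demazure_word_snoc hecke_right_def)
  ultimately show ?case by (simp add: demazure_word_snoc word_prod_snoc hecke_right_def)
qed (simp add: demazure_word_def word_prod_def)

lemma demazure_word_word_prod:
  assumes "perm_length (word_prod a) = length a"
  shows "demazure_word a = word_prod a"
  using assms
proof (induction a rule: rev_induct)
  case (snoc c a)
  then have "word_prod a \<langle>$\<rangle> c < word_prod a \<langle>$\<rangle> (c + 1)"
    using perm_length_word_prod_le[of a] length_mult_simple_desc[of "word_prod a" c]
      asc_or_desc[of "word_prod a" c] by (auto simp: word_prod_snoc)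
  moreover from this have "demazure_word a = word_prod a"
    using snoc length_mult_simple_asc[of "word_prod a" c] by (simp add: word_prod_snoc)
  ultimately show ?case by (simp add: demazure_word_snoc word_prod_snoc hecke_right_def)
qed (simp add: demazure_word_def word_prod_def)

lemma ex_reduced_word: "\<exists>a. word_prod a = w \<and> length a = perm_length w"
proof (induction w rule: perm_induct)
  case one
  then show ?case by (intro exI[of _ "[]"]) (simp add: word_prod_def)
next
  case (step v i)
  from step(2) obtain a where "word_prod a = v" "length a = perm_length v" by blast
  then show ?case
    using length_mult_simple_asc[OF step(1)] by (intro exI[of _ "a @ [i]"]) (simp add: word_prod_snoc)
qed

lemma reduced_words_iff: "a \<in> reduced_words w \<longleftrightarrow> word_prod a = w \<and> length a = perm_length w"
proof
  assume "a \<in> reduced_words w"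
  then have a: "word_prod a = w" "\<And>b. word_prod b = w \<Longrightarrow> \<not> length b < length a"
    by (auto simp: reduced_words_def is_arg_min_def)
  obtain b where "word_prod b = w" "length b = perm_length w" using ex_reduced_word by blast
  then show "word_prod a = w \<and> length a = perm_length w"
    using a(1) a(2)[of b] perm_length_word_prod_le[of a] by simp
next
  assume "word_prod a = w \<and> length a = perm_length w"
  moreover have "perm_length w \<le> length b" if "word_prod b = w" for b
    using perm_length_word_prod_le[of b] that by simp
  ultimately show "a \<in> reduced_words w"
    by (auto simp: reduced_words_def is_arg_min_def not_less)
qed

text \<open>
  Letters at which a word fails to ascend can be dropped, so a word of minimal length ascends.
\<close>

lemma ex_shorter_word:
  assumes "x \<in> invols" "\<not> asc_word x a"
  shows "\<exists>b. run x b = run x a \<and> length b < length a"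
  using assms
proof (induction a arbitrary: x)
  case (Cons c a)
  show ?case
  proof (cases "x \<langle>$\<rangle> c < x \<langle>$\<rangle> (c + 1)")
    case True
    then have "\<not> asc_word (act c x) a" using Cons.prems(2) by simp
    from Cons.IH[OF act_invol[OF Cons.prems(1)] this] obtain b
      where "run (act c x) b = run (act c x) a" "length b < length a" by blast
    then show ?thesis by (intro exI[of _ "c # b"]) simp
  next
    case False
    then have "act c x = x" using Cons.prems(1) asc_or_desc[of x c] act_desc[of x c] by auto
    then show ?thesis by (intro exI[of _ a]) simp
  qed
qed simp

text \<open>
  A word in \<open>invol_words z\<close> runs to \<open>z\<close>, and if it did not ascend, a shorter word would
  give a shorter \<open>w\<close> with \<open>w\<^sup>-\<^sup>1 \<circ>\<^sub>D w = z\<close>. Conversely all ascending words to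
  \<open>z\<close> have the same length, half of the rank of \<open>z\<close>, and no word to \<open>z\<close> is shorter; so
  their Demazure products have minimal length and are computed by reduced words.
\<close>

lemma invol_words_iff:
  "a \<in> invol_words z \<longleftrightarrow> asc_word 1 a \<and> run 1 a = z"
proof
  assume "a \<in> invol_words z"
  then obtain w where w: "is_arg_min perm_length (\<lambda>w. z = inverse w \<circ>\<^sub>D w) w"
    and a: "word_prod a = w" "length a = perm_length w"
    by (auto simp: invol_words_def reduced_words_iff)
  have min: "\<not> perm_length w' < perm_length w" if "z = inverse w' \<circ>\<^sub>D w'" for w'
    using w that by (auto simp: is_arg_min_def)
  have "demazure_word a = w"
    using a demazure_word_word_prod[of a] by simp
  then have run: "run 1 a = z"
    using w inverse_demazure_word[of a] by (simp add: is_arg_min_def)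
  have "asc_word 1 a"
  proof (rule ccontr)
    assume "\<not> asc_word 1 a"
    then obtain b where b: "run 1 b = z" "length b < length a"
      using ex_shorter_word[of 1 a] run by auto
    then show False
      using min[of "demazure_word b"] perm_length_demazure_word_le[of b] a
        inverse_demazure_word[of b] by simp
  qed
  with run show "asc_word 1 a \<and> run 1 a = z" by simp
next
  assume a: "asc_word 1 a \<and> run 1 a = z"
  let ?w = "demazure_word a"
  have le: "length a \<le> perm_length w'" if "z = inverse w' \<circ>\<^sub>D w'" for w'
  proof -
    obtain b where b: "word_prod b = w'" "length b = perm_length w'" using ex_reduced_word by blast
    then have "run 1 b = z"
      using that demazure_word_word_prod[of b] inverse_demazure_word[of b] by simp
    then show ?thesis
      using a b invol_rank_run_le[of 1 b] invol_rank_run[of 1 a] by simp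
  qed
  have z: "z = inverse ?w \<circ>\<^sub>D ?w"
    using a inverse_demazure_word[of a] by simp
  then have len: "perm_length ?w = length a"
    using le[of ?w] perm_length_demazure_word_le[of a] by simp
  then have "is_arg_min perm_length (\<lambda>w. z = inverse w \<circ>\<^sub>D w) ?w"
    using z le by (auto simp: is_arg_min_def not_less)
  moreover have "a \<in> reduced_words ?w"
    using len demazure_word_reduced[of a] by (simp add: reduced_words_iff)
  ultimately show "a \<in> invol_words z" by (auto simp: invol_words_def)
qed

lemma is_invol_word_iff: "is_invol_word a \<longleftrightarrow> asc_word 1 a"
  by (auto simp: is_invol_word_def invol_words_iff)

lemma marked_iff:
  "marked y (a, i) \<longleftrightarrow> i < length a \<and> asc_word 1 (del i a) \<and> run 1 (del i a) = y"
  by (simp add: marked_def invol_words_iff)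


section \<open>The Bruhat order on involutions\<close>

text \<open>
  The lifting property in the form of an induction step. Either \<open>y\<close> ascends at \<open>c\<close>, and
  then \<open>y\<close> itself lies below \<open>x\<close>, or the last step can be stripped from \<open>y\<close> as well as
  from \<open>act c x\<close>.
\<close>

lemma bruhat_le_down:
  assumes "x \<in> invols" "x \<langle>$\<rangle> c < x \<langle>$\<rangle> (c + 1)" "y \<preceq> act c x"
  shows "down c y \<preceq> x"
  using down_mono[OF assms(3), of c] down_act[OF assms(1,2)] by simp

lemma invol_down_cases [consumes 1, case_names asc desc]:
  assumes "y \<in> invols"
  obtains (asc) "y \<langle>$\<rangle> c < y \<langle>$\<rangle> (c + 1)" "down c y = y"
  | (desc) "down c y \<in> invols" "down c y \<langle>$\<rangle> c < down c y \<langle>$\<rangle> (c + 1)" "act c (down c y) = y"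
      "invol_rank y = invol_rank (down c y) + 2"
proof (cases "y \<langle>$\<rangle> c < y \<langle>$\<rangle> (c + 1)")
  case True
  then show ?thesis using asc down_asc[OF assms] by blast
next
  case False
  then have "y \<langle>$\<rangle> (c + 1) < y \<langle>$\<rangle> c" using asc_or_desc[of y c] by auto
  note d = act_down[OF assms this]
  then show ?thesis using desc[OF d] invol_rank_act[OF d(1,2)] by simp
qed

lemma invol_rank_strict_mono:
  assumes "z \<in> invols" "y \<in> invols" "y \<preceq> z"
  shows "y = z \<or> invol_rank y < invol_rank z"
  using assms
proof (induction arbitrary: y rule: invol_induct)
  case one
  then show ?case using bruhat_less_length by (fastforce simp: bruhat_le_def)
next
  case (act x c)
  have le: "down c y \<preceq> x"
    using bruhat_le_down[OF act.hyps(1,2) act.prems(2)] .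
  have rank: "invol_rank (act c x) = invol_rank x + 2"
    using act.hyps(1,2) by (rule invol_rank_act)
  show ?case
    using act.prems(1)
  proof (cases rule: invol_down_cases[where c = c])
    case asc
    then have "y = x \<or> invol_rank y < invol_rank x"
      using act.IH[of y] act.prems(1) le by simp
    then show ?thesis using rank by auto
  next
    case desc
    then have "down c y = x \<or> invol_rank (down c y) < invol_rank x"
      using act.IH[of "down c y"] le by simp
    then show ?thesis using rank desc by auto
  qed
qed

lemma invol_rank_less: "z \<in> invols \<Longrightarrow> y \<in> invols \<Longrightarrow> y \<prec> z \<Longrightarrow> invol_rank y < invol_rank z"
  using invol_rank_strict_mono[of z y] bruhat_less_irrefl[of z] by (auto simp: bruhat_less_imp_le)

text \<open>
  The involutions form a graded poset. In the induction step, if \<open>y\<close> descends at \<open>c\<close>, the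
  induction hypothesis gives an \<open>x\<close> one rank above \<open>down c y\<close>, and \<open>act c x\<close> is the
  element sought. If \<open>x\<close> descends at \<open>c\<close>, it has the rank of \<open>y\<close> and lies above it, so
  \<open>y = x\<close> is below the shorter involution and the induction hypothesis applies to \<open>y\<close>
  instead.
\<close>

lemma ex_rank_above:
  assumes "z \<in> invols" "y \<in> invols" "y \<prec> z"
  shows "\<exists>x \<in> invols. y \<prec> x \<and> x \<preceq> z \<and> invol_rank x = invol_rank y + 2"
  using assms
proof (induction arbitrary: y rule: invol_induct)
  case one
  then show ?case using bruhat_less_length by fastforce
next
  case (act z c)
  have le: "down c y \<preceq> z"
    using bruhat_le_down[OF act.hyps(1,2)] act.prems(2) bruhat_less_imp_le by blast
  have z: "z \<prec> act c z"
    using bruhat_le_act[of z c] invol_rank_act[OF act.hyps(1,2)] by (auto simp: bruhat_le_def)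
  have below: ?case if "y \<preceq> z"
  proof (cases "y = z")
    case True
    then show ?thesis
      using z invol_rank_act[OF act.hyps(1,2)] act.hyps(1) by (intro bexI[of _ "act c z"]) auto
  next
    case False
    then obtain x where "x \<in> invols" "y \<prec> x" "x \<preceq> z" "invol_rank x = invol_rank y + 2"
      using act.IH[of y] act.prems(1) \<open>y \<preceq> z\<close> by (auto simp: bruhat_le_def)
    then show ?thesis
      using z by (intro bexI[of _ x]) (auto intro: bruhat_le_trans bruhat_less_imp_le)
  qed
  show ?case
    using act.prems(1)
  proof (cases rule: invol_down_cases[where c = c])
    case asc
    then show ?thesis using le below by simp
  next
    case desc
    have "down c y \<noteq> z"
      using desc(3) act.prems(2) bruhat_less_irrefl by metis
    then have "down c y \<prec> z" using le by (simp add: bruhat_le_def)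
    then obtain x where x: "x \<in> invols" "down c y \<prec> x" "x \<preceq> z"
      "invol_rank x = invol_rank (down c y) + 2"
      using act.IH desc(1) by blast
    have le': "y \<preceq> act c x"
      using act_mono[OF bruhat_less_imp_le[OF x(2)], of c] desc(3) by simp
    show ?thesis
    proof (cases "x \<langle>$\<rangle> c < x \<langle>$\<rangle> (c + 1)")
      case True
      then have rank: "invol_rank (act c x) = invol_rank y + 2"
        using invol_rank_act[OF x(1)] x(4) desc(4) by simp
      then have "y \<prec> act c x" using le' by (auto simp: bruhat_le_def)
      then show ?thesis
        using act_mono[OF x(3), of c] rank x(1) by (intro bexI[of _ "act c x"]) auto
    next
      case False
      then have "act c x = x" using asc_or_desc[of x c] act_desc[OF x(1)] by auto
      then have "y = x"
        using invol_rank_strict_mono[of x y] le' x(1,4) desc(4) act.prems(1) by simp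
      then show ?thesis using below x(3) by simp
    qed
  qed
qed

lemma invol_covers_iff:
  "invol_covers y z \<longleftrightarrow> y \<in> invols \<and> z \<in> invols \<and> y \<prec> z \<and> invol_rank z = invol_rank y + 2"
proof
  assume c: "invol_covers y z"
  then have yz: "y \<in> invols" "z \<in> invols" "y \<prec> z"
    and only: "\<And>x. x \<in> invols \<Longrightarrow> y \<preceq> x \<Longrightarrow> x \<prec> z \<Longrightarrow> x = y"
    by (auto simp: invol_covers_def)
  obtain x where x: "x \<in> invols" "y \<prec> x" "x \<preceq> z" "invol_rank x = invol_rank y + 2"
    using ex_rank_above[OF yz(2,1,3)] by blast
  then have "x = z"
    using only[of x] bruhat_less_irrefl[of y] bruhat_less_imp_le[OF x(2)] by (auto simp: bruhat_le_def[of x])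
  then show "y \<in> invols \<and> z \<in> invols \<and> y \<prec> z \<and> invol_rank z = invol_rank y + 2"
    using yz x by simp
next
  assume yz: "y \<in> invols \<and> z \<in> invols \<and> y \<prec> z \<and> invol_rank z = invol_rank y + 2"
  have "x = y" if x: "x \<in> invols" "y \<preceq> x" "x \<prec> z" for x
  proof (rule ccontr)
    assume "x \<noteq> y"
    then have "y \<prec> x" using x by (auto simp: bruhat_le_def)
    then obtain x' where "x' \<in> invols" "y \<prec> x'" "x' \<preceq> x" "invol_rank x' = invol_rank y + 2"
      using ex_rank_above[of x y] x yz by blast
    then show False
      using invol_rank_less[of z x'] bruhat_le_less_trans[of x' x z] x yz by simp
  qed
  then show "invol_covers y z"
    using yz by (auto simp: invol_covers_def)
qed

lemma del_append_last: "del (length a) (a @ [c]) = a"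
  by (simp add: del_def)

lemma del_append: "i < length a \<Longrightarrow> del i (a @ b) = del i a @ b"
  by (simp add: del_def)

text \<open>The subword property of the Bruhat order for a pair of adjacent ranks.\<close>

lemma ex_marked:
  assumes "asc_word 1 a" "y \<in> invols" "y \<prec> run 1 a" "invol_rank (run 1 a) = invol_rank y + 2"
  shows "\<exists>i. marked y (a, i)"
  using assms
proof (induction a arbitrary: y rule: rev_induct)
  case Nil
  then show ?case using bruhat_less_length[of y 1] by simp
next
  case (snoc c a)
  let ?x = "run 1 a"
  have x: "?x \<in> invols" "?x \<langle>$\<rangle> c < ?x \<langle>$\<rangle> (c + 1)" "asc_word 1 a"
    using snoc.prems(1) by auto
  have rank: "invol_rank (act c ?x) = invol_rank ?x + 2"
    using x by (simp add: invol_rank_act)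
  have le: "down c y \<preceq> ?x"
  proof (rule bruhat_le_down[OF x(1,2)])
    show "y \<preceq> act c ?x" using snoc.prems(3) by (simp add: bruhat_le_def)
  qed
  show ?case
    using snoc.prems(2)
  proof (cases rule: invol_down_cases[where c = c])
    case asc
    have "y \<preceq> ?x" using le unfolding asc(2) .
    moreover have "invol_rank y = invol_rank ?x" using rank snoc.prems(4) by simp
    ultimately have "y = ?x"
      using invol_rank_strict_mono[OF x(1) snoc.prems(2)] by (metis less_irrefl)
    then show ?thesis
      using x by (intro exI[of _ "length a"]) (simp add: marked_iff del_append_last)
  next
    case desc
    have "down c y \<noteq> ?x"
    proof
      assume "down c y = ?x"
      then have "y = run 1 (a @ [c])" using desc(3) by simp
      then show False using snoc.prems(3) bruhat_less_irrefl by blast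
    qed
    then have "down c y \<prec> ?x" using le by (simp add: bruhat_le_def)
    moreover have "invol_rank ?x = invol_rank (down c y) + 2"
      using rank snoc.prems(4) desc(4) by simp
    ultimately obtain i where "marked (down c y) (a, i)"
      using snoc.IH[OF x(3) desc(1)] by blast
    then show ?thesis
      using desc by (intro exI[of _ i]) (simp add: marked_iff del_append)
  qed
qed

section \<open>Marked words\<close>

lemma del_split: "del (length u) (u @ s # v) = u @ v"
  by (simp add: del_def)

lemma split_at:
  assumes "i < length a"
  obtains u s v where "a = u @ s # v" "length u = i"
proof
  show "a = take i a @ a ! i # drop (Suc i) a" using assms by (rule id_take_nth_drop)
  show "length (take i a) = i" using assms by simp
qed

lemma split_at_two:
  assumes "i < j" "j < length a"
  obtains u s v c w where "a = u @ s # v @ c # w" "length u = i" "length (u @ s # v) = j"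
proof -
  obtain b c w where a: "a = b @ c # w" "length b = j" using split_at[OF assms(2)] by blast
  obtain u s v where "b = u @ s # v" "length u = i" using split_at[of i b] assms(1) a by blast
  then show ?thesis using that[of u s v c w] a by simp
qed

text \<open>
  If the \<open>i\<close>th and the \<open>j\<close>th letter of a word can both be removed with the same result and
  \<open>i < j\<close>, then the remainders agree already after position \<open>j\<close>, as ascending steps can be
  undone. So \<open>j\<close> is the first position at which the full word fails to ascend.
\<close>

lemma two_removals:
  assumes "asc_word 1 (u @ v @ c # w)" "asc_word 1 (u @ s # v @ w)"
    and "run 1 (u @ v @ c # w) = run 1 (u @ s # v @ w)"
  shows "run 1 (u @ s # v) = act c (run 1 (u @ v))"
    and "\<not> asc_word 1 (u @ s # v @ [c])"
proof -
  let ?x = "run 1 (u @ v)" and ?z = "run 1 (u @ s # v)"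
  have x: "?x \<in> invols" "?z \<in> invols" by simp_all
  have asc: "?x \<langle>$\<rangle> c < ?x \<langle>$\<rangle> (c + 1)" using assms(1) by simp
  have "act c ?x = ?z"
    by (rule run_inj[of _ _ w]) (use assms in simp_all)
  then show "?z = act c ?x" by (rule sym)
  then have "?z \<langle>$\<rangle> (c + 1) < ?z \<langle>$\<rangle> c"
    using act_desc_after[OF x(1) asc] by (simp only:)
  then show "\<not> asc_word 1 (u @ s # v @ [c])" by simp
qed

lemma two_marks_not_asc:
  assumes "marked y (a, i)" "marked y (a, j)" "i < j"
  shows "\<not> asc_word 1 (take (Suc j) a)"
proof -
  have "j < length a" using assms(2) by (simp add: marked_iff)
  with assms(3) obtain u s v c w where
    a: "a = u @ s # v @ c # w" "length u = i" "length (u @ s # v) = j"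
    by (rule split_at_two)
  have "del i a = u @ v @ c # w"
    using del_split[of u s "v @ c # w"] a by simp
  moreover have "del j a = u @ s # v @ w"
    using del_split[of "u @ s # v" c w] a by simp
  ultimately have "\<not> asc_word 1 (u @ s # v @ [c])"
    using assms(1,2) by (intro two_removals(2)[of u v c w]) (simp_all add: marked_iff)
  moreover have "take (Suc j) a = u @ s # v @ [c]"
    using a by auto
  ultimately show ?thesis by simp
qed

lemma asc_word_take: "asc_word x a \<Longrightarrow> asc_word x (take n a)"
  using asc_word_append[of x "take n a" "drop n a"] by simp

lemma marked_unique:
  assumes "asc_word 1 a" "marked y (a, i)" "marked y (a, j)"
  shows "i = j"
  using two_marks_not_asc[of y a i j] two_marks_not_asc[of y a j i] assms asc_word_take
  by (metis linorder_neqE_nat)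

text \<open>
  Removing the \<open>k\<close>th letter does not repair the failure to ascend at the earlier position
  \<open>j\<close>.
\<close>

lemma no_three_marks:
  assumes "marked y (a, i)" "marked y (a, j)" "marked y (a, k)" "i < j" "j < k"
  shows False
proof -
  have k: "k < length a" "asc_word 1 (del k a)" using assms(3) by (simp_all add: marked_iff)
  then have "take (Suc j) a = take (Suc j) (del k a)"
    using assms(5) by (simp add: del_def min_def)
  then show False
    using two_marks_not_asc[OF assms(1,2,4)] asc_word_take[OF k(2), of "Suc j"] by simp
qed

lemma other_mark_unique:
  assumes "marked y (a, i)" "marked y (a, j)" "marked y (a, k)" "j \<noteq> i" "k \<noteq> i"
  shows "j = k"
proof (rule ccontr)
  assume "j \<noteq> k"
  with assms(4,5) consider "i < j" "j < k" | "i < k" "k < j" | "j < i" "i < k" | "k < i" "i < j"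
    | "j < k" "k < i" | "k < j" "j < i"
    by linarith
  then show False by cases (use no_three_marks assms(1-3) in blast)+
qed

lemma not_asc_word_split:
  assumes "\<not> asc_word z b"
  obtains v c w where "b = v @ c # w" "asc_word z v" "\<not> run z v \<langle>$\<rangle> c < run z v \<langle>$\<rangle> (c + 1)"
  using assms
proof (induction b arbitrary: z thesis)
  case Nil
  then show ?case by simp
next
  case (Cons e b)
  show ?case
  proof (cases "z \<langle>$\<rangle> e < z \<langle>$\<rangle> (e + 1)")
    case True
    then have "\<not> asc_word (act e z) b" using Cons.prems(2) by simp
    then obtain v c w where "b = v @ c # w" "asc_word (act e z) v"
      "\<not> run (act e z) v \<langle>$\<rangle> c < run (act e z) v \<langle>$\<rangle> (c + 1)"
      using Cons.IH by blast
    then show ?thesis using True by (intro Cons.prems(1)[of "e # v" c w]) simp_all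
  next
    case False
    then show ?thesis by (intro Cons.prems(1)[of "[]" e b]) simp_all
  qed
qed

text \<open>
  The exchange condition: \<open>act c x\<close> lies below \<open>act c z = z\<close> and has the same rank.
\<close>

lemma act_eq_of_rank:
  assumes "x \<in> invols" "z \<in> invols" "x \<preceq> z" "invol_rank z = invol_rank x + 2"
    and "x \<langle>$\<rangle> c < x \<langle>$\<rangle> (c + 1)" "\<not> z \<langle>$\<rangle> c < z \<langle>$\<rangle> (c + 1)"
  shows "act c x = z"
proof -
  have "act c z = z" using assms(2,6) asc_or_desc[of z c] act_desc[of z c] by auto
  then have "act c x \<preceq> z" using act_mono[OF assms(3), of c] by simp
  then show ?thesis
    using invol_rank_strict_mono[OF assms(2), of "act c x"] invol_rank_act[OF assms(1,5)] assms(1,4)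
    by simp
qed

text \<open>
  If the failure to ascend occurs at the mark itself, a letter to the left of the mark
  cancels with it, by the subword property. Otherwise the first letter to the right of the
  mark at which the word fails to ascend can be removed instead of the marked one.
\<close>

lemma ex_other_mark:
  assumes "marked y (a, i)" "\<not> asc_word 1 a"
  shows "\<exists>j. j \<noteq> i \<and> marked y (a, j)"
proof -
  have "i < length a" using assms(1) by (simp add: marked_iff)
  then obtain u s b where a: "a = u @ s # b" "length u = i" by (rule split_at)
  have del: "del i a = u @ b" using a del_split[of u s b] by simp
  define x where "x = run 1 u"
  have u: "asc_word 1 u" "asc_word x b" "run x b = y" and x: "x \<in> invols"
    using assms(1) by (simp_all add: marked_iff del x_def)
  show ?thesis
  proof (cases "x \<langle>$\<rangle> s < x \<langle>$\<rangle> (s + 1)")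
    case False
    then have "x \<langle>$\<rangle> (s + 1) < x \<langle>$\<rangle> s" using asc_or_desc[of x s] by auto
    note d = act_down[OF x this]
    have rank: "invol_rank x = invol_rank (down s x) + 2"
      using invol_rank_act[OF d(1,2)] unfolding d(3) .
    have "down s x \<preceq> x" using bruhat_le_act[of "down s x" s] unfolding d(3) .
    then have "down s x \<prec> x" using rank by (auto simp: bruhat_le_def)
    then obtain j where j: "marked (down s x) (u, j)"
      using ex_marked[OF u(1) d(1)] rank unfolding x_def[symmetric] by blast
    then have "j < length u" by (simp add: marked_iff)
    moreover have "marked y (a, j)"
      using j u d by (simp add: marked_iff a(1) del_append)
    ultimately show ?thesis using a(2) by (intro exI[of _ j]) simp
  next
    case True
    define z where "z = act s x"
    have "\<not> asc_word z b" using assms(2) u True by (simp add: a z_def x_def)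
    then obtain v c w where b: "b = v @ c # w" "asc_word z v"
      "\<not> run z v \<langle>$\<rangle> c < run z v \<langle>$\<rangle> (c + 1)"
      by (rule not_asc_word_split)
    have z: "z \<in> invols" using x by (simp add: z_def)
    have asc: "asc_word x v" "run x v \<langle>$\<rangle> c < run x v \<langle>$\<rangle> (c + 1)"
      and w: "asc_word (act c (run x v)) w" "run (act c (run x v)) w = y"
      using u(2,3) by (simp_all add: b)
    have "x \<preceq> z" unfolding z_def by (rule bruhat_le_act)
    moreover have "invol_rank z = invol_rank x + 2"
      unfolding z_def using x True by (rule invol_rank_act)
    ultimately have eq: "act c (run x v) = run z v"
      using x z asc b run_mono[of x z v] invol_rank_run[of x v] invol_rank_run[of z v]
      by (intro act_eq_of_rank) simp_all
    have "del (length (u @ s # v)) a = u @ s # v @ w"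
      using del_split[of "u @ s # v" c w] a b by simp
    moreover have "asc_word 1 (u @ s # v @ w)" "run 1 (u @ s # v @ w) = y"
      using u(1) True b(2) w unfolding eq by (simp_all add: x_def[symmetric] z_def[symmetric])
    ultimately have "marked y (a, length (u @ s # v))"
      by (simp add: marked_iff a b)
    then show ?thesis using a(2) by (intro exI[of _ "length (u @ s # v)"]) simp
  qed
qed

text \<open>
  A step of the Little map is a change of the marked letter followed by \<open>flip\<close>. Separating
  the two makes both of them invertible: \<open>flip\<close> is an involution on marked words.
\<close>

definition flip :: "int perm \<Rightarrow> int list \<times> nat \<Rightarrow> int list \<times> nat" where
  "flip y = (\<lambda>(a, i). (a, if asc_word 1 a then i else THE j. j \<noteq> i \<and> marked y (a, j)))"

lemma fst_flip [simp]: "fst (flip y m) = fst m"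
  by (simp add: flip_def case_prod_beta)

lemma flip_asc: "asc_word 1 (fst m) \<Longrightarrow> flip y m = m"
  by (simp add: flip_def case_prod_beta)

lemma flip_not_asc:
  assumes "marked y (a, i)" "\<not> asc_word 1 a"
  obtains j where "flip y (a, i) = (a, j)" "j \<noteq> i" "marked y (a, j)"
proof -
  obtain j where j: "j \<noteq> i" "marked y (a, j)" using ex_other_mark[OF assms] by blast
  then have "(THE j. j \<noteq> i \<and> marked y (a, j)) = j"
    using other_mark_unique[OF assms(1)] by (intro the_equality) auto
  then show ?thesis using that j assms(2) by (simp add: flip_def)
qed

lemma marked_flip:
  assumes "marked y m"
  shows "marked y (flip y m)"
proof -
  obtain a i where m: "m = (a, i)" by (cases m)
  show ?thesis
  proof (cases "asc_word 1 a")
    case True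
    then show ?thesis using assms m by (simp add: flip_asc)
  next
    case False
    show ?thesis using flip_not_asc[of y a i, OF _ False] assms m by metis
  qed
qed

lemma flip_flip:
  assumes "marked y m"
  shows "flip y (flip y m) = m"
proof -
  obtain a i where m: "m = (a, i)" by (cases m)
  show ?thesis
  proof (cases "asc_word 1 a")
    case True
    then show ?thesis using m by (simp add: flip_asc)
  next
    case False
    obtain j where j: "flip y (a, i) = (a, j)" "j \<noteq> i" "marked y (a, j)"
      using flip_not_asc[of y a i, OF _ False] assms m by metis
    obtain k where k: "flip y (a, j) = (a, k)" "k \<noteq> j" "marked y (a, k)"
      using flip_not_asc[OF j(3) False] by metis
    have "i = k"
      using other_mark_unique[of y a j i k] assms m j k by simp
    then show ?thesis using m j k by simp
  qed
qed

section \<open>The shape of a covering\<close>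

text \<open>
  A common description of what the maps \<open>\<tau>\<^sub>i\<^sub>j\<close> do, in terms of two
  cycles \<open>(p, q)\<close> and \<open>(p', q')\<close> of \<open>x\<close>, possibly fixed points, with the first one below
  the second in both coordinates. In the first case the cycles are disjoint intervals, the
  extreme points \<open>p\<close> and \<open>q'\<close> are joined, and the inner end points become fixed. In the
  second case two such 2-cycles become crossing ones, and in the third case crossing
  2-cycles become nested ones.
\<close>

definition linked :: "int perm \<Rightarrow> int perm \<Rightarrow> int \<Rightarrow> int \<Rightarrow> int \<Rightarrow> int \<Rightarrow> bool" where
  "linked x z p q p' q' \<longleftrightarrow>
     p \<le> q \<and> p' \<le> q' \<and> p < p' \<and> q < q' \<and> x \<langle>$\<rangle> p = q \<and> x \<langle>$\<rangle> p' = q' \<and>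
     (\<forall>e. e \<notin> {p, q, p', q'} \<longrightarrow> z \<langle>$\<rangle> e = x \<langle>$\<rangle> e) \<and>
     (q < p' \<and> z \<langle>$\<rangle> p = q' \<and> z \<langle>$\<rangle> q' = p \<and> (p < q \<longrightarrow> z \<langle>$\<rangle> q = q) \<and> (p' < q' \<longrightarrow> z \<langle>$\<rangle> p' = p') \<or>
      p < q \<and> q < p' \<and> p' < q' \<and> z \<langle>$\<rangle> p = p' \<and> z \<langle>$\<rangle> p' = p \<and> z \<langle>$\<rangle> q = q' \<and> z \<langle>$\<rangle> q' = q \<or>
      p' < q \<and> z \<langle>$\<rangle> p = q' \<and> z \<langle>$\<rangle> q' = p \<and> z \<langle>$\<rangle> p' = q \<and> z \<langle>$\<rangle> q = p')"

lemma linked_back: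
  assumes "x \<in> invols" "linked x z p q p' q'"
  shows "x \<langle>$\<rangle> q = p" "x \<langle>$\<rangle> q' = p'"
proof -
  have "x \<langle>$\<rangle> p = q" "x \<langle>$\<rangle> p' = q'" using assms(2) by (simp_all add: linked_def)
  then show "x \<langle>$\<rangle> q = p" "x \<langle>$\<rangle> q' = p'"
    using invol_apply[OF assms(1), of p] invol_apply[OF assms(1), of p'] by simp_all
qed

lemma linked_cases [consumes 1, case_names outer crossing nesting]:
  assumes "linked x z p q p' q'"
  obtains "q < p'" "z \<langle>$\<rangle> p = q'" "z \<langle>$\<rangle> q' = p" "p < q \<longrightarrow> z \<langle>$\<rangle> q = q" "p' < q' \<longrightarrow> z \<langle>$\<rangle> p' = p'"
  | "p < q" "q < p'" "p' < q'" "z \<langle>$\<rangle> p = p'" "z \<langle>$\<rangle> p' = p" "z \<langle>$\<rangle> q = q'" "z \<langle>$\<rangle> q' = q"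
  | "p' < q" "z \<langle>$\<rangle> p = q'" "z \<langle>$\<rangle> q' = p" "z \<langle>$\<rangle> p' = q" "z \<langle>$\<rangle> q = p'"
  using assms unfolding linked_def by blast

lemma linkedD:
  assumes "linked x z p q p' q'"
  shows "p \<le> q" "p' \<le> q'" "p < p'" "q < q'" "x \<langle>$\<rangle> p = q" "x \<langle>$\<rangle> p' = q'"
    "e \<noteq> p \<Longrightarrow> e \<noteq> q \<Longrightarrow> e \<noteq> p' \<Longrightarrow> e \<noteq> q' \<Longrightarrow> z \<langle>$\<rangle> e = x \<langle>$\<rangle> e"
  using assms unfolding linked_def by auto

lemma bruhat_less_mult_swap':
  "u \<preceq> v \<Longrightarrow> a < b \<Longrightarrow> v \<langle>$\<rangle> a < v \<langle>$\<rangle> b \<Longrightarrow> u \<prec> v * \<langle>a \<leftrightarrow> b\<rangle>"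
  using bruhat_less_mult_swap bruhat_le_less_trans by blast

text \<open>
  Each of the cases is a chain of at most three multiplications by transpositions that
  raise the length. In the first one the second or third link is absent if a cycle is a
  fixed point.
\<close>

lemma linked_bruhat_less:
  assumes x: "x \<in> invols" and l: "linked x z p q p' q'"
  shows "x \<prec> z"
proof -
  note D = linkedD(1-6)[OF l] linked_back[OF x l]
  note out = linkedD(7)[OF l]
  note app = apply_times apply_swap
  from l show ?thesis
  proof (cases rule: linked_cases)
    case outer
    let ?x1 = "x * \<langle>p \<leftrightarrow> p'\<rangle>"
    have 1: "x \<prec> ?x1" using D by (intro bruhat_less_mult_swap) auto
    define x2 where "x2 = (if p < q then ?x1 * \<langle>q \<leftrightarrow> p'\<rangle> else ?x1)"
    have "x \<prec> ?x1 * \<langle>q \<leftrightarrow> p'\<rangle>" if "p < q"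
      using D outer that
      by (intro bruhat_less_mult_swap'[OF bruhat_less_imp_le[OF 1]]) (auto simp: app)
    then have 2: "x \<prec> x2" using 1 by (simp add: x2_def)
    have x2: "x2 \<langle>$\<rangle> p' = p" "x2 \<langle>$\<rangle> q' = (if p' < q' then p' else p)"
      using D outer unfolding x2_def by (auto simp: app)
    have "z = (if p' < q' then x2 * \<langle>p' \<leftrightarrow> q'\<rangle> else x2)"
    proof (rule perm_eqI)
      fix e
      show "z \<langle>$\<rangle> e = (if p' < q' then x2 * \<langle>p' \<leftrightarrow> q'\<rangle> else x2) \<langle>$\<rangle> e"
      proof (cases "e \<in> {p, q, p', q'}")
        case True
        then show ?thesis using D outer unfolding x2_def by (auto simp: app)
      next
        case False
        then show ?thesis using out[of e] unfolding x2_def by (auto simp: app)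
      qed
    qed
    moreover have "x \<prec> x2 * \<langle>p' \<leftrightarrow> q'\<rangle>" if "p' < q'"
      using D x2 that by (intro bruhat_less_mult_swap'[OF bruhat_less_imp_le[OF 2]]) auto
    ultimately show ?thesis using 2 by simp
  next
    case crossing
    let ?x1 = "x * \<langle>q \<leftrightarrow> p'\<rangle>"
    have 1: "x \<prec> ?x1" using D crossing by (intro bruhat_less_mult_swap) auto
    have 2: "x \<prec> ?x1 * \<langle>p \<leftrightarrow> q'\<rangle>"
      using D crossing
      by (intro bruhat_less_mult_swap'[OF bruhat_less_imp_le[OF 1]]) (auto simp: app)
    have "z = ?x1 * \<langle>p \<leftrightarrow> q'\<rangle>"
    proof (rule perm_eqI)
      fix e
      show "z \<langle>$\<rangle> e = (?x1 * \<langle>p \<leftrightarrow> q'\<rangle>) \<langle>$\<rangle> e"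
        using D crossing out[of e] by (cases "e \<in> {p, q, p', q'}") (auto simp: app)
    qed
    then show ?thesis using 2 by simp
  next
    case nesting
    let ?x1 = "x * \<langle>p \<leftrightarrow> p'\<rangle>"
    have 1: "x \<prec> ?x1" using D nesting by (intro bruhat_less_mult_swap) auto
    have 2: "x \<prec> ?x1 * \<langle>q \<leftrightarrow> q'\<rangle>"
      using D nesting
      by (intro bruhat_less_mult_swap'[OF bruhat_less_imp_le[OF 1]]) (auto simp: app)
    have "z = ?x1 * \<langle>q \<leftrightarrow> q'\<rangle>"
    proof (rule perm_eqI)
      fix e
      show "z \<langle>$\<rangle> e = (?x1 * \<langle>q \<leftrightarrow> q'\<rangle>) \<langle>$\<rangle> e"
        using D nesting out[of e] by (cases "e \<in> {p, q, p', q'}") (auto simp: app)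
    qed
    then show ?thesis using 2 by simp
  qed
qed

lemma linked_support:
  assumes x: "x \<in> invols" and l: "linked x z p q p' q'"
  shows "{e. z \<langle>$\<rangle> e \<noteq> x \<langle>$\<rangle> e} = {p, q, p', q'}"
proof -
  note D = linkedD(1-6)[OF l] linked_back[OF x l]
  note out = linkedD(7)[OF l]
  from l have "z \<langle>$\<rangle> p \<noteq> x \<langle>$\<rangle> p \<and> z \<langle>$\<rangle> q \<noteq> x \<langle>$\<rangle> q \<and> z \<langle>$\<rangle> p' \<noteq> x \<langle>$\<rangle> p' \<and> z \<langle>$\<rangle> q' \<noteq> x \<langle>$\<rangle> q'"
  proof (cases rule: linked_cases)
    case outer
    then show ?thesis
      unfolding D(5-8) using D(1-4) by (cases "p = q"; cases "p' = q'"; simp)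
  next
    case crossing
    then show ?thesis unfolding D(5-8) using D(1-4) by simp
  next
    case nesting
    then show ?thesis unfolding D(5-8) using D(1-4) by simp
  qed
  with out show ?thesis by blast
qed

text \<open>
  Both cycles can be read off from the set of points at which \<open>x\<close> and \<open>z\<close> differ: the
  lower cycle contains the least of these points and the upper cycle the greatest.
\<close>

lemma linked_unique:
  assumes x: "x \<in> invols" and l: "linked x z p q p' q'" and l': "linked x z P Q P' Q'"
  shows "P = p \<and> Q = q \<and> P' = p' \<and> Q' = q'"
proof -
  note D = linkedD(1-6)[OF l] linked_back[OF x l]
  note D' = linkedD(1-6)[OF l'] linked_back[OF x l']
  have eq: "{p, q, p', q'} = {P, Q, P', Q'}"
    using linked_support[OF x l] linked_support[OF x l'] by simp
  have "Min {p, q, p', q'} = p" "Max {p, q, p', q'} = q'"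
    using D by (auto intro!: Min_eqI Max_eqI)
  moreover have "Min {P, Q, P', Q'} = P" "Max {P, Q, P', Q'} = Q'"
    using D' by (auto intro!: Min_eqI Max_eqI)
  ultimately have "P = p" "Q' = q'" using eq by simp_all
  then show ?thesis using D D' by auto
qed

text \<open>
  The ascent at \<open>c\<close> puts the cycle of \<open>c\<close> below that of \<open>c + 1\<close>; the positions of their
  other points relative to \<open>c\<close> and \<open>c + 1\<close> decide which case of \<open>linked\<close> occurs.
\<close>

lemma linked_act:
  assumes x: "x \<in> invols" and asc: "x \<langle>$\<rangle> c < x \<langle>$\<rangle> (c + 1)"
  shows "linked x (act c x) (min c (x \<langle>$\<rangle> c)) (max c (x \<langle>$\<rangle> c))
    (min (c + 1) (x \<langle>$\<rangle> (c + 1))) (max (c + 1) (x \<langle>$\<rangle> (c + 1)))"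
proof -
  define k l where "k = x \<langle>$\<rangle> c" and "l = x \<langle>$\<rangle> (c + 1)"
  have bk: "x \<langle>$\<rangle> k = c" "x \<langle>$\<rangle> l = c + 1"
    using x by (simp_all add: k_def l_def)
  have kl: "k < l" using asc by (simp add: k_def l_def)
  have "k \<noteq> c + 1"
  proof
    assume "k = c + 1"
    then have "l = c" using bk by (simp add: l_def)
    then show False using kl \<open>k = c + 1\<close> by simp
  qed
  moreover have "l \<noteq> c"
    using bk k_def \<open>k \<noteq> c + 1\<close> by metis
  moreover have e: "x \<langle>$\<rangle> e \<noteq> c" "x \<langle>$\<rangle> e \<noteq> c + 1" if "e \<noteq> k" "e \<noteq> l" for e
    using that x invol_apply k_def l_def by metis+
  note app = act_apply[OF x asc] apply_simple k_def[symmetric] l_def[symmetric] bk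
  consider "k = c" "l = c + 1" | "k = c" "l > c + 1" | "k < c" "l = c + 1" | "k < c" "l > c + 1"
    | "l < c" | "k > c + 1"
    using kl \<open>k \<noteq> c + 1\<close> \<open>l \<noteq> c\<close> by linarith
  then show ?thesis
    unfolding k_def[symmetric] l_def[symmetric]
    by cases (use kl e in \<open>auto simp: linked_def app min_def max_def\<close>)
qed

text \<open>
  Conjugation by \<open>s\<^sub>c\<close> moves the four points along, and keeps their order unless
  both \<open>c\<close> and \<open>c + 1\<close> are among them.
\<close>

lemma linked_conj:
  assumes l: "linked x z p q p' q'"
    and c: "\<not> {c, c + 1} \<subseteq> {p, q, p', q'}"
    and X: "\<And>e. X \<langle>$\<rangle> e = simple c \<langle>$\<rangle> (x \<langle>$\<rangle> (simple c \<langle>$\<rangle> e))"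
    and Z: "\<And>e. Z \<langle>$\<rangle> e = simple c \<langle>$\<rangle> (z \<langle>$\<rangle> (simple c \<langle>$\<rangle> e))"
  shows "linked X Z (simple c \<langle>$\<rangle> p) (simple c \<langle>$\<rangle> q) (simple c \<langle>$\<rangle> p') (simple c \<langle>$\<rangle> q')"
proof -
  have less: "simple c \<langle>$\<rangle> a < simple c \<langle>$\<rangle> b \<longleftrightarrow> a < b"
    if "a \<in> {p, q, p', q'}" "b \<in> {p, q, p', q'}" for a b
    using that c by (intro simple_less_iff) blast
  then have le: "simple c \<langle>$\<rangle> a \<le> simple c \<langle>$\<rangle> b \<longleftrightarrow> a \<le> b"
    if "a \<in> {p, q, p', q'}" "b \<in> {p, q, p', q'}" for a b
    using that less[of b a] by (simp add: not_less[symmetric] del: insert_iff)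
  have out: "Z \<langle>$\<rangle> e = X \<langle>$\<rangle> e"
    if "e \<notin> {simple c \<langle>$\<rangle> p, simple c \<langle>$\<rangle> q, simple c \<langle>$\<rangle> p', simple c \<langle>$\<rangle> q'}" for e
  proof -
    have "simple c \<langle>$\<rangle> e \<notin> {p, q, p', q'}" using that by auto
    then show ?thesis using linkedD(7)[OF l, of "simple c \<langle>$\<rangle> e"] by (simp add: X Z)
  qed
  have ord: "simple c \<langle>$\<rangle> p \<le> simple c \<langle>$\<rangle> q \<longleftrightarrow> p \<le> q"
    "simple c \<langle>$\<rangle> p' \<le> simple c \<langle>$\<rangle> q' \<longleftrightarrow> p' \<le> q'"
    "simple c \<langle>$\<rangle> p < simple c \<langle>$\<rangle> p' \<longleftrightarrow> p < p'"
    "simple c \<langle>$\<rangle> q < simple c \<langle>$\<rangle> q' \<longleftrightarrow> q < q'"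
    "simple c \<langle>$\<rangle> q < simple c \<langle>$\<rangle> p' \<longleftrightarrow> q < p'"
    "simple c \<langle>$\<rangle> p < simple c \<langle>$\<rangle> q \<longleftrightarrow> p < q"
    "simple c \<langle>$\<rangle> p' < simple c \<langle>$\<rangle> q' \<longleftrightarrow> p' < q'"
    "simple c \<langle>$\<rangle> p' < simple c \<langle>$\<rangle> q \<longleftrightarrow> p' < q"
    by (simp_all add: le less)
  show ?thesis
    using l out unfolding linked_def by (simp add: X Z ord apply_inj)
qed

text \<open>
  The form of \<open>linked\<close> that can be carried along a word: a point of a cycle is moved by
  each letter, whereas the names of its ends may be exchanged.
\<close>

definition linked_at :: "int perm \<Rightarrow> int perm \<Rightarrow> int \<Rightarrow> int \<Rightarrow> bool" where
  "linked_at x z l h \<longleftrightarrow> (\<exists>p q p' q'. linked x z p q p' q' \<and> l \<in> {p, q} \<and> h \<in> {p', q'})"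

lemma linked_atI:
  "linked x z p q p' q' \<Longrightarrow> l = p \<or> l = q \<Longrightarrow> h = p' \<or> h = q' \<Longrightarrow> linked_at x z l h"
  unfolding linked_at_def by blast

lemma invol_rank_less_of_linked:
  "x \<in> invols \<Longrightarrow> z \<in> invols \<Longrightarrow> linked x z p q p' q' \<Longrightarrow> invol_rank x < invol_rank z"
  using linked_bruhat_less invol_rank_less by blast

lemma linked_at_both_conj:
  assumes x: "x \<in> invols" and z: "z \<in> invols"
    and ascx: "x \<langle>$\<rangle> c < x \<langle>$\<rangle> (c + 1)" and ascz: "z \<langle>$\<rangle> c < z \<langle>$\<rangle> (c + 1)"
    and l: "linked x z p q p' q'" and c: "\<not> {c, c + 1} \<subseteq> {p, q, p', q'}"
    and nx: "\<not> (x \<langle>$\<rangle> c = c \<and> x \<langle>$\<rangle> (c + 1) = c + 1)"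
    and nz: "\<not> (z \<langle>$\<rangle> c = c \<and> z \<langle>$\<rangle> (c + 1) = c + 1)"
    and lh: "lo = p \<or> lo = q" "hi = p' \<or> hi = q'"
  shows "linked_at (act c x) (act c z) (simple c \<langle>$\<rangle> lo) (simple c \<langle>$\<rangle> hi)"
proof (rule linked_atI)
  show "linked (act c x) (act c z)
      (simple c \<langle>$\<rangle> p) (simple c \<langle>$\<rangle> q) (simple c \<langle>$\<rangle> p') (simple c \<langle>$\<rangle> q')"
    using nx nz by (intro linked_conj[OF l c]) (simp_all only: act_apply[OF x ascx] act_apply[OF z ascz] if_False)
qed (use lh in auto)

text \<open>
  If \<open>c\<close> and \<open>c + 1\<close> are both among the four points, a look at all adjacent pairs shows
  that \<open>x\<close> and \<open>z\<close> both ascend at \<open>c\<close> only for disjoint 2-cycles \<open>(p, c)\<close> and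
  \<open>(c + 1, q')\<close> of \<open>x\<close> whose ends \<open>p\<close> and \<open>q'\<close> are joined in \<open>z\<close>. The step makes the
  cycles of \<open>x\<close> cross and joins the fixed points \<open>c\<close> and \<open>c + 1\<close> of \<open>z\<close>, so the first case
  of \<open>linked\<close> becomes the third.
\<close>

lemma linked_at_both_moved:
  assumes x: "x \<in> invols" and z: "z \<in> invols"
    and ascx: "x \<langle>$\<rangle> c < x \<langle>$\<rangle> (c + 1)" and ascz: "z \<langle>$\<rangle> c < z \<langle>$\<rangle> (c + 1)"
    and l: "linked x z p q p' q'" and c: "{c, c + 1} \<subseteq> {p, q, p', q'}"
    and lh: "lo = p \<or> lo = q" "hi = p' \<or> hi = q'"
  shows "linked_at (act c x) (act c z) (simple c \<langle>$\<rangle> lo) (simple c \<langle>$\<rangle> hi)"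
proof -
  note D = linkedD(1-6)[OF l] linked_back[OF x l]
  note out = linkedD(7)[OF l]
  have c': "c = p \<or> c = q \<or> c = p' \<or> c = q'" "c + 1 = p \<or> c + 1 = q \<or> c + 1 = p' \<or> c + 1 = q'"
    using c by auto
  from l have "q = c \<and> p' = c + 1 \<and> p < q \<and> p' < q' \<and> z \<langle>$\<rangle> p = q' \<and> z \<langle>$\<rangle> q' = p \<and>
      z \<langle>$\<rangle> q = q \<and> z \<langle>$\<rangle> p' = p'"
  proof (cases rule: linked_cases)
    case outer
    have qp: "q = c \<and> p' = c + 1"
    proof (rule ccontr)
      assume n: "\<not> ?thesis"
      then consider "p = c" "q = c + 1" | "p' = c" "q' = c + 1"
        using c' D(1-4) outer(1) by linarith
      then show False using ascx D by cases simp_all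
    qed
    have "p < q" using qp ascz outer D(1-4) by (cases "p = q"; cases "p' = q'"; simp)
    moreover have "p' < q'" using qp ascz outer D(1-4) by (cases "p = q"; cases "p' = q'"; simp)
    ultimately show ?thesis using qp outer by simp
  next
    case crossing
    then consider "p = c" "q = c + 1" | "q = c" "p' = c + 1" | "p' = c" "q' = c + 1"
      using c' D(1-4) by linarith
    then show ?thesis using ascx ascz D crossing by cases simp_all
  next
    case nesting
    then consider "p = c" "p' = c + 1" | "p' = c" "q = c + 1" | "q = c" "q' = c + 1"
      using c' D(1-4) by linarith
    then show ?thesis using ascx ascz D nesting by cases simp_all
  qed
  then have q: "q = c" "p' = c + 1" "p < c" "c + 1 < q'"
    and zs: "z \<langle>$\<rangle> p = q'" "z \<langle>$\<rangle> q' = p" "z \<langle>$\<rangle> c = c" "z \<langle>$\<rangle> (c + 1) = c + 1"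
    by auto
  have xs: "x \<langle>$\<rangle> p = c" "x \<langle>$\<rangle> c = p" "x \<langle>$\<rangle> (c + 1) = q'" "x \<langle>$\<rangle> q' = c + 1"
    using D q by simp_all
  have e: "x \<langle>$\<rangle> e \<noteq> c \<and> x \<langle>$\<rangle> e \<noteq> c + 1" if "e \<noteq> p" "e \<noteq> q'" for e
    using that xs invol_apply[OF x, of e] by metis
  have X: "act c x \<langle>$\<rangle> e = simple c \<langle>$\<rangle> (x \<langle>$\<rangle> (simple c \<langle>$\<rangle> e))" for e
    using xs q by (simp add: act_apply[OF x ascx])
  have Z: "act c z \<langle>$\<rangle> e = z \<langle>$\<rangle> (simple c \<langle>$\<rangle> e)" for e
    using zs by (simp add: act_apply[OF z ascz])
  have v: "act c x \<langle>$\<rangle> p = c + 1" "act c x \<langle>$\<rangle> c = q'" "act c z \<langle>$\<rangle> p = q'" "act c z \<langle>$\<rangle> q' = p"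
    "act c z \<langle>$\<rangle> c = c + 1" "act c z \<langle>$\<rangle> (c + 1) = c"
    using xs zs q by (simp_all add: X Z apply_simple)
  have "act c z \<langle>$\<rangle> e = act c x \<langle>$\<rangle> e" if "e \<notin> {p, c + 1, c, q'}" for e
    using that e[of e] out[of e] q by (simp add: X Z apply_simple)
  then have "linked (act c x) (act c z) p (c + 1) c q'"
    using q v by (simp add: linked_def)
  moreover have "simple c \<langle>$\<rangle> lo = p \<or> simple c \<langle>$\<rangle> lo = c + 1"
    using lh(1) q by (elim disjE) (simp_all add: apply_simple)
  moreover have "simple c \<langle>$\<rangle> hi = c \<or> simple c \<langle>$\<rangle> hi = q'"
    using lh(2) q by (elim disjE) (simp_all add: apply_simple)
  ultimately show ?thesis by (intro linked_atI)
qed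

text \<open>
  If the step joins two fixed points of \<open>x\<close> but not of \<open>z\<close>, exactly one of them is linked.
  Its cycle grows from a fixed point to \<open>(c, c + 1)\<close>, whose inner end is fixed by the
  image of \<open>z\<close>. The linked point cannot be the outer one of the two, as \<open>z\<close> would then
  descend at \<open>c\<close>.
\<close>

lemma linked_at_join_lower:
  assumes x: "x \<in> invols" and z: "z \<in> invols"
    and ascx: "x \<langle>$\<rangle> c < x \<langle>$\<rangle> (c + 1)" and ascz: "z \<langle>$\<rangle> c < z \<langle>$\<rangle> (c + 1)"
    and l: "linked x z p q p' q'" and c: "\<not> {c, c + 1} \<subseteq> {p, q, p', q'}"
    and jx: "x \<langle>$\<rangle> c = c" "x \<langle>$\<rangle> (c + 1) = c + 1"
    and nz: "\<not> (z \<langle>$\<rangle> c = c \<and> z \<langle>$\<rangle> (c + 1) = c + 1)"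
    and lh: "lo = p \<or> lo = q" "hi = p' \<or> hi = q'"
  shows "linked_at (act c x) (act c z) (simple c \<langle>$\<rangle> lo) (simple c \<langle>$\<rangle> hi)"
proof -
  note D = linkedD(1-6)[OF l] linked_back[OF x l]
  note out = linkedD(7)[OF l]
  have X: "act c x \<langle>$\<rangle> e = x \<langle>$\<rangle> (simple c \<langle>$\<rangle> e)" for e
    using jx by (simp add: act_apply[OF x ascx])
  have Z: "act c z \<langle>$\<rangle> e = simple c \<langle>$\<rangle> (z \<langle>$\<rangle> (simple c \<langle>$\<rangle> e))" for e
    unfolding act_apply[OF z ascz] using nz by (simp only: if_False)
  have zout: "z \<langle>$\<rangle> e = x \<langle>$\<rangle> e \<and> x \<langle>$\<rangle> e \<noteq> c \<and> x \<langle>$\<rangle> e \<noteq> c + 1"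
    if "e \<noteq> c" "e \<noteq> c + 1" "e \<notin> {p, q, p', q'}" for e
    using that out[of e] jx invol_apply[OF x, of e] by auto
  define A where "A = {p, q, p', q'}"
  have "c \<in> A \<or> c + 1 \<in> A"
    using nz jx out[of c] out[of "c + 1"] by (auto simp: A_def)
  then have "c \<in> A \<and> c + 1 \<notin> A \<or> c + 1 \<in> A \<and> c \<notin> A"
    using c by (auto simp: A_def)
  moreover have "p = q \<and> q = c \<or> p' = q' \<and> q' = c" if "c \<in> A"
    using that D jx by (auto simp: A_def)
  moreover have "p = q \<and> q = c + 1 \<or> p' = q' \<and> q' = c + 1" if "c + 1 \<in> A"
    using that D jx by (auto simp: A_def)
  ultimately consider
      (1) "p = c" "q = c" "c + 1 \<notin> A" | (2) "p' = c" "q' = c" "c + 1 \<notin> A"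
    | (3) "p = c + 1" "q = c + 1" "c \<notin> A" | (4) "p' = c + 1" "q' = c + 1" "c \<notin> A"
    by metis
  then show ?thesis
  proof cases
    case 1
    have "z \<langle>$\<rangle> c = q'" using l 1 D(1-4) by (cases rule: linked_cases; simp)
    moreover have "z \<langle>$\<rangle> (c + 1) = c + 1" using 1 out[of "c + 1"] jx by (simp add: A_def)
    ultimately show ?thesis using ascz 1 D by simp
  next
    case 4
    have "z \<langle>$\<rangle> (c + 1) = p" using l 4 D(1-4) by (cases rule: linked_cases; simp)
    moreover have "z \<langle>$\<rangle> c = c" using 4 out[of c] jx by (simp add: A_def)
    ultimately show ?thesis using ascz 4 D by simp
  next
    case 2
    note 2 = 2(1,2) 2(3)[unfolded A_def]
    have zs: "q < c" "z \<langle>$\<rangle> p = c" "z \<langle>$\<rangle> c = p" "p < q \<longrightarrow> z \<langle>$\<rangle> q = q"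
      using l 2 D(1-4) by (cases rule: linked_cases; simp)+
    have "z \<langle>$\<rangle> (c + 1) = c + 1" using 2 out[of "c + 1"] jx by (simp add: A_def)
    then have v: "act c x \<langle>$\<rangle> p = q" "act c x \<langle>$\<rangle> c = c + 1" "act c z \<langle>$\<rangle> p = c + 1"
      "act c z \<langle>$\<rangle> (c + 1) = p" "act c z \<langle>$\<rangle> c = c" "p < q \<longrightarrow> act c z \<langle>$\<rangle> q = q"
      using zs 2 D(1-5) jx by (simp_all add: X Z apply_simple)
    have "act c z \<langle>$\<rangle> e = act c x \<langle>$\<rangle> e" if "e \<notin> {p, q, c, c + 1}" for e
      using that zout[of e] 2 by (simp add: X Z apply_simple)
    then have "linked (act c x) (act c z) p q c (c + 1)"
      using v zs(1) 2 D(1-3) by (simp add: linked_def)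
    moreover have "simple c \<langle>$\<rangle> p = p" "simple c \<langle>$\<rangle> q = q"
      using 2 D(1) zs(1) by (simp_all add: apply_simple)
    then have "simple c \<langle>$\<rangle> lo = p \<or> simple c \<langle>$\<rangle> lo = q" using lh(1) by (elim disjE) simp_all
    moreover have "simple c \<langle>$\<rangle> hi = c \<or> simple c \<langle>$\<rangle> hi = c + 1"
      using lh(2) 2 by (simp add: apply_simple)
    ultimately show ?thesis by (intro linked_atI)
  next
    case 3
    note 3 = 3(1,2) 3(3)[unfolded A_def]
    have zs: "c + 1 < p'" "z \<langle>$\<rangle> (c + 1) = q'" "z \<langle>$\<rangle> q' = c + 1" "p' < q' \<longrightarrow> z \<langle>$\<rangle> p' = p'"
      using l 3 D(1-4) by (cases rule: linked_cases; simp)+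
    have "z \<langle>$\<rangle> c = c" using 3 out[of c] jx by (simp add: A_def)
    then have v: "act c x \<langle>$\<rangle> p' = q'" "act c x \<langle>$\<rangle> c = c + 1" "act c z \<langle>$\<rangle> c = q'"
      "act c z \<langle>$\<rangle> q' = c" "act c z \<langle>$\<rangle> (c + 1) = c + 1" "p' < q' \<longrightarrow> act c z \<langle>$\<rangle> p' = p'"
      using zs 3 D(1-4,6) jx by (simp_all add: X Z apply_simple)
    have "act c z \<langle>$\<rangle> e = act c x \<langle>$\<rangle> e" if "e \<notin> {c, c + 1, p', q'}" for e
      using that zout[of e] 3 by (simp add: X Z apply_simple)
    then have "linked (act c x) (act c z) c (c + 1) p' q'"
      using v zs(1) 3 D(1-4) by (simp add: linked_def)
    moreover have "simple c \<langle>$\<rangle> p' = p'" "simple c \<langle>$\<rangle> q' = q'"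
      using 3 D(2) zs(1) by (simp_all add: apply_simple)
    then have "simple c \<langle>$\<rangle> hi = p' \<or> simple c \<langle>$\<rangle> hi = q'" using lh(2) by (elim disjE) simp_all
    moreover have "simple c \<langle>$\<rangle> lo = c \<or> simple c \<langle>$\<rangle> lo = c + 1"
      using lh(1) 3 by (simp add: apply_simple)
    ultimately show ?thesis by (intro linked_atI)
  qed
qed

text \<open>
  If the step joined two fixed points of \<open>z\<close> but not of \<open>x\<close>, then an inner end point, \<open>q\<close>
  or \<open>p'\<close>, would be one of the two. The step would move this end of the cycle to the other
  point, so that \<open>act c x\<close> would be linked to \<open>z\<close> itself, although the two have the same
  rank.
\<close>

lemma linked_not_join_upper:
  assumes x: "x \<in> invols" and z: "z \<in> invols"
    and ascx: "x \<langle>$\<rangle> c < x \<langle>$\<rangle> (c + 1)" and rank: "invol_rank z = invol_rank x + 2"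
    and l: "linked x z p q p' q'" and c: "\<not> {c, c + 1} \<subseteq> {p, q, p', q'}"
    and jz: "z \<langle>$\<rangle> c = c" "z \<langle>$\<rangle> (c + 1) = c + 1"
    and nx: "\<not> (x \<langle>$\<rangle> c = c \<and> x \<langle>$\<rangle> (c + 1) = c + 1)"
  shows False
proof -
  note D = linkedD(1-6)[OF l] linked_back[OF x l]
  note out = linkedD(7)[OF l]
  have X: "act c x \<langle>$\<rangle> e = simple c \<langle>$\<rangle> (x \<langle>$\<rangle> (simple c \<langle>$\<rangle> e))" for e
    unfolding act_apply[OF x ascx] using nx by (simp only: if_False)
  have no_link: "\<not> linked (act c x) z P Q P' Q'" for P Q P' Q'
    using invol_rank_less_of_linked[of "act c x" z] invol_rank_act[OF x ascx] rank x z by auto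
  have A: "c \<in> {p, q, p', q'} \<or> c + 1 \<in> {p, q, p', q'}"
  proof (rule ccontr)
    assume "\<not> ?thesis"
    then have "z \<langle>$\<rangle> c = x \<langle>$\<rangle> c" "z \<langle>$\<rangle> (c + 1) = x \<langle>$\<rangle> (c + 1)"
      by (auto intro!: out)
    then show False using nx jz by simp
  qed
  have fixed: "\<exists>e \<in> {p, q, p', q'}. z \<langle>$\<rangle> e = e" using A jz by blast
  from l have "q < p' \<and> z \<langle>$\<rangle> p = q' \<and> z \<langle>$\<rangle> q' = p \<and> (p < q \<longrightarrow> z \<langle>$\<rangle> q = q) \<and>
      (p' < q' \<longrightarrow> z \<langle>$\<rangle> p' = p')"
  proof (cases rule: linked_cases)
    case outer
    then show ?thesis by simp
  next
    case crossing
    then have "\<forall>e \<in> {p, q, p', q'}. z \<langle>$\<rangle> e \<noteq> e" using D(1-4) by simp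
    then show ?thesis using fixed by blast
  next
    case nesting
    then have "\<forall>e \<in> {p, q, p', q'}. z \<langle>$\<rangle> e \<noteq> e" using D(1-4) by simp
    then show ?thesis using fixed by blast
  qed
  then have n: "q < p'" "z \<langle>$\<rangle> p = q'" "z \<langle>$\<rangle> q' = p" "p < q \<longrightarrow> z \<langle>$\<rangle> q = q" "p' < q' \<longrightarrow> z \<langle>$\<rangle> p' = p'"
    by simp_all
  have m: "e \<noteq> p \<and> e \<noteq> q' \<and> (e = q \<longrightarrow> p < q) \<and> (e = p' \<longrightarrow> p' < q')" if "z \<langle>$\<rangle> e = e" for e
    using that n D(1-4) by (intro conjI notI impI; cases "p = q"; cases "p' = q'"; simp)
  have moved: "x \<langle>$\<rangle> e \<noteq> c \<and> x \<langle>$\<rangle> e \<noteq> c + 1" if "e \<noteq> x \<langle>$\<rangle> c" "e \<noteq> x \<langle>$\<rangle> (c + 1)" for e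
    using that invol_apply[OF x, of e] by auto
  from A consider (1) "c = q" | (2) "c = p'" | (3) "c + 1 = q" | (4) "c + 1 = p'"
    using m[OF jz(1)] m[OF jz(2)] by blast
  then show False
  proof cases
    case 1
    then have 1: "q = c" "p < c" "c + 1 \<notin> {p, q, p', q'}" using m[OF jz(1)] c by auto
    then have "x \<langle>$\<rangle> (c + 1) = c + 1" using out[of "c + 1"] jz by simp
    moreover from this have "z \<langle>$\<rangle> e = x \<langle>$\<rangle> e \<and> x \<langle>$\<rangle> e \<noteq> c \<and> x \<langle>$\<rangle> e \<noteq> c + 1"
      if "e \<noteq> c + 1" "e \<notin> {p, q, p', q'}" for e
      using that moved[of e] out[of e] D 1 by simp
    ultimately have out': "z \<langle>$\<rangle> e = act c x \<langle>$\<rangle> e" if "e \<notin> {p, c + 1, p', q'}" for e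
      using that 1 jz by (cases "e = c") (simp_all add: X apply_simple)
    have "act c x \<langle>$\<rangle> p = c + 1" "act c x \<langle>$\<rangle> p' = q'"
      using 1 D n(1) by (simp_all add: X apply_simple)
    then have "linked (act c x) z p (c + 1) p' q'"
      using out' 1 D(1-4) n jz by (simp add: linked_def)
    then show False using no_link by blast
  next
    case 2
    then have 2: "p' = c" "c < q'" "c + 1 \<notin> {p, q, p', q'}" using m[OF jz(1)] c by auto
    then have "x \<langle>$\<rangle> (c + 1) = c + 1" using out[of "c + 1"] jz by simp
    then show False using ascx 2 D by auto
  next
    case 3
    then have 3: "q = c + 1" "p < c + 1" "c \<notin> {p, q, p', q'}" using m[OF jz(2)] c by auto
    then have "x \<langle>$\<rangle> c = c" using out[of c] jz by simp
    then show False using ascx 3 D by auto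
  next
    case 4
    then have 4: "p' = c + 1" "c + 1 < q'" "c \<notin> {p, q, p', q'}" using m[OF jz(2)] c by auto
    then have "x \<langle>$\<rangle> c = c" using out[of c] jz by simp
    moreover from this have "z \<langle>$\<rangle> e = x \<langle>$\<rangle> e \<and> x \<langle>$\<rangle> e \<noteq> c \<and> x \<langle>$\<rangle> e \<noteq> c + 1"
      if "e \<noteq> c" "e \<notin> {p, q, p', q'}" for e
      using that moved[of e] out[of e] D 4 by simp
    ultimately have out': "z \<langle>$\<rangle> e = act c x \<langle>$\<rangle> e" if "e \<notin> {p, q, c, q'}" for e
      using that 4 jz by (cases "e = c + 1") (simp_all add: X apply_simple)
    have "act c x \<langle>$\<rangle> p = q" "act c x \<langle>$\<rangle> c = q'"
      using 4 D n(1) by (simp_all add: X apply_simple)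
    then have "linked (act c x) z p q c q'"
      using out' 4 D(1-4) n jz by (simp add: linked_def)
    then show False using no_link by blast
  qed
qed

text \<open>
  Here \<open>c\<close> and \<open>c + 1\<close> are not linked, because \<open>x\<close> and \<open>z\<close> agree there, and the link stays
  as it is.
\<close>

lemma linked_at_both_join:
  assumes x: "x \<in> invols" and z: "z \<in> invols"
    and ascx: "x \<langle>$\<rangle> c < x \<langle>$\<rangle> (c + 1)" and ascz: "z \<langle>$\<rangle> c < z \<langle>$\<rangle> (c + 1)"
    and l: "linked x z p q p' q'"
    and jx: "x \<langle>$\<rangle> c = c" "x \<langle>$\<rangle> (c + 1) = c + 1" and jz: "z \<langle>$\<rangle> c = c" "z \<langle>$\<rangle> (c + 1) = c + 1"
    and lh: "lo = p \<or> lo = q" "hi = p' \<or> hi = q'"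
  shows "linked_at (act c x) (act c z) (simple c \<langle>$\<rangle> lo) (simple c \<langle>$\<rangle> hi)"
proof -
  have "c \<notin> {p, q, p', q'}" "c + 1 \<notin> {p, q, p', q'}"
    using jx jz unfolding linked_support[OF x l, symmetric] by simp_all
  then have s: "simple c \<langle>$\<rangle> p = p" "simple c \<langle>$\<rangle> q = q" "simple c \<langle>$\<rangle> p' = p'" "simple c \<langle>$\<rangle> q' = q'"
    by (simp_all add: apply_simple)
  have "z \<langle>$\<rangle> (simple c \<langle>$\<rangle> e) = x \<langle>$\<rangle> (simple c \<langle>$\<rangle> e)" if "e \<notin> {p, q, p', q'}" for e
    using that jx jz linkedD(7)[OF l, of e] by (simp add: apply_simple)
  then have "linked (act c x) (act c z) p q p' q'"
    using l jx jz unfolding linked_def by (simp add: act_apply[OF x ascx] act_apply[OF z ascz] s)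
  then show ?thesis using lh s by (intro linked_atI) auto
qed

lemma linked_at_act:
  assumes x: "x \<in> invols" and z: "z \<in> invols"
    and ascx: "x \<langle>$\<rangle> c < x \<langle>$\<rangle> (c + 1)" and ascz: "z \<langle>$\<rangle> c < z \<langle>$\<rangle> (c + 1)"
    and rank: "invol_rank z = invol_rank x + 2"
    and l: "linked_at x z lo hi"
  shows "linked_at (act c x) (act c z) (simple c \<langle>$\<rangle> lo) (simple c \<langle>$\<rangle> hi)"
proof -
  obtain p q p' q' where l: "linked x z p q p' q'" and lh: "lo = p \<or> lo = q" "hi = p' \<or> hi = q'"
    using l unfolding linked_at_def by blast
  consider (both) "{c, c + 1} \<subseteq> {p, q, p', q'}"
    | (conj) "\<not> {c, c + 1} \<subseteq> {p, q, p', q'}" "\<not> (x \<langle>$\<rangle> c = c \<and> x \<langle>$\<rangle> (c + 1) = c + 1)"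
        "\<not> (z \<langle>$\<rangle> c = c \<and> z \<langle>$\<rangle> (c + 1) = c + 1)"
    | (lower) "\<not> {c, c + 1} \<subseteq> {p, q, p', q'}" "x \<langle>$\<rangle> c = c" "x \<langle>$\<rangle> (c + 1) = c + 1"
        "\<not> (z \<langle>$\<rangle> c = c \<and> z \<langle>$\<rangle> (c + 1) = c + 1)"
    | (upper) "\<not> {c, c + 1} \<subseteq> {p, q, p', q'}" "z \<langle>$\<rangle> c = c" "z \<langle>$\<rangle> (c + 1) = c + 1"
        "\<not> (x \<langle>$\<rangle> c = c \<and> x \<langle>$\<rangle> (c + 1) = c + 1)"
    | (join) "x \<langle>$\<rangle> c = c" "x \<langle>$\<rangle> (c + 1) = c + 1" "z \<langle>$\<rangle> c = c" "z \<langle>$\<rangle> (c + 1) = c + 1"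
    by blast
  then show ?thesis
  proof cases
    case both
    then show ?thesis by (rule linked_at_both_moved[OF x z ascx ascz l _ lh])
  next
    case conj
    then show ?thesis by (rule linked_at_both_conj[OF x z ascx ascz l _ _ _ lh])
  next
    case lower
    then show ?thesis by (rule linked_at_join_lower[OF x z ascx ascz l _ _ _ _ lh])
  next
    case upper
    then show ?thesis using linked_not_join_upper[OF x z ascx rank l] by blast
  next
    case join
    then show ?thesis by (rule linked_at_both_join[OF x z ascx ascz l _ _ _ _ lh])
  qed
qed

section \<open>Links and the maps \<open>\<tau>\<^sub>i\<^sub>j\<close>\<close>

lemma sorted_list_of_set_doubleton:
  "a < b \<Longrightarrow> sorted_list_of_set {a, b} = [a, b :: int]"
  using sorted_list_of_set.idem_if_sorted_distinct[of "[a, b]"] by simp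

lemma sorted_list_of_set_three:
  "a < b \<Longrightarrow> b < c \<Longrightarrow> sorted_list_of_set {a, b, c} = [a, b, c :: int]"
  using sorted_list_of_set.idem_if_sorted_distinct[of "[a, b, c]"] by simp

lemma sorted_list_of_set_four:
  "a < b \<Longrightarrow> b < c \<Longrightarrow> c < d \<Longrightarrow> sorted_list_of_set {a, b, c, d} = [a, b, c, d :: int]"
  using sorted_list_of_set.idem_if_sorted_distinct[of "[a, b, c, d]"] by simp

lemma tau_fixed_fixed:
  assumes "a < b" "y \<langle>$\<rangle> a = a" "y \<langle>$\<rangle> b = b"
  shows "tau a b y = splice {a, b} \<langle>a \<leftrightarrow> b\<rangle> y"
proof -
  have "{a, b, y \<langle>$\<rangle> a, y \<langle>$\<rangle> b} = {a, b}" using assms by auto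
  then show ?thesis
    using assms by (simp add: tau_def sorted_list_of_set_doubleton agree_on_def)
qed

lemma tau_cycle_fixed:
  assumes "a < b" "b < c" "y \<langle>$\<rangle> a = b" "y \<langle>$\<rangle> b = a" "y \<langle>$\<rangle> c = c"
    and "(i, j) = (b, c) \<or> (i, j) = (a, c)"
  shows "tau i j y = splice {a, b, c} \<langle>a \<leftrightarrow> c\<rangle> y"
proof -
  have A: "{i, j, y \<langle>$\<rangle> i, y \<langle>$\<rangle> j} = {a, b, c}" using assms by auto
  show ?thesis
    unfolding tau_def Let_def A using assms(1-5) assms(6)[unfolded prod.inject]
    by (simp add: sorted_list_of_set_three agree_on_def apply_swap)
qed

lemma tau_fixed_cycle:
  assumes "a < b" "b < c" "y \<langle>$\<rangle> a = a" "y \<langle>$\<rangle> b = c" "y \<langle>$\<rangle> c = b"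
    and "(i, j) = (a, b) \<or> (i, j) = (a, c)"
  shows "tau i j y = splice {a, b, c} \<langle>a \<leftrightarrow> c\<rangle> y"
proof -
  have A: "{i, j, y \<langle>$\<rangle> i, y \<langle>$\<rangle> j} = {a, b, c}" using assms by auto
  show ?thesis
    unfolding tau_def Let_def A using assms(1-5) assms(6)[unfolded prod.inject]
    by (simp add: sorted_list_of_set_three agree_on_def apply_swap)
qed

lemma tau_disjoint_inner:
  assumes "a < b" "b < c" "c < d" "y \<langle>$\<rangle> a = b" "y \<langle>$\<rangle> b = a" "y \<langle>$\<rangle> c = d" "y \<langle>$\<rangle> d = c"
  shows "tau b c y = splice {a, b, c, d} (\<langle>a \<leftrightarrow> c\<rangle> * \<langle>b \<leftrightarrow> d\<rangle>) y"
proof -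
  have A: "{b, c, y \<langle>$\<rangle> b, y \<langle>$\<rangle> c} = {a, b, c, d}" using assms by auto
  show ?thesis
    unfolding tau_def Let_def A using assms
    by (simp add: sorted_list_of_set_four agree_on_def apply_swap apply_times)
qed

lemma tau_disjoint_outer:
  assumes "a < b" "b < c" "c < d" "y \<langle>$\<rangle> a = b" "y \<langle>$\<rangle> b = a" "y \<langle>$\<rangle> c = d" "y \<langle>$\<rangle> d = c"
    and "(i, j) = (a, c) \<or> (i, j) = (b, d) \<or> (i, j) = (a, d)"
  shows "tau i j y = splice {a, b, c, d} \<langle>a \<leftrightarrow> d\<rangle> y"
proof -
  have A: "{i, j, y \<langle>$\<rangle> i, y \<langle>$\<rangle> j} = {a, b, c, d}" using assms by auto
  show ?thesis
    unfolding tau_def Let_def A using assms(1-7) assms(8)[unfolded prod.inject]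
    by (elim disjE)
      (simp_all add: sorted_list_of_set_four agree_on_def apply_swap apply_times)
qed

lemma tau_crossing:
  assumes "a < b" "b < c" "c < d" "y \<langle>$\<rangle> a = c" "y \<langle>$\<rangle> b = d" "y \<langle>$\<rangle> c = a" "y \<langle>$\<rangle> d = b"
    and "(i, j) = (a, b) \<or> (i, j) = (c, d) \<or> (i, j) = (a, d)"
  shows "tau i j y = splice {a, b, c, d} (\<langle>a \<leftrightarrow> d\<rangle> * \<langle>b \<leftrightarrow> c\<rangle>) y"
proof -
  have A: "{i, j, y \<langle>$\<rangle> i, y \<langle>$\<rangle> j} = {a, b, c, d}" using assms by auto
  show ?thesis
    unfolding tau_def Let_def A using assms(1-7) assms(8)[unfolded prod.inject]
    by (elim disjE)
      (simp_all add: sorted_list_of_set_four agree_on_def apply_swap apply_times)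
qed

lemma splice_eqI:
  assumes "apply \<rho> ` A = A" "apply y ` A = A"
    and "\<And>e. e \<in> A \<Longrightarrow> z \<langle>$\<rangle> e = \<rho> \<langle>$\<rangle> e" "\<And>e. e \<notin> A \<Longrightarrow> z \<langle>$\<rangle> e = y \<langle>$\<rangle> e"
  shows "splice A \<rho> y = z"
  by (rule perm_eqI) (use assms in \<open>simp add: apply_splice\<close>)

text \<open>
  The indices \<open>(q, q')\<close> and \<open>(p, p')\<close> both serve, except if disjoint 2-cycles become
  crossing ones, where \<open>(q, p')\<close> is the only choice. So \<open>q\<close> occurs as the first index and
  \<open>p'\<close> as the second index in all cases.
\<close>

lemma ex_tau_of_linked:
  assumes y: "y \<in> invols" and l: "linked y z p q p' q'"
  shows "(\<exists>j > q. z = tau q j y) \<and> (\<exists>i < p'. z = tau i p' y)"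
proof -
  note D = linkedD(1-6)[OF l] linked_back[OF y l]
  note out = linkedD(7)[OF l]
  from l show ?thesis
  proof (cases rule: linked_cases)
    case outer
    consider "p = q" "p' = q'" | "p < q" "p' = q'" | "p = q" "p' < q'" | "p < q" "p' < q'"
      using D by linarith
    then have "tau q q' y = z \<and> tau p p' y = z"
    proof cases
      case 1
      then have "tau q q' y = splice {q, q'} \<langle>q \<leftrightarrow> q'\<rangle> y"
        using D by (intro tau_fixed_fixed) auto
      also have "\<dots> = z"
        using 1 D outer out by (intro splice_eqI) auto
      finally show ?thesis using 1 by simp
    next
      case 2
      have "splice {p, q, q'} \<langle>p \<leftrightarrow> q'\<rangle> y = z"
        using 2 D outer out by (intro splice_eqI) (auto simp: apply_swap)
      then show ?thesis
        using 2 D tau_cycle_fixed[of p q q' y q q'] tau_cycle_fixed[of p q q' y p p'] by simp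
    next
      case 3
      have "splice {p, p', q'} \<langle>p \<leftrightarrow> q'\<rangle> y = z"
        using 3 D outer out by (intro splice_eqI) (auto simp: apply_swap)
      then show ?thesis
        using 3 D tau_fixed_cycle[of p p' q' y q q'] tau_fixed_cycle[of p p' q' y p p'] by simp
    next
      case 4
      have "splice {p, q, p', q'} \<langle>p \<leftrightarrow> q'\<rangle> y = z"
        using 4 D outer out by (intro splice_eqI) (auto simp: apply_swap)
      then show ?thesis
        using 4 D outer tau_disjoint_outer[of p q p' q' y q q'] tau_disjoint_outer[of p q p' q' y p p']
        by simp
    qed
    then show ?thesis using D by metis
  next
    case crossing
    have "splice {p, q, p', q'} (\<langle>p \<leftrightarrow> p'\<rangle> * \<langle>q \<leftrightarrow> q'\<rangle>) y = z"
      using D crossing out by (intro splice_eqI) (auto simp: apply_swap apply_times)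
    then have "tau q p' y = z"
      using D crossing tau_disjoint_inner[of p q p' q' y] by simp
    then show ?thesis using crossing(2) by metis
  next
    case nesting
    have "splice {p, p', q, q'} (\<langle>p \<leftrightarrow> q'\<rangle> * \<langle>p' \<leftrightarrow> q\<rangle>) y = z"
      using D nesting out by (intro splice_eqI) (auto simp: apply_swap apply_times)
    then have "tau q q' y = z \<and> tau p p' y = z"
      using D nesting tau_crossing[of p p' q q' y q q'] tau_crossing[of p p' q q' y p p'] by simp
    then show ?thesis using D by metis
  qed
qed

lemma tau_cases:
  assumes "tau i j y \<noteq> y"
  obtains a b where "a < b" "agree_on {a, b} y 1" "(i, j) = (a, b)" "tau i j y = splice {a, b} \<langle>a \<leftrightarrow> b\<rangle> y"
  | a b c where "a < b" "b < c" "agree_on {a, b, c} y \<langle>a \<leftrightarrow> b\<rangle>" "(i, j) = (b, c) \<or> (i, j) = (a, c)"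
      "tau i j y = splice {a, b, c} \<langle>a \<leftrightarrow> c\<rangle> y"
  | a b c where "a < b" "b < c" "agree_on {a, b, c} y \<langle>b \<leftrightarrow> c\<rangle>" "(i, j) = (a, b) \<or> (i, j) = (a, c)"
      "tau i j y = splice {a, b, c} \<langle>a \<leftrightarrow> c\<rangle> y"
  | a b c d where "a < b" "b < c" "c < d" "agree_on {a, b, c, d} y (\<langle>a \<leftrightarrow> b\<rangle> * \<langle>c \<leftrightarrow> d\<rangle>)"
      "(i, j) = (b, c)" "tau i j y = splice {a, b, c, d} (\<langle>a \<leftrightarrow> c\<rangle> * \<langle>b \<leftrightarrow> d\<rangle>) y"
  | a b c d where "a < b" "b < c" "c < d" "agree_on {a, b, c, d} y (\<langle>a \<leftrightarrow> b\<rangle> * \<langle>c \<leftrightarrow> d\<rangle>)"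
      "(i, j) = (a, c) \<or> (i, j) = (b, d) \<or> (i, j) = (a, d)"
      "tau i j y = splice {a, b, c, d} \<langle>a \<leftrightarrow> d\<rangle> y"
  | a b c d where "a < b" "b < c" "c < d" "agree_on {a, b, c, d} y (\<langle>a \<leftrightarrow> c\<rangle> * \<langle>b \<leftrightarrow> d\<rangle>)"
      "(i, j) = (a, b) \<or> (i, j) = (c, d) \<or> (i, j) = (a, d)"
      "tau i j y = splice {a, b, c, d} (\<langle>a \<leftrightarrow> d\<rangle> * \<langle>b \<leftrightarrow> c\<rangle>) y"
proof -
  define A where "A = {i, j, y \<langle>$\<rangle> i, y \<langle>$\<rangle> j}"
  define L where "L = sorted_list_of_set A"
  have L: "set L = A" "sorted_wrt (<) L"
    by (simp_all add: L_def A_def del: sorted_list_of_set_insert_remove)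
  note tau = tau_def[of i j y, unfolded Let_def, folded A_def, folded L_def, folded L(1)]
  have "L = [] \<or> (\<exists>a. L = [a]) \<or> (\<exists>a b. L = [a, b]) \<or> (\<exists>a b c. L = [a, b, c]) \<or>
      (\<exists>a b c d. L = [a, b, c, d]) \<or> (\<exists>a b c d e l. L = a # b # c # d # e # l)"
    by (metis neq_Nil_conv)
  moreover have "tau i j y = y" if "L = []" unfolding tau that by simp
  moreover have "tau i j y = y" if "L = [a]" for a unfolding tau that by simp
  moreover have "tau i j y = y" if "L = a # b # c # d # e # l" for a b c d e l
    unfolding tau that by simp
  ultimately consider a b where "L = [a, b]" | a b c where "L = [a, b, c]"
    | a b c d where "L = [a, b, c, d]"
    using assms by metis
  then show thesis
  proof cases
    case (1 a b)
    have "a < b" using L(2) 1 by simp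
    moreover have "agree_on {a, b} y 1 \<and> (i, j) = (a, b) \<and> tau i j y = splice {a, b} \<langle>a \<leftrightarrow> b\<rangle> y"
      using assms unfolding tau 1 by (simp split: if_splits)
    ultimately show ?thesis using that(1) by blast
  next
    case (2 a b c)
    have "a < b" "b < c" using L(2) 2 by simp_all
    moreover have "agree_on {a, b, c} y \<langle>a \<leftrightarrow> b\<rangle> \<and> ((i, j) = (b, c) \<or> (i, j) = (a, c)) \<and>
        tau i j y = splice {a, b, c} \<langle>a \<leftrightarrow> c\<rangle> y \<or>
        agree_on {a, b, c} y \<langle>b \<leftrightarrow> c\<rangle> \<and> ((i, j) = (a, b) \<or> (i, j) = (a, c)) \<and>
        tau i j y = splice {a, b, c} \<langle>a \<leftrightarrow> c\<rangle> y"
      using assms unfolding tau 2 by (simp split: if_splits)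
    ultimately show ?thesis using that(2,3) by blast
  next
    case (3 a b c d)
    have abc: "a < b" "b < c" "c < d" using L(2) 3 by simp_all
    \<comment> \<open>The alternatives stay opaque here, since splitting the nested conditionals along with the comparisons of \<open>i\<close> and \<open>j\<close> gives too many cases.\<close>
    have choose: thesis
      if "t = (if P1 then s1 else if P2 then s2 else if P3 then s3 else y)" "t \<noteq> y"
        "t = s1 \<Longrightarrow> P1 \<Longrightarrow> thesis" "t = s2 \<Longrightarrow> P2 \<Longrightarrow> thesis" "t = s3 \<Longrightarrow> P3 \<Longrightarrow> thesis"
      for P1 P2 P3 and t s1 s2 s3 :: "int perm"
      using that by (simp split: if_splits)
    have "tau i j y = (if agree_on {a, b, c, d} y (\<langle>a \<leftrightarrow> b\<rangle> * \<langle>c \<leftrightarrow> d\<rangle>) \<and> (i, j) = (b, c)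
        then splice {a, b, c, d} (\<langle>a \<leftrightarrow> c\<rangle> * \<langle>b \<leftrightarrow> d\<rangle>) y
      else if agree_on {a, b, c, d} y (\<langle>a \<leftrightarrow> b\<rangle> * \<langle>c \<leftrightarrow> d\<rangle>) \<and>
        ((i, j) = (a, c) \<or> (i, j) = (b, d) \<or> (i, j) = (a, d))
        then splice {a, b, c, d} \<langle>a \<leftrightarrow> d\<rangle> y
      else if agree_on {a, b, c, d} y (\<langle>a \<leftrightarrow> c\<rangle> * \<langle>b \<leftrightarrow> d\<rangle>) \<and>
        ((i, j) = (a, b) \<or> (i, j) = (c, d) \<or> (i, j) = (a, d))
        then splice {a, b, c, d} (\<langle>a \<leftrightarrow> d\<rangle> * \<langle>b \<leftrightarrow> c\<rangle>) y
      else y)"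
      unfolding tau 3 by (simp only: list.case list.set insert_iff empty_iff simp_thms)
    note choose' = choose[OF this assms]
    show ?thesis
      by (rule choose'; erule conjE; rule that(4-6)[OF abc]; assumption)
  qed
qed

lemma linked_at_tau:
  assumes "tau i j y \<noteq> y"
  shows "linked_at y (tau i j y) i j"
proof -
  have sp: "splice A \<rho> y \<langle>$\<rangle> e = (if e \<in> A then \<rho> \<langle>$\<rangle> e else y \<langle>$\<rangle> e)"
    if "agree_on A y \<sigma>" "apply \<sigma> ` A = A" "apply \<rho> ` A = A" for A \<rho> \<sigma> e
    using that by (intro apply_splice) (simp_all add: agree_on_def cong: image_cong)
  from assms show ?thesis
  proof (cases rule: tau_cases)
    case (1 a b)
    have im: "apply 1 ` {a, b} = {a, b}" "apply \<langle>a \<leftrightarrow> b\<rangle> ` {a, b} = {a, b}" by auto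
    note s = sp[OF 1(2) im]
    have "linked y (tau i j y) a a b b"
      using 1 s by (simp add: linked_def agree_on_def)
    from linked_atI[OF this, of i j] show ?thesis using 1(3) by auto
  next
    case (2 a b c)
    have im: "apply \<langle>a \<leftrightarrow> b\<rangle> ` {a, b, c} = {a, b, c}" "apply \<langle>a \<leftrightarrow> c\<rangle> ` {a, b, c} = {a, b, c}"
      using 2(1,2) by (auto simp: apply_swap)
    note s = sp[OF 2(3) im]
    have "linked y (tau i j y) a b c c"
      using 2 s by (simp add: linked_def agree_on_def apply_swap)
    from linked_atI[OF this, of i j] show ?thesis using 2(4) by auto
  next
    case (3 a b c)
    have im: "apply \<langle>b \<leftrightarrow> c\<rangle> ` {a, b, c} = {a, b, c}" "apply \<langle>a \<leftrightarrow> c\<rangle> ` {a, b, c} = {a, b, c}"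
      using 3(1,2) by (auto simp: apply_swap)
    note s = sp[OF 3(3) im]
    have "linked y (tau i j y) a a b c"
      using 3 s by (simp add: linked_def agree_on_def apply_swap)
    from linked_atI[OF this, of i j] show ?thesis using 3(4) by auto
  next
    case (4 a b c d)
    have im: "apply (\<langle>a \<leftrightarrow> b\<rangle> * \<langle>c \<leftrightarrow> d\<rangle>) ` {a, b, c, d} = {a, b, c, d}"
      "apply (\<langle>a \<leftrightarrow> c\<rangle> * \<langle>b \<leftrightarrow> d\<rangle>) ` {a, b, c, d} = {a, b, c, d}"
      using 4(1-3) by (auto simp: apply_swap apply_times)
    note s = sp[OF 4(4) im]
    have "linked y (tau i j y) a b c d"
      using 4 s by (simp add: linked_def agree_on_def apply_swap apply_times)
    from linked_atI[OF this, of i j] show ?thesis using 4(5) by auto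
  next
    case (5 a b c d)
    have im: "apply (\<langle>a \<leftrightarrow> b\<rangle> * \<langle>c \<leftrightarrow> d\<rangle>) ` {a, b, c, d} = {a, b, c, d}"
      "apply (\<langle>a \<leftrightarrow> d\<rangle>) ` {a, b, c, d} = {a, b, c, d}"
      using 5(1-3) by (auto simp: apply_swap apply_times)
    note s = sp[OF 5(4) im]
    have "linked y (tau i j y) a b c d"
      using 5 s by (simp add: linked_def agree_on_def apply_swap apply_times)
    from linked_atI[OF this, of i j] show ?thesis using 5(5) by auto
  next
    case (6 a b c d)
    have im: "apply (\<langle>a \<leftrightarrow> c\<rangle> * \<langle>b \<leftrightarrow> d\<rangle>) ` {a, b, c, d} = {a, b, c, d}"
      "apply (\<langle>a \<leftrightarrow> d\<rangle> * \<langle>b \<leftrightarrow> c\<rangle>) ` {a, b, c, d} = {a, b, c, d}"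
      using 6(1-3) by (auto simp: apply_swap apply_times)
    note s = sp[OF 6(4) im]
    have "linked y (tau i j y) a c b d"
      using 6 s by (simp add: linked_def agree_on_def apply_swap apply_times)
    from linked_atI[OF this, of i j] show ?thesis using 6(5) by auto
  qed
qed

section \<open>Following strands through a marked word\<close>

text \<open>
  Reading the wiring diagram of a word from left to right, \<open>strand a i h\<close> is the final height of
  the wire that has height \<open>h\<close> just after position \<open>i\<close>.
\<close>

definition strand :: "int list \<Rightarrow> nat \<Rightarrow> int \<Rightarrow> int" where
  "strand a i h = inverse (word_prod (drop (Suc i) a)) \<langle>$\<rangle> h"

lemma inverse_word_prod_Cons:
  "inverse (word_prod (c # v)) \<langle>$\<rangle> h = inverse (word_prod v) \<langle>$\<rangle> (simple c \<langle>$\<rangle> h)"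
  unfolding apply_inverse_eq by (simp add: word_prod_def apply_times)

lemma inverse_word_prod_Nil: "inverse (word_prod []) \<langle>$\<rangle> h = h"
  unfolding apply_inverse_eq by (simp add: word_prod_def)

lemma inverse_word_prod_append:
  "inverse (word_prod (v @ w)) \<langle>$\<rangle> h = inverse (word_prod w) \<langle>$\<rangle> (inverse (word_prod v) \<langle>$\<rangle> h)"
  by (induction v arbitrary: h) (simp_all add: inverse_word_prod_Cons inverse_word_prod_Nil)

lemma linked_at_run:
  assumes "x \<in> invols" "z \<in> invols" "asc_word x v" "asc_word z v"
    and "invol_rank z = invol_rank x + 2" "linked_at x z lo hi"
  shows "linked_at (run x v) (run z v)
    (inverse (word_prod v) \<langle>$\<rangle> lo) (inverse (word_prod v) \<langle>$\<rangle> hi)"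
  using assms
proof (induction v arbitrary: x z lo hi)
  case Nil
  then show ?case by (simp add: inverse_word_prod_Nil)
next
  case (Cons c v)
  have asc: "x \<langle>$\<rangle> c < x \<langle>$\<rangle> (c + 1)" "z \<langle>$\<rangle> c < z \<langle>$\<rangle> (c + 1)"
    using Cons.prems(3,4) by simp_all
  have rank: "invol_rank (act c z) = invol_rank (act c x) + 2"
    using invol_rank_act[OF Cons.prems(1) asc(1)] invol_rank_act[OF Cons.prems(2) asc(2)] Cons.prems(5)
    by simp
  have "linked_at (act c x) (act c z) (simple c \<langle>$\<rangle> lo) (simple c \<langle>$\<rangle> hi)"
    using Cons.prems asc by (intro linked_at_act)
  then have "linked_at (run (act c x) v) (run (act c z) v)
    (inverse (word_prod v) \<langle>$\<rangle> (simple c \<langle>$\<rangle> lo)) (inverse (word_prod v) \<langle>$\<rangle> (simple c \<langle>$\<rangle> hi))"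
    using Cons.prems(3,4) rank
    by (intro Cons.IH act_invol Cons.prems(1,2)) simp_all
  then show ?case by (simp add: inverse_word_prod_Cons)
qed

lemma linked_at_single_act:
  assumes "x \<in> invols" "x \<langle>$\<rangle> c < x \<langle>$\<rangle> (c + 1)"
  shows "linked_at x (act c x) c (c + 1)"
  using linked_act[OF assms] by (rule linked_atI) (auto simp: min_def max_def)

text \<open>Used for involutions \<open>x\<close>, where cycles have at most two elements.\<close>

definition same_cycle :: "int perm \<Rightarrow> int \<Rightarrow> int \<Rightarrow> bool" where
  "same_cycle x e f \<longleftrightarrow> f = e \<or> f = x \<langle>$\<rangle> e"

lemma same_cycle_sym: "x \<in> invols \<Longrightarrow> same_cycle x e f \<Longrightarrow> same_cycle x f e"
  by (auto simp: same_cycle_def)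

lemma same_cycle_trans:
  "x \<in> invols \<Longrightarrow> same_cycle x e f \<Longrightarrow> same_cycle x f g \<Longrightarrow> same_cycle x e g"
  by (auto simp: same_cycle_def)

lemma same_cycle_act:
  assumes x: "x \<in> invols" and asc: "x \<langle>$\<rangle> c < x \<langle>$\<rangle> (c + 1)" and s: "same_cycle x e f"
  shows "same_cycle (act c x) (simple c \<langle>$\<rangle> e) (simple c \<langle>$\<rangle> f)"
proof (cases "x \<langle>$\<rangle> c = c \<and> x \<langle>$\<rangle> (c + 1) = c + 1")
  case True
  have "e = c \<or> e = c + 1 \<or> x \<langle>$\<rangle> e \<noteq> c \<and> x \<langle>$\<rangle> e \<noteq> c + 1"
    using True invol_apply[OF x, of e] by auto
  then show ?thesis
    using True s by (auto simp: same_cycle_def act_apply[OF x asc] apply_simple)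
next
  case False
  then have "act c x \<langle>$\<rangle> (simple c \<langle>$\<rangle> e) = simple c \<langle>$\<rangle> (x \<langle>$\<rangle> e)"
    unfolding act_apply[OF x asc] by (simp only: if_False apply_simple_simple)
  then show ?thesis using s by (auto simp: same_cycle_def)
qed

lemma same_cycle_run:
  assumes "x \<in> invols" "asc_word x v" "same_cycle x e f"
  shows "same_cycle (run x v) (inverse (word_prod v) \<langle>$\<rangle> e) (inverse (word_prod v) \<langle>$\<rangle> f)"
  using assms
proof (induction v arbitrary: x e f)
  case Nil
  then show ?case by (simp add: inverse_word_prod_Nil)
next
  case (Cons c v)
  then have "same_cycle (act c x) (simple c \<langle>$\<rangle> e) (simple c \<langle>$\<rangle> f)"
    by (intro same_cycle_act) simp_all
  then show ?case
    using Cons.IH[of "act c x"] Cons.prems(1,2) by (simp add: inverse_word_prod_Cons)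
qed

lemma linked_at_same_cycle:
  assumes x: "x \<in> invols" and "linked_at x z l h" "linked_at x z l' h'"
  shows "same_cycle x l l'" "same_cycle x h h'"
proof -
  obtain p q p' q' where l: "linked x z p q p' q'" "l \<in> {p, q}" "h \<in> {p', q'}"
    using assms(2) unfolding linked_at_def by blast
  obtain P Q P' Q' where l': "linked x z P Q P' Q'" "l' \<in> {P, Q}" "h' \<in> {P', Q'}"
    using assms(3) unfolding linked_at_def by blast
  have eq: "P = p \<and> Q = q \<and> P' = p' \<and> Q' = q'" using linked_unique[OF x l(1) l'(1)] .
  have v: "x \<langle>$\<rangle> p = q" "x \<langle>$\<rangle> q = p" "x \<langle>$\<rangle> p' = q'" "x \<langle>$\<rangle> q' = p'"
    using linkedD(5,6)[OF l(1)] linked_back[OF x l(1)] by simp_all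
  show "same_cycle x l l'" using l(2) l'(2) eq v by (auto simp: same_cycle_def)
  show "same_cycle x h h'" using l(3) l'(3) eq v by (auto simp: same_cycle_def)
qed

lemma linked_at_same_cycle_left:
  assumes x: "x \<in> invols" and "linked_at x z l h" "same_cycle x l l'"
  shows "linked_at x z l' h"
proof -
  obtain p q p' q' where l: "linked x z p q p' q'" "l \<in> {p, q}" "h \<in> {p', q'}"
    using assms(2) unfolding linked_at_def by blast
  have "l' \<in> {p, q}"
    using l(2) assms(3) linkedD(5)[OF l(1)] linked_back(1)[OF x l(1)] by (auto simp: same_cycle_def)
  then show ?thesis using l unfolding linked_at_def by blast
qed

lemma linked_at_same_cycle_right:
  assumes x: "x \<in> invols" and "linked_at x z l h" "same_cycle x h h'"
  shows "linked_at x z l h'"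
proof -
  obtain p q p' q' where l: "linked x z p q p' q'" "l \<in> {p, q}" "h \<in> {p', q'}"
    using assms(2) unfolding linked_at_def by blast
  have "h' \<in> {p', q'}"
    using l(3) assms(3) linkedD(6)[OF l(1)] linked_back(2)[OF x l(1)] by (auto simp: same_cycle_def)
  then show ?thesis using l unfolding linked_at_def by blast
qed

text \<open>
  The marked letter by itself links the cycles of the two heights that it joins, and the
  letters to its right carry the link along.
\<close>

lemma linked_at_marked:
  assumes "asc_word 1 a" "marked y (a, i)"
  shows "linked_at y (run 1 a) (strand a i (a ! i)) (strand a i (a ! i + 1))"
proof -
  have "i < length a" using assms(2) by (simp add: marked_iff)
  then obtain u s v where a: "a = u @ s # v" "length u = i" by (rule split_at)
  define x where "x = run 1 u"
  have x: "x \<in> invols" "x \<langle>$\<rangle> s < x \<langle>$\<rangle> (s + 1)" "asc_word (act s x) v"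
    using assms(1) by (simp_all add: a x_def)
  have del: "del i a = u @ v" using a del_split[of u s v] by simp
  then have v: "asc_word x v" "run x v = y"
    using assms(2) by (simp_all add: marked_iff x_def)
  have "linked_at (run x v) (run (act s x) v)
      (inverse (word_prod v) \<langle>$\<rangle> s) (inverse (word_prod v) \<langle>$\<rangle> (s + 1))"
    using x v(1) by (intro linked_at_run act_invol linked_at_single_act invol_rank_act)
  moreover have "run 1 a = run (act s x) v" "drop (Suc i) a = v" "a ! i = s"
    using a by (auto simp: x_def nth_append)
  ultimately show ?thesis by (simp add: v(2) strand_def)
qed

text \<open>
  Up to the later mark \<open>j\<close>, removing the \<open>i\<close>th letter leads to an involution \<open>x\<close>, and the
  full word leads to \<open>act c x\<close>, where \<open>c\<close> is the letter at \<open>j\<close>. Since links are unique,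
  the cycles linked by the \<open>i\<close>th letter are those of \<open>c\<close> and \<open>c + 1\<close>, and the letter \<open>c\<close>
  exchanges the two.
\<close>

lemma strand_two_marks:
  assumes "marked y (a, i)" "marked y (a, j)" "i < j"
  shows "same_cycle y (strand a i (a ! i)) (strand a j (a ! j + 1))"
    and "same_cycle y (strand a i (a ! i + 1)) (strand a j (a ! j))"
proof -
  have "j < length a" using assms(2) by (simp add: marked_iff)
  with assms(3) obtain u s v c w where
    a: "a = u @ s # v @ c # w" "length u = i" "length (u @ s # v) = j"
    by (rule split_at_two)
  have deli: "del i a = u @ v @ c # w"
    using del_split[of u s "v @ c # w"] a by simp
  have delj: "del j a = u @ s # v @ w"
    using del_split[of "u @ s # v" c w] a by simp
  define x0 where "x0 = run 1 u"
  define x where "x = run x0 v"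
  have x0: "x0 \<in> invols" and x: "x \<in> invols" by (simp_all add: x0_def x_def)
  have A: "asc_word x0 v" "x \<langle>$\<rangle> c < x \<langle>$\<rangle> (c + 1)" "asc_word (act c x) w" "run (act c x) w = y"
    using assms(1) by (simp_all add: marked_iff deli x0_def x_def)
  have B: "x0 \<langle>$\<rangle> s < x0 \<langle>$\<rangle> (s + 1)" "asc_word (act s x0) v"
    using assms(2) by (simp_all add: marked_iff delj x0_def)
  have z: "run (act s x0) v = act c x"
    using two_removals(1)[of u v c w s] assms(1,2) by (simp add: marked_iff deli delj x0_def x_def)
  define l h where "l = inverse (word_prod v) \<langle>$\<rangle> s" and "h = inverse (word_prod v) \<langle>$\<rangle> (s + 1)"
  have "linked_at x (act c x) l h"
    unfolding x_def z[unfolded x_def, symmetric] l_def h_def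
    using x0 A(1) B by (intro linked_at_run act_invol linked_at_single_act invol_rank_act)
  note cyc = linked_at_same_cycle[OF x this linked_at_single_act[OF x A(2)]]
  have *: "drop (Suc i) a = v @ c # w" "drop (Suc j) a = w" "a ! i = s" "a ! j = c"
    using a by (auto simp: nth_append)
  have strand_i: "strand a i e = inverse (word_prod w) \<langle>$\<rangle> (simple c \<langle>$\<rangle> (inverse (word_prod v) \<langle>$\<rangle> e))" for e
    by (simp add: strand_def * inverse_word_prod_append inverse_word_prod_Cons)
  have strand_j: "strand a j e = inverse (word_prod w) \<langle>$\<rangle> e" for e
    by (simp add: strand_def *)
  have c: "simple c \<langle>$\<rangle> c = c + 1" "simple c \<langle>$\<rangle> (c + 1) = c" by (simp_all add: apply_simple)
  have final: "same_cycle y (inverse (word_prod w) \<langle>$\<rangle> (simple c \<langle>$\<rangle> e)) (inverse (word_prod w) \<langle>$\<rangle> (simple c \<langle>$\<rangle> f))"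
    if "same_cycle x e f" for e f
    using same_cycle_run[OF act_invol[OF x] A(3) same_cycle_act[OF x A(2) that]] unfolding A(4) .
  show "same_cycle y (strand a i (a ! i)) (strand a j (a ! j + 1))"
    using final[OF cyc(1)] unfolding strand_i strand_j * c l_def .
  show "same_cycle y (strand a i (a ! i + 1)) (strand a j (a ! j))"
    using final[OF cyc(2)] unfolding strand_i strand_j * c h_def .
qed

lemma invol_covers_marked:
  assumes "asc_word 1 a" "marked y (a, i)"
  shows "invol_covers y (run 1 a)"
proof -
  have y: "y \<in> invols" using assms(2) by (auto simp: marked_iff)
  obtain p q p' q' where "linked y (run 1 a) p q p' q'"
    using linked_at_marked[OF assms] unfolding linked_at_def by blast
  then have "y \<prec> run 1 a" by (rule linked_bruhat_less[OF y])
  moreover have "i < length a" using assms(2) by (simp add: marked_iff)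
  then have "length a = Suc (length (del i a))" by (auto simp: del_def)
  then have "invol_rank (run 1 a) = invol_rank y + 2"
    using invol_rank_run[of 1 a] invol_rank_run[of 1 "del i a"] assms by (simp add: marked_iff)
  ultimately show ?thesis using y by (simp add: invol_covers_iff)
qed

lemma ex_marked_of_covers:
  assumes "asc_word 1 a" "invol_covers y (run 1 a)"
  shows "\<exists>i. marked y (a, i)"
  using assms by (intro ex_marked) (simp_all add: invol_covers_iff)

text \<open>
  Being the greater element of its cycle, \<open>q\<close> can only be the upper end of the lower
  linked cycle, the position in which it is a first index of \<open>\<tau>\<close>.
\<close>

lemma Phi_plus_iff:
  assumes y: "y \<in> invols" and pq: "(p, q) \<in> Cyc y"
  shows "z \<in> Phi_plus y q \<longleftrightarrow> invol_covers y z \<and> (\<exists>h. linked_at y z q h)"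
proof
  assume "z \<in> Phi_plus y q"
  then obtain j where j: "invol_covers y z" "z = tau q j y"
    by (auto simp: Phi_plus_def)
  then have "z \<noteq> y" using bruhat_less_irrefl by (auto simp: invol_covers_iff)
  then show "invol_covers y z \<and> (\<exists>h. linked_at y z q h)"
    using j linked_at_tau[of q j y] by blast
next
  assume z: "invol_covers y z \<and> (\<exists>h. linked_at y z q h)"
  then obtain P Q P' Q' where l: "linked y z P Q P' Q'" "q \<in> {P, Q}"
    unfolding linked_at_def by blast
  have "y \<langle>$\<rangle> p = q" "p \<le> q" using pq by (simp_all add: Cyc_def)
  then have "y \<langle>$\<rangle> q = p" using invol_apply[OF y, of p] by simp
  then have "q = Q"
    using l(2) linkedD(1,5)[OF l(1)] linked_back(1)[OF y l(1)] \<open>p \<le> q\<close> by auto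
  then have "\<exists>j > q. z = tau q j y"
    using ex_tau_of_linked[OF y l(1)] by simp
  then show "z \<in> Phi_plus y q"
    using z by (simp add: Phi_plus_def invol_covers_iff)
qed

text \<open>Symmetrically, \<open>p\<close> can only be the lower end of the upper linked cycle.\<close>

lemma Phi_minus_iff:
  assumes y: "y \<in> invols" and pq: "(p, q) \<in> Cyc y"
  shows "z \<in> Phi_minus y p \<longleftrightarrow> invol_covers y z \<and> (\<exists>l. linked_at y z l p)"
proof
  assume "z \<in> Phi_minus y p"
  then obtain i where i: "invol_covers y z" "z = tau i p y"
    by (auto simp: Phi_minus_def)
  then have "z \<noteq> y" using bruhat_less_irrefl by (auto simp: invol_covers_iff)
  then show "invol_covers y z \<and> (\<exists>l. linked_at y z l p)"
    using i linked_at_tau[of i p y] by blast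
next
  assume z: "invol_covers y z \<and> (\<exists>l. linked_at y z l p)"
  then obtain P Q P' Q' where l: "linked y z P Q P' Q'" "p \<in> {P', Q'}"
    unfolding linked_at_def by blast
  have "y \<langle>$\<rangle> p = q" "p \<le> q" using pq by (simp_all add: Cyc_def)
  then have "p = P'"
    using l(2) linkedD(2,6)[OF l(1)] linked_back(2)[OF y l(1)] by auto
  then have "\<exists>i < p. z = tau i p y"
    using ex_tau_of_linked[OF y l(1)] by simp
  then show "z \<in> Phi_minus y p"
    using z by (simp add: Phi_minus_def invol_covers_iff)
qed

text \<open>
  By uniqueness of links, the set to which the end point of a reduced marked word belongs
  depends on the cycles of its two strands only.
\<close>

lemma Phi_plus_words_iff:
  assumes y: "y \<in> invols" and pq: "(p, q) \<in> Cyc y"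
  shows "a \<in> (\<Union>z \<in> Phi_plus y q. invol_words z) \<longleftrightarrow>
    asc_word 1 a \<and> (\<exists>i. marked y (a, i) \<and> same_cycle y q (strand a i (a ! i)))"
proof
  assume "a \<in> (\<Union>z \<in> Phi_plus y q. invol_words z)"
  then have a: "asc_word 1 a" "run 1 a \<in> Phi_plus y q" by (auto simp: invol_words_iff)
  then obtain h where h: "invol_covers y (run 1 a)" "linked_at y (run 1 a) q h"
    using Phi_plus_iff[OF y pq] by blast
  obtain i where i: "marked y (a, i)" using ex_marked_of_covers[OF a(1) h(1)] by blast
  then show "asc_word 1 a \<and> (\<exists>i. marked y (a, i) \<and> same_cycle y q (strand a i (a ! i)))"
    using linked_at_same_cycle(1)[OF y h(2) linked_at_marked[OF a(1) i]] a(1) by blast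
next
  assume "asc_word 1 a \<and> (\<exists>i. marked y (a, i) \<and> same_cycle y q (strand a i (a ! i)))"
  then obtain i where a: "asc_word 1 a" "marked y (a, i)" "same_cycle y q (strand a i (a ! i))"
    by blast
  have "\<exists>h. linked_at y (run 1 a) q h"
    using linked_at_same_cycle_left[OF y linked_at_marked[OF a(1,2)] same_cycle_sym[OF y a(3)]] by blast
  then have "run 1 a \<in> Phi_plus y q"
    using invol_covers_marked[OF a(1,2)] Phi_plus_iff[OF y pq] by blast
  then show "a \<in> (\<Union>z \<in> Phi_plus y q. invol_words z)" using a(1) by (auto simp: invol_words_iff)
qed

lemma Phi_minus_words_iff:
  assumes y: "y \<in> invols" and pq: "(p, q) \<in> Cyc y"
  shows "a \<in> (\<Union>z \<in> Phi_minus y p. invol_words z) \<longleftrightarrow>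
    asc_word 1 a \<and> (\<exists>i. marked y (a, i) \<and> same_cycle y q (strand a i (a ! i + 1)))"
proof
  have qp: "same_cycle y q p" using pq y by (auto simp: Cyc_def same_cycle_def)
  assume "a \<in> (\<Union>z \<in> Phi_minus y p. invol_words z)"
  then have a: "asc_word 1 a" "run 1 a \<in> Phi_minus y p" by (auto simp: invol_words_iff)
  then obtain l where l: "invol_covers y (run 1 a)" "linked_at y (run 1 a) l p"
    using Phi_minus_iff[OF y pq] by blast
  obtain i where i: "marked y (a, i)" using ex_marked_of_covers[OF a(1) l(1)] by blast
  have "same_cycle y p (strand a i (a ! i + 1))"
    using linked_at_same_cycle(2)[OF y l(2) linked_at_marked[OF a(1) i]] .
  then show "asc_word 1 a \<and> (\<exists>i. marked y (a, i) \<and> same_cycle y q (strand a i (a ! i + 1)))"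
    using same_cycle_trans[OF y qp] a(1) i by blast
next
  have pq': "same_cycle y p q" using pq y by (auto simp: Cyc_def same_cycle_def)
  assume "asc_word 1 a \<and> (\<exists>i. marked y (a, i) \<and> same_cycle y q (strand a i (a ! i + 1)))"
  then obtain i where a: "asc_word 1 a" "marked y (a, i)" "same_cycle y q (strand a i (a ! i + 1))"
    by blast
  have "same_cycle y (strand a i (a ! i + 1)) p"
    using same_cycle_sym[OF y same_cycle_trans[OF y pq' a(3)]] .
  then have "\<exists>l. linked_at y (run 1 a) l p"
    using linked_at_same_cycle_right[OF y linked_at_marked[OF a(1,2)]] by blast
  then have "run 1 a \<in> Phi_minus y p"
    using invol_covers_marked[OF a(1,2)] Phi_minus_iff[OF y pq] by blast
  then show "a \<in> (\<Union>z \<in> Phi_minus y p. invol_words z)" using a(1) by (auto simp: invol_words_iff)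
qed

section \<open>Termination\<close>

text \<open>
  This holds if and only if the letter \<open>v\<close> does not occur in the involution words of \<open>x\<close>;
  what is needed of this are the effects of a single letter.
\<close>

definition preserves_below :: "int \<Rightarrow> int perm \<Rightarrow> bool" where
  "preserves_below v x \<longleftrightarrow> (\<forall>e \<le> v. x \<langle>$\<rangle> e \<le> v)"

lemma preserves_below_act_other:
  assumes x: "x \<in> invols" and "c \<noteq> v"
  shows "preserves_below v (act c x) \<longleftrightarrow> preserves_below v x"
proof (cases "x \<langle>$\<rangle> c < x \<langle>$\<rangle> (c + 1)")
  case True
  have s: "simple c \<langle>$\<rangle> e \<le> v \<longleftrightarrow> e \<le> v" for e
    using assms(2) by (auto simp: apply_simple)
  have "act c x \<langle>$\<rangle> e \<le> v \<longleftrightarrow> x \<langle>$\<rangle> (simple c \<langle>$\<rangle> e) \<le> v" for e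
    by (simp add: act_apply[OF x True] s)
  then show ?thesis
    unfolding preserves_below_def using s by (metis apply_simple_simple)
next
  case False
  then show ?thesis using act_desc[OF x] asc_or_desc[of x c] by auto
qed

lemma preserves_below_run_other:
  assumes "x \<in> invols" "v \<notin> set a"
  shows "preserves_below v (run x a) \<longleftrightarrow> preserves_below v x"
  using assms
proof (induction a arbitrary: x)
  case (Cons c a)
  then show ?case using preserves_below_act_other[of x c v] by auto
qed simp

lemma not_preserves_below_act:
  assumes x: "x \<in> invols" and asc: "x \<langle>$\<rangle> v < x \<langle>$\<rangle> (v + 1)" and pres: "preserves_below v x"
  shows "\<not> preserves_below v (act v x)"
proof -
  have above: "v < x \<langle>$\<rangle> (v + 1)"
    using pres invol_apply[OF x, of "v + 1"] unfolding preserves_below_def by (metis not_less zle_add1_eq_le less_irrefl)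
  have below: "x \<langle>$\<rangle> v \<le> v" using pres by (simp add: preserves_below_def)
  show ?thesis
  proof (cases "x \<langle>$\<rangle> v = v")
    case True
    then have "v < act v x \<langle>$\<rangle> v"
      using above by (auto simp: act_apply[OF x asc] apply_simple)
    then show ?thesis unfolding preserves_below_def by (metis not_less order_refl)
  next
    case False
    then have "v < act v x \<langle>$\<rangle> (x \<langle>$\<rangle> v)"
      using below invol_apply[OF x, of v] by (simp add: act_apply[OF x asc] apply_simple)
    then show ?thesis using below unfolding preserves_below_def by (metis not_less)
  qed
qed

text \<open>
  If the word were not reduced, it would have a second mark. Up to the later one of the
  two marks, the two removals would lead to the same involution by one word with the
  letter at position \<open>i\<close> and one word without it. But the first one moves an integer
  across the gap above this letter, and the second one does not.
\<close>

lemma asc_word_of_unique_letter: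
  assumes m: "marked y (a, i)" and unique: "\<And>k. k < length a \<Longrightarrow> k \<noteq> i \<Longrightarrow> a ! k \<noteq> a ! i"
  shows "asc_word 1 a"
proof (rule ccontr)
  assume "\<not> asc_word 1 a"
  then obtain j where j: "j \<noteq> i" "marked y (a, j)" using ex_other_mark[OF m] by blast
  have len: "i < length a" "j < length a" using m j by (simp_all add: marked_iff)
  obtain k l where kl: "k < l" "{k, l} = {i, j}" "marked y (a, k)" "marked y (a, l)" "l < length a"
    using j m len by (metis insert_commute linorder_neqE_nat)
  have ij: "i = k \<and> j = l \<or> i = l \<and> j = k" using kl(2) by (auto simp: doubleton_eq_iff)
  obtain u s v c w where a: "a = u @ s # v @ c # w" "length u = k" "length (u @ s # v) = l"
    using split_at_two[OF kl(1,5)] by blast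
  have delk: "del k a = u @ v @ c # w"
    using del_split[of u s "v @ c # w"] a by simp
  have dell: "del l a = u @ s # v @ w"
    using del_split[of "u @ s # v" c w] a by simp
  have eq: "run 1 (u @ s # v) = act c (run 1 (u @ v))"
    using two_removals(1)[of u v c w s] kl(3,4) by (simp add: marked_iff delk dell)
  have letters: "a ! k = s" "a ! l = c" using a by (auto simp: nth_append)
  have mem: "b \<noteq> a ! i" if "b \<in> set (u @ v)" for b
  proof -
    from that consider n where "n < length u" "b = u ! n" | n where "n < length v" "b = v ! n"
      by (auto simp: in_set_conv_nth)
    then obtain n where "n < length a" "n \<noteq> k" "n \<noteq> l" "b = a ! n"
    proof cases
      case (1 n)
      then show ?thesis using that[of n] a by (simp add: nth_append)
    next
      case (2 n)
      then show ?thesis using that[of "Suc (k + n)"] a by (simp add: nth_append)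
    qed
    moreover from this have "n \<noteq> i" using ij by auto
    ultimately show ?thesis using unique[of n] by simp
  qed
  have id: "preserves_below e 1" for e by (simp add: preserves_below_def)
  have ne: "s \<noteq> c" using unique[of j] len(2) j(1) letters ij by auto
  show False
  proof (cases "k = i")
    case True
    then have notin: "s \<notin> set (u @ v)" using mem letters by auto
    have asc: "asc_word 1 u" "run 1 u \<langle>$\<rangle> s < run 1 u \<langle>$\<rangle> (s + 1)"
      using kl(4) by (simp_all add: marked_iff dell)
    have "preserves_below s (run 1 (u @ v))"
      using preserves_below_run_other[OF one_invol notin] id by blast
    then have "preserves_below s (run 1 (u @ s # v))"
      unfolding eq using preserves_below_act_other[OF run_invol[OF one_invol], of c s] ne by blast
    then have "preserves_below s (run (act s (run 1 u)) v)" by simp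
    then have "preserves_below s (act s (run 1 u))"
      using preserves_below_run_other[of "act s (run 1 u)" s v] notin by simp
    moreover have "preserves_below s (run 1 u)"
      using preserves_below_run_other[of 1 s u] notin id by simp
    ultimately show False using not_preserves_below_act[OF run_invol[OF one_invol] asc(2)] by blast
  next
    case False
    then have "l = i" "k = j" using ij by auto
    then have notin: "c \<notin> set (u @ v)" using mem letters by auto
    have asc: "run 1 (u @ v) \<langle>$\<rangle> c < run 1 (u @ v) \<langle>$\<rangle> (c + 1)"
      using kl(3) by (simp add: marked_iff delk)
    have "preserves_below c (run 1 (u @ v))"
      using preserves_below_run_other[OF one_invol notin] id by blast
    then have "\<not> preserves_below c (run 1 (u @ s # v))"
      unfolding eq using not_preserves_below_act[OF run_invol[OF one_invol] asc] by blast
    moreover have "c \<notin> set (u @ s # v)" using notin ne by simp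
    then have "preserves_below c (run 1 (u @ s # v))"
      using preserves_below_run_other[OF one_invol] id by blast
    ultimately show False by blast
  qed
qed

section \<open>The Little map and its inverse\<close>

definition shift_mark :: "int \<Rightarrow> int list \<times> nat \<Rightarrow> int list \<times> nat" where
  "shift_mark d = (\<lambda>(a, i). (a[i := a ! i + d], i))"

text \<open>The Little map has \<open>d = - 1\<close>; its inverse will turn out to have \<open>d = 1\<close>.\<close>

definition bump_step :: "int \<Rightarrow> int perm \<Rightarrow> int list \<times> nat \<Rightarrow> int list \<times> nat" where
  "bump_step d y m = flip y (shift_mark d m)"

lemma little_step_eq: "little_step y = bump_step (- 1) y"
  by (rule ext)
    (simp add: little_step_def bump_step_def shift_mark_def flip_def case_prod_beta Let_def is_invol_word_iff)

lemma marked_shift_mark: "marked y m \<Longrightarrow> marked y (shift_mark d m)"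
  by (simp add: shift_mark_def marked_def case_prod_beta del_def)

lemma marked_bump_step: "marked y m \<Longrightarrow> marked y (bump_step d y m)"
  unfolding bump_step_def by (intro marked_flip marked_shift_mark)

lemma marked_bump_steps: "marked y m \<Longrightarrow> marked y ((bump_step d y ^^ n) m)"
  by (induction n) (simp_all add: marked_bump_step)

lemma shift_mark_shift_mark: "marked y m \<Longrightarrow> shift_mark (- d) (shift_mark d m) = m"
  by (cases m) (simp add: shift_mark_def marked_def)

lemma bump_terminates:
  assumes m: "marked y m" and d: "d = 1 \<or> d = - 1"
  shows "\<exists>n > 0. asc_word 1 (fst ((bump_step d y ^^ n) m))"
proof (rule ccontr)
  assume no: "\<not> ?thesis"
  define w where "w n = fst ((bump_step d y ^^ n) m)" for n
  \<comment> \<open>A letter that passed this bound would differ from all others, so the word would be reduced.\<close>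
  obtain M where M: "\<And>l. l \<in> set (w 0) \<Longrightarrow> d * l \<le> M"
    using finite_imageI[OF finite_set, of "\<lambda>l. d * l" "w 0"] by (meson Max_ge imageI)
  have inv: "(\<forall>l \<in> set (w n). d * l \<le> M) \<and> length (w n) = length (w 0) \<and>
      (\<Sum>l \<leftarrow> w n. d * l) = (\<Sum>l \<leftarrow> w 0. d * l) + int n" for n
  proof (induction n)
    case 0
    then show ?case using M by simp
  next
    case (Suc n)
    obtain a i where ai: "(bump_step d y ^^ n) m = (a, i)" by fastforce
    then have marked: "marked y (a, i)" using marked_bump_steps[OF m, of n d] by simp
    then have i: "i < length a" by (simp add: marked_def)
    define b where "b = a[i := a ! i + d]"
    have wn: "w n = a" and wSuc: "w (Suc n) = b"
      by (simp_all add: w_def ai bump_step_def shift_mark_def b_def)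
    have dd: "d * d = 1" using d by auto
    have le: "d * (a ! k) \<le> M" if "k < length a" for k
      using Suc.IH that by (simp add: wn)
    have "\<not> asc_word 1 b" using no wSuc unfolding w_def by blast
    moreover have "marked y (b, i)"
      using marked_shift_mark[OF marked, of d] by (simp add: shift_mark_def b_def)
    ultimately obtain k where k: "k < length b" "k \<noteq> i" "b ! k = b ! i"
      using asc_word_of_unique_letter[of y b i] by blast
    then have "a ! k = a ! i + d" "k < length a" using i by (simp_all add: b_def)
    then have "d * (a ! i + d) \<le> M" using le[of k] by simp
    then have setb: "\<forall>l \<in> set b. d * l \<le> M"
      using Suc.IH set_update_subset_insert[of a i "a ! i + d"] by (auto simp: b_def wn)
    have sumb: "(\<Sum>l \<leftarrow> b. d * l) = (\<Sum>l \<leftarrow> a. d * l) + 1"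
    proof -
      obtain u s v where "a = u @ s # v" "length u = i" using split_at[OF i] by blast
      then show ?thesis using dd by (auto simp: b_def distrib_left)
    qed
    have "length b = length (w 0)" "(\<Sum>l \<leftarrow> a. d * l) = (\<Sum>l \<leftarrow> w 0. d * l) + int n"
      using Suc.IH unfolding wn by (simp_all add: b_def)
    then show ?case unfolding wSuc sumb using setb by simp
  qed
  have "(\<Sum>l \<leftarrow> w 0. d * l) + int n \<le> int (length (w 0)) * M" for n
  proof -
    have "(\<Sum>l \<leftarrow> w n. d * l) \<le> (\<Sum>l \<leftarrow> w n. M)"
      using inv[of n] by (intro sum_list_mono) blast
    also have "\<dots> = int (length (w n)) * M" by (rule sum_list_triv)
    finally show ?thesis using inv[of n] by simp
  qed
  \<comment> \<open>The sum of the signed letters increases by one in each step.\<close>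
  from this[of "nat (int (length (w 0)) * M - (\<Sum>l \<leftarrow> w 0. d * l) + 1)"] show False by linarith
qed

definition bump :: "int \<Rightarrow> int perm \<Rightarrow> int list \<times> nat \<Rightarrow> int list \<times> nat" where
  "bump d y m = (bump_step d y ^^ (LEAST n. n > 0 \<and> asc_word 1 (fst ((bump_step d y ^^ n) m)))) m"

lemma little_marked_eq: "little_marked y = bump (- 1) y"
  by (rule ext) (simp add: little_marked_def bump_def little_step_eq is_invol_word_iff)

lemma bump_obtain:
  assumes m: "marked y m" and d: "d = 1 \<or> d = - 1"
  obtains N where "N > 0" "bump d y m = (bump_step d y ^^ N) m"
    "asc_word 1 (fst ((bump_step d y ^^ N) m))"
    "\<And>k. 0 < k \<Longrightarrow> k < N \<Longrightarrow> \<not> asc_word 1 (fst ((bump_step d y ^^ k) m))"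
proof -
  let ?P = "\<lambda>n. n > 0 \<and> asc_word 1 (fst ((bump_step d y ^^ n) m))"
  have "?P (LEAST n. ?P n)"
    using bump_terminates[OF assms] by (intro LeastI_ex[of ?P]) blast
  then show ?thesis
    using that[of "LEAST n. ?P n"] not_less_Least[of _ ?P] by (auto simp: bump_def)
qed

lemma bump_eqI:
  assumes "N > 0" "asc_word 1 (fst ((bump_step d y ^^ N) m))"
    and "\<And>k. 0 < k \<Longrightarrow> k < N \<Longrightarrow> \<not> asc_word 1 (fst ((bump_step d y ^^ k) m))"
  shows "bump d y m = (bump_step d y ^^ N) m"
proof -
  have "(LEAST n. n > 0 \<and> asc_word 1 (fst ((bump_step d y ^^ n) m))) = N"
    using assms by (intro Least_equality) (auto simp: not_less[symmetric])
  then show ?thesis by (simp add: bump_def)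
qed

text \<open>
  Writing a step as a shift followed by a flip, the opposite shifts undo the path from its end:
  the path read backwards visits the same words, each with its other mark.
\<close>

lemma bump_bump:
  assumes m: "marked y m" and asc: "asc_word 1 (fst m)" and d: "d = 1 \<or> d = - 1"
  shows "bump (- d) y (bump d y m) = m"
proof -
  obtain N where N: "N > 0" "bump d y m = (bump_step d y ^^ N) m"
    "asc_word 1 (fst ((bump_step d y ^^ N) m))"
    "\<And>k. 0 < k \<Longrightarrow> k < N \<Longrightarrow> \<not> asc_word 1 (fst ((bump_step d y ^^ k) m))"
    using bump_obtain[OF m d] by blast
  define f where "f k = (bump_step d y ^^ k) m" for k
  have fm: "marked y (f k)" for k unfolding f_def using m by (rule marked_bump_steps)
  have fSuc: "f (Suc k) = flip y (shift_mark d (f k))" for k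
    by (simp add: f_def bump_step_def)
  have undo: "bump_step (- d) y (shift_mark d (f k)) = flip y (f k)" for k
    by (simp add: bump_step_def shift_mark_shift_mark[OF fm])
  have path: "(bump_step (- d) y ^^ k) (f N) = shift_mark d (f (N - Suc k))" if "k < N" for k
    using that
  proof (induction k)
    case 0
    then obtain K where K: "N = Suc K" using gr0_implies_Suc by blast
    have "asc_word 1 (fst (shift_mark d (f K)))"
      using N(3) fSuc[of K] by (simp add: K f_def[symmetric] del: funpow.simps)
    then show ?case by (simp add: K fSuc flip_asc)
  next
    case (Suc k)
    then obtain K where K: "N - Suc k = Suc K" by (metis Suc_diff_Suc)
    have "(bump_step (- d) y ^^ Suc k) (f N) = flip y (f (N - Suc k))"
      using Suc by (simp add: undo)
    also have "\<dots> = shift_mark d (f K)"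
      unfolding K fSuc by (rule flip_flip[OF marked_shift_mark[OF fm]])
    finally show ?case using K by (metis diff_Suc_Suc diff_Suc_eq_diff_pred diff_commute diff_Suc_1)
  qed
  have words: "fst ((bump_step (- d) y ^^ k) (f N)) = fst (f (N - k))" if "k < N" for k
  proof -
    have "f (N - k) = flip y (shift_mark d (f (N - Suc k)))"
      using that fSuc[of "N - Suc k"] by (simp add: Suc_diff_Suc)
    then show ?thesis by (simp add: path[OF that])
  qed
  obtain K where K: "N = Suc K" using N(1) gr0_implies_Suc by blast
  have last: "(bump_step (- d) y ^^ N) (f N) = m"
    using path[of K] undo[of 0] asc by (simp add: K f_def flip_asc)
  have "bump (- d) y (f N) = (bump_step (- d) y ^^ N) (f N)"
  proof (rule bump_eqI)
    show "asc_word 1 (fst ((bump_step (- d) y ^^ N) (f N)))" using last asc by simp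
    fix k assume "0 < k" "k < N"
    then show "\<not> asc_word 1 (fst ((bump_step (- d) y ^^ k) (f N)))"
      using words[of k] N(4)[of "N - k"] by (simp add: f_def)
  qed (rule N(1))
  then show ?thesis using last N(2) by (simp add: f_def)
qed

text \<open>
  The strand on the side towards which the letter is shifted: it stays at the mark, where
  it changes from the lower to the upper one if the letter is lowered, and vice versa if
  it is raised.
\<close>

definition near_strand :: "int \<Rightarrow> int list \<times> nat \<Rightarrow> int" where
  "near_strand d = (\<lambda>(a, i). strand a i (if d = 1 then a ! i + 1 else a ! i))"

lemma near_strand_shift_mark:
  assumes "marked y m" "d = 1 \<or> d = - 1"
  shows "near_strand (- d) (shift_mark d m) = near_strand d m"
  using assms by (cases m) (auto simp: near_strand_def shift_mark_def marked_def strand_def)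

lemma near_strand_flip:
  assumes y: "y \<in> invols" and m: "marked y m" and n: "\<not> asc_word 1 (fst m)" and d: "d = 1 \<or> d = - 1"
  shows "same_cycle y (near_strand (- d) m) (near_strand d (flip y m))"
proof -
  obtain a i where ai: "m = (a, i)" by (cases m)
  obtain j where j: "flip y (a, i) = (a, j)" "j \<noteq> i" "marked y (a, j)"
    using flip_not_asc[of y a i] m n ai by auto
  have i: "marked y (a, i)" using m ai by simp
  from j(2) consider "i < j" | "j < i" by linarith
  then show ?thesis
  proof cases
    case 1
    show ?thesis
      using d strand_two_marks[OF i j(3) 1] by (auto simp: ai j(1) near_strand_def)
  next
    case 2
    show ?thesis
      using d strand_two_marks[OF j(3) i 2] same_cycle_sym[OF y] by (auto simp: ai j(1) near_strand_def)
  qed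
qed

text \<open>
  For \<open>d = - 1\<close> these are the starting points of the Little map on words over
  \<open>\<Phi>\<^sup>+(y, q)\<close>, and for \<open>d = 1\<close> the end points, with the cycle of \<open>q\<close> now on the
  other side of the mark.
\<close>

definition reduced_marks :: "int \<Rightarrow> int perm \<Rightarrow> int \<Rightarrow> (int list \<times> nat) set" where
  "reduced_marks d y q = {m. marked y m \<and> asc_word 1 (fst m) \<and> same_cycle y q (near_strand d m)}"

text \<open>
  A shift puts the cycle of \<open>q\<close> on the far side of the mark, and the following flip
  returns it to the near side. The last step has no flip.
\<close>

lemma bump_reduced_marks:
  assumes y: "y \<in> invols" and d: "d = 1 \<or> d = - 1" and m: "m \<in> reduced_marks d y q"
  shows "bump d y m \<in> reduced_marks (- d) y q"
proof -
  have mm: "marked y m" and q: "same_cycle y q (near_strand d m)"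
    using m by (simp_all add: reduced_marks_def)
  obtain N where N: "N > 0" "bump d y m = (bump_step d y ^^ N) m"
    "asc_word 1 (fst ((bump_step d y ^^ N) m))"
    "\<And>k. 0 < k \<Longrightarrow> k < N \<Longrightarrow> \<not> asc_word 1 (fst ((bump_step d y ^^ k) m))"
    using bump_obtain[OF mm d] by blast
  define f where "f k = (bump_step d y ^^ k) m" for k
  have fm: "marked y (f k)" for k unfolding f_def using mm by (rule marked_bump_steps)
  have fSuc: "f (Suc k) = flip y (shift_mark d (f k))" for k
    by (simp add: f_def bump_step_def)
  have near: "same_cycle y q (near_strand d (f k))" if "k < N" for k
    using that
  proof (induction k)
    case 0
    then show ?case using q by (simp add: f_def)
  next
    case (Suc k)
    have "\<not> asc_word 1 (fst (shift_mark d (f k)))"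
      using N(4)[of "Suc k"] Suc.prems fSuc[of k] by (simp add: f_def[symmetric] del: funpow.simps)
    from near_strand_flip[OF y marked_shift_mark[OF fm] this d]
    have "same_cycle y (near_strand d (f k)) (near_strand d (f (Suc k)))"
      by (simp add: near_strand_shift_mark[OF fm d] fSuc)
    then show ?case using Suc same_cycle_trans[OF y] by simp
  qed
  obtain K where K: "N = Suc K" using N(1) gr0_implies_Suc by blast
  have asc: "asc_word 1 (fst (f N))" using N(3) by (simp add: f_def)
  then have "f N = shift_mark d (f K)"
    using fSuc[of K] by (simp add: K flip_asc)
  then have "near_strand (- d) (f N) = near_strand d (f K)"
    by (simp add: near_strand_shift_mark[OF fm d])
  then have "f N \<in> reduced_marks (- d) y q"
    using near[of K] K asc fm by (simp add: reduced_marks_def)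
  then show ?thesis by (simp add: N(2) f_def)
qed

definition the_mark :: "int perm \<Rightarrow> int list \<Rightarrow> int list \<times> nat" where
  "the_mark y a = (a, THE i. marked y (a, i) \<and> asc_word 1 a)"

lemma the_mark_fst:
  assumes "marked y m" "asc_word 1 (fst m)"
  shows "the_mark y (fst m) = m"
proof -
  have "(THE i. marked y (fst m, i) \<and> asc_word 1 (fst m)) = snd m"
    using assms marked_unique[of "fst m" y] by (intro the_equality) auto
  then show ?thesis by (simp add: the_mark_def)
qed

lemma little_map_eq: "little_map y a = fst (bump (- 1) y (the_mark y a))"
  by (simp add: little_map_def little_marked_eq the_mark_def is_invol_word_iff)

lemma fst_bump_the_mark:
  assumes "m \<in> reduced_marks d y q"
  shows "fst (bump d y (the_mark y (fst m))) = fst (bump d y m)"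
  using assms by (simp add: reduced_marks_def the_mark_fst)

lemma bij_betw_bump_words:
  assumes y: "y \<in> invols" and d: "d = 1 \<or> d = - 1"
  shows "bij_betw (\<lambda>a. fst (bump d y (the_mark y a)))
    (fst ` reduced_marks d y q) (fst ` reduced_marks (- d) y q)"
proof -
  have fwd: "fst (bump e y (the_mark y a)) \<in> fst ` reduced_marks (- e) y q \<and>
      fst (bump (- e) y (the_mark y (fst (bump e y (the_mark y a))))) = a"
    if e: "e = 1 \<or> e = - 1" and a: "a \<in> fst ` reduced_marks e y q" for e a
  proof -
    obtain m where m: "m \<in> reduced_marks e y q" "a = fst m" using a by blast
    note b = bump_reduced_marks[OF y e m(1)]
    have "bump (- e) y (bump e y m) = m"
      using m(1) e by (intro bump_bump) (simp_all add: reduced_marks_def)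
    then show ?thesis
      using b unfolding m(2) fst_bump_the_mark[OF m(1)] fst_bump_the_mark[OF b] by auto
  qed
  have bwd: "fst (bump (- d) y (the_mark y a)) \<in> fst ` reduced_marks d y q \<and>
      fst (bump d y (the_mark y (fst (bump (- d) y (the_mark y a))))) = a"
    if "a \<in> fst ` reduced_marks (- d) y q" for a
    using fwd[of "- d" a, unfolded minus_minus, OF _ that] d by fastforce
  show ?thesis
  proof (rule bij_betw_byWitness[where f' = "\<lambda>a. fst (bump (- d) y (the_mark y a))"])
    show "\<forall>a \<in> fst ` reduced_marks d y q.
        fst (bump (- d) y (the_mark y (fst (bump d y (the_mark y a))))) = a"
      using fwd[OF d] by blast
    show "\<forall>a \<in> fst ` reduced_marks (- d) y q.
        fst (bump d y (the_mark y (fst (bump (- d) y (the_mark y a))))) = a"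
      using bwd by blast
    show "(\<lambda>a. fst (bump d y (the_mark y a))) ` fst ` reduced_marks d y q
        \<subseteq> fst ` reduced_marks (- d) y q"
      using fwd[OF d] by blast
    show "(\<lambda>a. fst (bump (- d) y (the_mark y a))) ` fst ` reduced_marks (- d) y q
        \<subseteq> fst ` reduced_marks d y q"
      using bwd by blast
  qed
qed

theorem theorem3p40:
  fixes y :: "int perm" and p q :: int
  assumes "y \<in> invols" and "(p, q) \<in> Cyc y"
  shows "bij_betw (little_map y)
           (\<Union>z \<in> Phi_plus y q. invol_words z)
           (\<Union>z \<in> Phi_minus y p. invol_words z)"
proof -
  have "(\<Union>z \<in> Phi_plus y q. invol_words z) = fst ` reduced_marks (- 1) y q"
    unfolding set_eq_iff Phi_plus_words_iff[OF assms]
    by (force simp: reduced_marks_def near_strand_def)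
  moreover have "(\<Union>z \<in> Phi_minus y p. invol_words z) = fst ` reduced_marks 1 y q"
    unfolding set_eq_iff Phi_minus_words_iff[OF assms]
    by (force simp: reduced_marks_def near_strand_def)
  moreover have "little_map y = (\<lambda>a. fst (bump (- 1) y (the_mark y a)))"
    by (rule ext) (rule little_map_eq)
  ultimately show ?thesis
    using bij_betw_bump_words[OF assms(1), of "- 1" q] by simp
qed

end
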